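(* Let $k$ be a commutative ring with unit and $A$ a unital associative $k$-algebra. For $i=0,1$, $HS_i(A)$ is the degree $i$ homology group of the (partial) chain complex $$0\longleftarrow A\xleftarrow{\ \partial_1\ }A\otimes A\otimes A\xleftarrow{\ \partial_2\ }(A\otimes A\otimes A\otimes A)\oplus A,$$ with $A$ in degree $0$, $A^{\otimes 3}$ in degree $1$ (tensor products over $k$), where $$\partial_1(a\otimes b\otimes c)=abc-cba,$$ $$\partial_2(a\otimes b\otimes c\otimes d)=ab\otimes c\otimes d+d\otimes ca\otimes b+bca\otimes 1\otimes d+d\otimes bc\otimes a,$$ and $\partial_2(a)=1\otimes a\otimes 1$ on the summand $A$.
   Context: Category $\Delta S$: objects are the sets $[n]=\{0,1,\dots,n\}$, $n\ge 0$; a morphism $[n]\to[m]$ is a set map $f$ together with a total order on each fibre $f^{-1}(j)$. The composite of $f:[n]\to[m]$ and $g:[m]\to[l]$ has underlying map $g\circ f$, and the fibre over $i$ is ordered by concatenating the ordered fibres $f^{-1}(j)$, with $j$ running over $g^{-1}(i)$ in its given order. The symmetric bar construction is the covariant functor $B_*^{sym}A:\Delta S\to k\text{-Mod}$, $[n]\mapsto A^{\otimes(n+1)}$; a morphism $\alpha:[n]\to[m]$ sends $a_0\otimes\cdots\otimes a_n$ to $b_0\otimes\cdots\otimes b_m$, where $b_j$ is the product of the $a_i$, $i\in\alpha^{-1}(j)$, in the given order of the fibre ($b_j=1$ if the fibre is empty). Symmetric homology is $HS_*(A)=\mathrm{Tor}_*^{\Delta S}(\underline{k},B_*^{sym}A)$,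 where $\underline{k}$ is the constant contravariant functor with value $k$; equivalently, the left derived functors of $\mathrm{colim}_{\Delta S}$ evaluated at $B_*^{sym}A$. *)

theory Defs
  imports "HOL-Algebra.Module" "HOL-Algebra.AbelCoset"
begin

section \<open>Modules over a commutative ring\<close>

text \<open>Modules and algebras share the record type \<open>('k, 'a) module\<close>; for plain modules the
  fields \<open>mult\<close> and \<open>one\<close> carry no meaning. The library locale \<open>algebra\<close> covers only
  commutative algebras, hence the following predicate.\<close>

definition unital_algebra :: "'k ring \<Rightarrow> ('k, 'a) module \<Rightarrow> bool" where
  "unital_algebra R A \<longleftrightarrow> module R A \<and> ring A \<and>
     (\<forall>r \<in> carrier R. \<forall>a \<in> carrier A. \<forall>b \<in> carrier A.
        (r \<odot>\<^bsub>A\<^esub> a) \<otimes>\<^bsub>A\<^esub> b = r \<odot>\<^bsub>A\<^esub> (a \<otimes>\<^bsub>A\<^esub> b) \<and>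
        a \<otimes>\<^bsub>A\<^esub> (r \<odot>\<^bsub>A\<^esub> b) = r \<odot>\<^bsub>A\<^esub> (a \<otimes>\<^bsub>A\<^esub> b))"

definition mod_hom :: "'k ring \<Rightarrow> ('k, 'm) module \<Rightarrow> ('k, 'n) module \<Rightarrow> ('m \<Rightarrow> 'n) set" where
  "mod_hom R M N = {h \<in> carrier M \<rightarrow> carrier N.
     (\<forall>x \<in> carrier M. \<forall>y \<in> carrier M. h (x \<oplus>\<^bsub>M\<^esub> y) = h x \<oplus>\<^bsub>N\<^esub> h y) \<and>
     (\<forall>r \<in> carrier R. \<forall>x \<in> carrier M. h (r \<odot>\<^bsub>M\<^esub> x) = r \<odot>\<^bsub>N\<^esub> h x)}"

definition mod_iso :: "'k ring \<Rightarrow> ('k, 'm) module \<Rightarrow> ('k, 'n) module \<Rightarrow> bool" where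
  "mod_iso R M N \<longleftrightarrow> (\<exists>h \<in> mod_hom R M N. bij_betw h (carrier M) (carrier N))"

definition zero_mod :: "('k, unit) module" where
  "zero_mod = \<lparr>carrier = {()}, mult = (\<lambda>_ _. ()), one = (), zero = (), add = (\<lambda>_ _. ()),
     smult = (\<lambda>_ _. ())\<rparr>"

definition self_mod :: "'k ring \<Rightarrow> ('k, 'k) module" where
  "self_mod R = \<lparr>carrier = carrier R, mult = mult R, one = one R, zero = zero R, add = add R,
     smult = mult R\<rparr>"

definition dsum_mod :: "('k, 'm) module \<Rightarrow> ('k, 'n) module \<Rightarrow> ('k, 'm \<times> 'n) module" where
  "dsum_mod M N = \<lparr>carrier = carrier M \<times> carrier N, mult = undefined, one = undefined,
     zero = (\<zero>\<^bsub>M\<^esub>, \<zero>\<^bsub>N\<^esub>),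
     add = (\<lambda>(x, y) (x', y'). (x \<oplus>\<^bsub>M\<^esub> x', y \<oplus>\<^bsub>N\<^esub> y')),
     smult = (\<lambda>r (x, y). (r \<odot>\<^bsub>M\<^esub> x, r \<odot>\<^bsub>N\<^esub> y))\<rparr>"

definition quot_mod :: "('k, 'm) module \<Rightarrow> 'm set \<Rightarrow> ('k, 'm set) module" where
  "quot_mod M H = \<lparr>carrier = a_rcosets\<^bsub>M\<^esub> H, mult = undefined, one = undefined,
     zero = H, add = set_add M, smult = (\<lambda>r X. \<Union>x \<in> X. H +>\<^bsub>M\<^esub> (r \<odot>\<^bsub>M\<^esub> x))\<rparr>"

definition mod_span :: "'k ring \<Rightarrow> ('k, 'm) module \<Rightarrow> 'm set \<Rightarrow> 'm set" where
  "mod_span R M Q = \<Inter>{H. submodule H R M \<and> Q \<subseteq> H}"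

text \<open>Homology at \<open>M\<close> of a sequence \<open>f : L \<rightarrow> M\<close>, \<open>g : M \<rightarrow> N\<close> with \<open>g \<circ> f = 0\<close>.\<close>

definition homology ::
  "('k, 'l) module \<Rightarrow> ('l \<Rightarrow> 'm) \<Rightarrow> ('k, 'm) module \<Rightarrow> ('m \<Rightarrow> 'n) \<Rightarrow> ('k, 'n) module
    \<Rightarrow> ('k, 'm set) module" where
  "homology L f M g N = quot_mod (M\<lparr>carrier := {x \<in> carrier M. g x = \<zero>\<^bsub>N\<^esub>}\<rparr>) (f ` carrier L)"


section \<open>Modules given by generators and relations\<close>

definition free_mod :: "'k ring \<Rightarrow> 's set \<Rightarrow> ('k, 's \<Rightarrow> 'k) module" where
  "free_mod R S = \<lparr>carrier = {f. (\<forall>s \<in> S. f s \<in> carrier R) \<and> (\<forall>s. s \<notin> S \<longrightarrow> f s = \<zero>\<^bsub>R\<^esub>) \<and>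
        finite {s. f s \<noteq> \<zero>\<^bsub>R\<^esub>}},
     mult = undefined, one = undefined, zero = (\<lambda>_. \<zero>\<^bsub>R\<^esub>),
     add = (\<lambda>f g s. f s \<oplus>\<^bsub>R\<^esub> g s), smult = (\<lambda>r f s. r \<otimes>\<^bsub>R\<^esub> f s)\<rparr>"

definition basis_vec :: "'k ring \<Rightarrow> 's \<Rightarrow> 's \<Rightarrow> 'k" where
  "basis_vec R s = (\<lambda>t. if t = s then \<one>\<^bsub>R\<^esub> else \<zero>\<^bsub>R\<^esub>)"

definition pres_mod :: "'k ring \<Rightarrow> 's set \<Rightarrow> ('s \<Rightarrow> 'k) set \<Rightarrow> ('k, ('s \<Rightarrow> 'k) set) module" where
  "pres_mod R S Q = quot_mod (free_mod R S) (mod_span R (free_mod R S) Q)"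

definition pres_gen :: "'k ring \<Rightarrow> 's set \<Rightarrow> ('s \<Rightarrow> 'k) set \<Rightarrow> 's \<Rightarrow> ('s \<Rightarrow> 'k) set" where
  "pres_gen R S Q s = mod_span R (free_mod R S) Q +>\<^bsub>free_mod R S\<^esub> basis_vec R s"

text \<open>The linear map out of \<open>pres_mod R S Q\<close> with prescribed values \<open>\<phi>\<close> on the generators. It is
  unique when it exists, and it exists iff \<open>\<phi>\<close> respects the relations \<open>Q\<close>.\<close>

definition pres_lift ::
  "'k ring \<Rightarrow> 's set \<Rightarrow> ('s \<Rightarrow> 'k) set \<Rightarrow> ('k, 'n) module \<Rightarrow> ('s \<Rightarrow> 'n)
    \<Rightarrow> ('s \<Rightarrow> 'k) set \<Rightarrow> 'n" where
  "pres_lift R S Q N \<phi> = (THE h. h \<in> mod_hom R (pres_mod R S Q) N \<and>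
     h \<in> extensional (carrier (pres_mod R S Q)) \<and> (\<forall>s \<in> S. h (pres_gen R S Q s) = \<phi> s))"


section \<open>Tensor powers\<close>

text \<open>The tensor power \<open>A \<otimes> \<dots> \<otimes> A\<close> (\<open>n\<close> factors, over \<open>R\<close>) is presented by the lists
  \<open>[a\<^sub>1, \<dots>, a\<^sub>n]\<close> modulo multilinearity in each slot.\<close>

definition tens_gens :: "('k, 'a) module \<Rightarrow> nat \<Rightarrow> 'a list set" where
  "tens_gens A n = {as. length as = n \<and> set as \<subseteq> carrier A}"

definition tens_rels :: "'k ring \<Rightarrow> ('k, 'a) module \<Rightarrow> nat \<Rightarrow> ('a list \<Rightarrow> 'k) set" where
  "tens_rels R A n = (let F = free_mod R (tens_gens A n); e = basis_vec R in
     {e (us @ [a \<oplus>\<^bsub>A\<^esub> b] @ vs) \<ominus>\<^bsub>F\<^esub> (e (us @ [a] @ vs) \<oplus>\<^bsub>F\<^esub> e (us @ [b] @ vs)) | us vs a b.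
        us @ [a] @ vs \<in> tens_gens A n \<and> b \<in> carrier A} \<union>
     {e (us @ [r \<odot>\<^bsub>A\<^esub> a] @ vs) \<ominus>\<^bsub>F\<^esub> (r \<odot>\<^bsub>F\<^esub> e (us @ [a] @ vs)) | us vs a r.
        us @ [a] @ vs \<in> tens_gens A n \<and> r \<in> carrier R})"

definition tens_pow :: "'k ring \<Rightarrow> ('k, 'a) module \<Rightarrow> nat \<Rightarrow> ('k, ('a list \<Rightarrow> 'k) set) module" where
  "tens_pow R A n = pres_mod R (tens_gens A n) (tens_rels R A n)"

definition pure :: "'k ring \<Rightarrow> ('k, 'a) module \<Rightarrow> 'a list \<Rightarrow> ('a list \<Rightarrow> 'k) set" where
  "pure R A as = pres_gen R (tens_gens A (length as)) (tens_rels R A (length as)) as"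

definition tens_lift ::
  "'k ring \<Rightarrow> ('k, 'a) module \<Rightarrow> nat \<Rightarrow> ('k, 'n) module \<Rightarrow> ('a list \<Rightarrow> 'n)
    \<Rightarrow> ('a list \<Rightarrow> 'k) set \<Rightarrow> 'n" where
  "tens_lift R A n = pres_lift R (tens_gens A n) (tens_rels R A n)"


section \<open>Modules over a small category and Tor\<close>

text \<open>\<open>Cmp C g f\<close> is the composite "first \<open>f\<close>, then \<open>g\<close>".\<close>

record ('o, 'm) cat =
  Ob :: "'o set"
  Ar :: "'m set"
  Dom :: "'m \<Rightarrow> 'o"
  Cod :: "'m \<Rightarrow> 'o"
  Idn :: "'o \<Rightarrow> 'm"
  Cmp :: "'m \<Rightarrow> 'm \<Rightarrow> 'm"

text \<open>The data of a functor to modules, of either variance.\<close>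

record ('o, 'm, 'k, 'p) catmod =
  fob :: "'o \<Rightarrow> ('k, 'p) module"
  far :: "'m \<Rightarrow> 'p \<Rightarrow> 'p"

definition co_functor :: "'k ring \<Rightarrow> ('o, 'm) cat \<Rightarrow> ('o, 'm, 'k, 'p) catmod \<Rightarrow> bool" where
  "co_functor R C F \<longleftrightarrow>
     (\<forall>x \<in> Ob C. module R (fob F x)) \<and>
     (\<forall>f \<in> Ar C. far F f \<in> mod_hom R (fob F (Dom C f)) (fob F (Cod C f))) \<and>
     (\<forall>x \<in> Ob C. \<forall>v \<in> carrier (fob F x). far F (Idn C x) v = v) \<and>
     (\<forall>f \<in> Ar C. \<forall>g \<in> Ar C. Cod C f = Dom C g \<longrightarrow>
        (\<forall>v \<in> carrier (fob F (Dom C f)). far F (Cmp C g f) v = far F g (far F f v)))"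

definition contra_functor :: "'k ring \<Rightarrow> ('o, 'm) cat \<Rightarrow> ('o, 'm, 'k, 'p) catmod \<Rightarrow> bool" where
  "contra_functor R C F \<longleftrightarrow>
     (\<forall>x \<in> Ob C. module R (fob F x)) \<and>
     (\<forall>f \<in> Ar C. far F f \<in> mod_hom R (fob F (Cod C f)) (fob F (Dom C f))) \<and>
     (\<forall>x \<in> Ob C. \<forall>v \<in> carrier (fob F x). far F (Idn C x) v = v) \<and>
     (\<forall>f \<in> Ar C. \<forall>g \<in> Ar C. Cod C f = Dom C g \<longrightarrow>
        (\<forall>v \<in> carrier (fob F (Cod C g)). far F (Cmp C g f) v = far F f (far F g v)))"

definition contra_nat ::
  "'k ring \<Rightarrow> ('o, 'm) cat \<Rightarrow> ('o, 'm, 'k, 'p) catmod \<Rightarrow> ('o, 'm, 'k, 'q) catmod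
    \<Rightarrow> ('o \<Rightarrow> 'p \<Rightarrow> 'q) \<Rightarrow> bool" where
  "contra_nat R C F G \<eta> \<longleftrightarrow>
     (\<forall>x \<in> Ob C. \<eta> x \<in> mod_hom R (fob F x) (fob G x)) \<and>
     (\<forall>f \<in> Ar C. \<forall>v \<in> carrier (fob F (Cod C f)).
        \<eta> (Dom C f) (far F f v) = far G f (\<eta> (Cod C f) v))"

definition const_functor :: "'k ring \<Rightarrow> ('o, 'm, 'k, 'k) catmod" where
  "const_functor R = \<lparr>fob = (\<lambda>_. self_mod R), far = (\<lambda>_ v. v)\<rparr>"

text \<open>Projectivity in the category of contravariant functors: lifting along pointwise
  surjections \<open>X \<rightarrow> Y\<close>. A definition cannot quantify over types, so \<open>X\<close> and \<open>Y\<close> range over functors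
  with values in two fixed types. Nothing is lost: these types accommodate the identity
  \<open>P \<rightarrow> Y = P\<close> and the canonical free cover \<open>X \<rightarrow> P\<close>, where \<open>X(x)\<close> is free on the pairs \<open>(p, f)\<close> with
  \<open>f\<close> an arrow out of \<open>x\<close> and \<open>p \<in> P(Cod f)\<close>. A lift of the identity makes \<open>P\<close> a direct summand of
  a sum of representable functors, and hence projective against functors of all types.\<close>

definition projective ::
  "'k ring \<Rightarrow> ('o, 'm) cat \<Rightarrow> ('o, 'm, 'k, 'p) catmod \<Rightarrow> bool" where
  "projective R C P \<longleftrightarrow> contra_functor R C P \<and>
     (\<forall>(X :: ('o, 'm, 'k, 'p \<times> 'm \<Rightarrow> 'k) catmod) (Y :: ('o, 'm, 'k, 'p) catmod) \<pi> \<phi>.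
        contra_functor R C X \<and> contra_functor R C Y \<and>
        contra_nat R C X Y \<pi> \<and> (\<forall>x \<in> Ob C. \<pi> x ` carrier (fob X x) = carrier (fob Y x)) \<and>
        contra_nat R C P Y \<phi>
        \<longrightarrow> (\<exists>\<psi>. contra_nat R C P X \<psi> \<and>
              (\<forall>x \<in> Ob C. \<forall>v \<in> carrier (fob P x). \<pi> x (\<psi> x v) = \<phi> x v)))"

text \<open>\<open>\<dots> \<rightarrow> P 1 \<rightarrow> P 0 \<rightarrow> N \<rightarrow> 0\<close> with \<open>d n : P (n + 1) \<rightarrow> P n\<close> and augmentation \<open>\<epsilon> : P 0 \<rightarrow> N\<close>.\<close>

definition projective_resolution ::
  "'k ring \<Rightarrow> ('o, 'm) cat \<Rightarrow> ('o, 'm, 'k, 'q) catmod \<Rightarrow> (nat \<Rightarrow> ('o, 'm, 'k, 'p) catmod)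
    \<Rightarrow> (nat \<Rightarrow> 'o \<Rightarrow> 'p \<Rightarrow> 'p) \<Rightarrow> ('o \<Rightarrow> 'p \<Rightarrow> 'q) \<Rightarrow> bool" where
  "projective_resolution R C N P d \<epsilon> \<longleftrightarrow>
     (\<forall>n. projective R C (P n)) \<and>
     (\<forall>n. contra_nat R C (P (Suc n)) (P n) (d n)) \<and>
     contra_nat R C (P 0) N \<epsilon> \<and>
     (\<forall>x \<in> Ob C.
        \<epsilon> x ` carrier (fob (P 0) x) = carrier (fob N x) \<and>
        d 0 x ` carrier (fob (P 1) x) = {v \<in> carrier (fob (P 0) x). \<epsilon> x v = \<zero>\<^bsub>fob N x\<^esub>} \<and>
        (\<forall>n. d (Suc n) x ` carrier (fob (P (Suc (Suc n))) x)
               = {v \<in> carrier (fob (P (Suc n)) x). d n x v = \<zero>\<^bsub>fob (P n) x\<^esub>}))"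

text \<open>The tensor product of a contravariant functor \<open>P\<close> and a covariant functor \<open>M\<close> over \<open>C\<close>: the
  quotient of the direct sum over \<open>x\<close> of \<open>P(x) \<otimes> M(x)\<close> by \<open>P(f)(p) \<otimes> m = p \<otimes> M(f)(m)\<close>. The triple
  \<open>(x, p, m)\<close> stands for \<open>p \<otimes> m\<close> in the summand of \<open>x\<close>.\<close>

definition ftens_gens ::
  "('o, 'm) cat \<Rightarrow> ('o, 'm, 'k, 'p) catmod \<Rightarrow> ('o, 'm, 'k, 'v) catmod \<Rightarrow> ('o \<times> 'p \<times> 'v) set" where
  "ftens_gens C P M = {(x, p, m). x \<in> Ob C \<and> p \<in> carrier (fob P x) \<and> m \<in> carrier (fob M x)}"

definition ftens_rels ::
  "'k ring \<Rightarrow> ('o, 'm) cat \<Rightarrow> ('o, 'm, 'k, 'p) catmod \<Rightarrow> ('o, 'm, 'k, 'v) catmod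
    \<Rightarrow> ('o \<times> 'p \<times> 'v \<Rightarrow> 'k) set" where
  "ftens_rels R C P M = (let F = free_mod R (ftens_gens C P M); e = basis_vec R in
     {e (x, p \<oplus>\<^bsub>fob P x\<^esub> q, m) \<ominus>\<^bsub>F\<^esub> (e (x, p, m) \<oplus>\<^bsub>F\<^esub> e (x, q, m)) | x p q m.
        (x, p, m) \<in> ftens_gens C P M \<and> (x, q, m) \<in> ftens_gens C P M} \<union>
     {e (x, p, m \<oplus>\<^bsub>fob M x\<^esub> n) \<ominus>\<^bsub>F\<^esub> (e (x, p, m) \<oplus>\<^bsub>F\<^esub> e (x, p, n)) | x p m n.
        (x, p, m) \<in> ftens_gens C P M \<and> (x, p, n) \<in> ftens_gens C P M} \<union>
     {e (x, r \<odot>\<^bsub>fob P x\<^esub> p, m) \<ominus>\<^bsub>F\<^esub> (r \<odot>\<^bsub>F\<^esub> e (x, p, m)) | x p m r.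
        (x, p, m) \<in> ftens_gens C P M \<and> r \<in> carrier R} \<union>
     {e (x, p, r \<odot>\<^bsub>fob M x\<^esub> m) \<ominus>\<^bsub>F\<^esub> (r \<odot>\<^bsub>F\<^esub> e (x, p, m)) | x p m r.
        (x, p, m) \<in> ftens_gens C P M \<and> r \<in> carrier R} \<union>
     {e (Dom C f, far P f p, m) \<ominus>\<^bsub>F\<^esub> e (Cod C f, p, far M f m) | f p m.
        f \<in> Ar C \<and> p \<in> carrier (fob P (Cod C f)) \<and> m \<in> carrier (fob M (Dom C f))})"

definition ftens ::
  "'k ring \<Rightarrow> ('o, 'm) cat \<Rightarrow> ('o, 'm, 'k, 'p) catmod \<Rightarrow> ('o, 'm, 'k, 'v) catmod
    \<Rightarrow> ('k, ('o \<times> 'p \<times> 'v \<Rightarrow> 'k) set) module" where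
  "ftens R C P M = pres_mod R (ftens_gens C P M) (ftens_rels R C P M)"

definition ftens_map ::
  "'k ring \<Rightarrow> ('o, 'm) cat \<Rightarrow> ('o, 'm, 'k, 'v) catmod \<Rightarrow> ('o, 'm, 'k, 'p) catmod
    \<Rightarrow> ('o, 'm, 'k, 'q) catmod \<Rightarrow> ('o \<Rightarrow> 'p \<Rightarrow> 'q)
    \<Rightarrow> ('o \<times> 'p \<times> 'v \<Rightarrow> 'k) set \<Rightarrow> ('o \<times> 'q \<times> 'v \<Rightarrow> 'k) set" where
  "ftens_map R C M P P' \<eta> = pres_lift R (ftens_gens C P M) (ftens_rels R C P M) (ftens R C P' M)
     (\<lambda>(x, p, m). pres_gen R (ftens_gens C P' M) (ftens_rels R C P' M) (x, \<eta> x p, m))"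

text \<open>\<open>Tor\<^sub>i(N, M)\<close> over \<open>C\<close>, computed from a projective resolution \<open>(P, d)\<close> of the contravariant
  functor \<open>N\<close>; up to isomorphism it does not depend on the resolution.\<close>

fun tor ::
  "'k ring \<Rightarrow> ('o, 'm) cat \<Rightarrow> (nat \<Rightarrow> ('o, 'm, 'k, 'p) catmod) \<Rightarrow> (nat \<Rightarrow> 'o \<Rightarrow> 'p \<Rightarrow> 'p)
    \<Rightarrow> ('o, 'm, 'k, 'v) catmod \<Rightarrow> nat \<Rightarrow> ('k, ('o \<times> 'p \<times> 'v \<Rightarrow> 'k) set set) module" where
  "tor R C P d M 0 =
     homology (ftens R C (P 1) M) (ftens_map R C M (P 1) (P 0) (d 0)) (ftens R C (P 0) M)
       (\<lambda>_. ()) zero_mod"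
| "tor R C P d M (Suc i) =
     homology (ftens R C (P (Suc (Suc i))) M)
       (ftens_map R C M (P (Suc (Suc i))) (P (Suc i)) (d (Suc i))) (ftens R C (P (Suc i)) M)
       (ftens_map R C M (P (Suc i)) (P i) (d i)) (ftens R C (P i) M)"


section \<open>The category \<open>\<Delta>S\<close> and symmetric homology\<close>

text \<open>The object \<open>[n] = {0, \<dots>, n}\<close> is represented by \<open>n\<close>. The total order on the fibre over \<open>j\<close> is
  given by the list \<open>fib f j\<close> enumerating that fibre in increasing order. Outside \<open>{0, \<dots>, n}\<close> the
  underlying map is \<open>undefined\<close>, so that equal morphisms are equal records.\<close>

record ds_arrow =
  src :: nat
  tgt :: nat
  und :: "nat \<Rightarrow> nat"
  fib :: "nat \<Rightarrow> nat list"

definition is_ds_arrow :: "ds_arrow \<Rightarrow> bool" where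
  "is_ds_arrow f \<longleftrightarrow> und f \<in> {..src f} \<rightarrow>\<^sub>E {..tgt f} \<and>
     (\<forall>j. distinct (fib f j) \<and> set (fib f j) = {i \<in> {..src f}. und f i = j})"

definition DeltaS :: "(nat, ds_arrow) cat" where
  "DeltaS = \<lparr>Ob = UNIV, Ar = {f. is_ds_arrow f}, Dom = src, Cod = tgt,
     Idn = (\<lambda>n. \<lparr>src = n, tgt = n, und = restrict id {..n},
                 fib = (\<lambda>j. if j \<le> n then [j] else [])\<rparr>),
     Cmp = (\<lambda>g f. \<lparr>src = src f, tgt = tgt g, und = compose {..src f} (und g) (und f),
                   fib = (\<lambda>i. concat (map (fib f) (fib g i)))\<rparr>)\<rparr>"

definition list_prod :: "('k, 'a) module \<Rightarrow> 'a list \<Rightarrow> 'a" where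
  "list_prod A as = foldr (mult A) as (one A)"

definition Bsym :: "'k ring \<Rightarrow> ('k, 'a) module \<Rightarrow> (nat, ds_arrow, 'k, ('a list \<Rightarrow> 'k) set) catmod" where
  "Bsym R A = \<lparr>fob = (\<lambda>n. tens_pow R A (n + 1)),
     far = (\<lambda>\<alpha>. tens_lift R A (src \<alpha> + 1) (tens_pow R A (tgt \<alpha> + 1))
              (\<lambda>as. pure R A (map (\<lambda>j. list_prod A (map ((!) as) (fib \<alpha> j))) [0..<tgt \<alpha> + 1])))\<rparr>"

definition HS ::
  "'k ring \<Rightarrow> ('k, 'a) module \<Rightarrow> (nat \<Rightarrow> (nat, ds_arrow, 'k, 'p) catmod)
    \<Rightarrow> (nat \<Rightarrow> nat \<Rightarrow> 'p \<Rightarrow> 'p) \<Rightarrow> nat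
    \<Rightarrow> ('k, (nat \<times> 'p \<times> ('a list \<Rightarrow> 'k) set \<Rightarrow> 'k) set set) module" where
  "HS R A P d = tor R DeltaS P d (Bsym R A)"

end

theory Submission
  imports Defs
begin

text \<open>
  Let \<open>F\<^sub>0 = k[\<Delta>S(-,[0])]\<close> and \<open>F\<^sub>1 = k[\<Delta>S(-,[2])]\<close>. At \<open>[n]\<close> the former is free on the permutations of
  \<open>{0, \<dots>, n}\<close> and the latter on the triples of words \<open>(X, Y, Z)\<close> whose concatenation is such a permutation. The two arrows
  \<open>[2] \<rightarrow> [0]\<close> with fibre orders \<open>0, 1, 2\<close> and \<open>2, 1, 0\<close> give \<open>F\<^sub>1 \<rightarrow> F\<^sub>0\<close>, \<open>(X, Y, Z) \<mapsto> XYZ - ZYX\<close>. Since block swaps connect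
  all permutations, \<open>F\<^sub>1 \<rightarrow> F\<^sub>0 \<rightarrow> k \<rightarrow> 0\<close> is exact. The kernel of \<open>F\<^sub>1 \<rightarrow> F\<^sub>0\<close> is generated by the elements
  \<open>(WX, Y, Z) + (Z, YW, X) + (XYW, 1, Z) + (Z, XY, W)\<close> and \<open>(1, X, 1)\<close>: modulo these the triples admit a potential,
  \<open>(X, Y, Z) = s(XYZ) - s(ZYX)\<close>, so every cycle vanishes. The potential is found by first contracting the rotations
  \<open>(X, 1, Z)\<close> and then by induction on the length of a common prefix. Hence the kernel is a quotient of
  \<open>k[\<Delta>S(-,[3])] \<oplus> k[\<Delta>S(-,[0])]\<close>, and tensoring with the bar construction yields the stated complex. The comparison with an
  arbitrary projective resolution is the usual homotopy argument.
\<close>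

section \<open>Potentials on permutations\<close>


text \<open>The four-term relation is a closed walk: the boundaries of its four triples are the
  steps WXYZ, ZYWX, XYWZ, ZXYW and back to WXYZ. Exactness at F1 says that these walks, with the
  trivial steps (1, X, 1), generate all closed walks on permutations whose steps are block reversals
  XYZ -> ZYX. A potential is the dual form of this claim, and it may take values in any abelian
  group. It is applied in the third tensor power of A modulo the image of the second differential,
  to the classes obtained by pushing a fixed tensor w along the arrows (X, Y, Z). On a cycle, the
  sum of s(XYZ) - s(ZYX) is the linear extension of s evaluated at the zero boundary. The obstacle
  in finding s is that a reversal disturbs every position of a word. Once rotations are subtracted,
  the remaining cocycle is alternating in its three words and invariant under their cyclic
  permutation. Cutting cyclic words at a marked letter z turns a reversal into a swap of two
  adjacent blocks behind a fixed prefix, which can be treated letter by letter.\<close>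

lemma move_to_front_invariant:
  assumes front: "\<And>U c X. distinct (U @ c # X) \<Longrightarrow> set (U @ c # X) = L \<Longrightarrow> E (U @ c # X) = E (c # U @ X)"
    and w: "distinct w" "set w = L" and v: "distinct v" "set v = L"
  shows "E w = E v"
proof -
  \<comment> \<open>The target \<open>v\<close> is assembled from its right end: after the letters
    of the suffix \<open>v2\<close> have been pulled to the front one at a time, the word is
    \<open>v2\<close> followed by the untouched rest of \<open>w\<close>.\<close>
  have "distinct (v2 @ filter (\<lambda>x. x \<notin> set v2) w) \<and> set (v2 @ filter (\<lambda>x. x \<notin> set v2) w) = L
      \<and> E w = E (v2 @ filter (\<lambda>x. x \<notin> set v2) w)" if "v = v1 @ v2" for v1 v2
    using that
  proof (induction v2 arbitrary: v1)
    case Nil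
    then show ?case using w by simp
  next
    case (Cons c v2)
    let ?r = "filter (\<lambda>x. x \<notin> set v2) w"
    from Cons.prems have "v = (v1 @ [c]) @ v2" by simp
    note IH = Cons.IH[OF this]
    have "c \<in> set ?r" using Cons.prems w v by auto
    then obtain U X where r: "?r = U @ c # X" by (meson split_list)
    have "distinct ?r" using w by simp
    then have "c \<notin> set U" "c \<notin> set X" unfolding r by simp_all
    then have "filter (\<lambda>x. x \<noteq> c) U = U" "filter (\<lambda>x. x \<noteq> c) X = X"
      unfolding filter_id_conv by blast+
    then have "filter (\<lambda>x. x \<noteq> c) ?r = U @ X" unfolding r by simp
    moreover have "filter (\<lambda>x. x \<notin> set (c # v2)) w = filter (\<lambda>x. x \<noteq> c) ?r"
      by (auto intro: filter_cong)
    ultimately have *: "filter (\<lambda>x. x \<notin> set (c # v2)) w = U @ X" by simp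
    have ok: "distinct ((v2 @ U) @ c # X)" "set ((v2 @ U) @ c # X) = L"
      using IH unfolding r by simp_all
    have "E (v2 @ ?r) = E (c # v2 @ U @ X)" using front[OF ok] unfolding r by simp
    moreover have "distinct (c # v2 @ U @ X)" "set (c # v2 @ U @ X) = L" using ok by auto
    ultimately show ?case using IH * by simp
  qed
  from this[of "[]" v] have "E w = E (v @ filter (\<lambda>x. x \<notin> set v) w)" by simp
  also have "filter (\<lambda>x. x \<notin> set v) w = []" using w v by (auto simp: filter_empty_conv)
  finally show ?thesis by simp
qed

section \<open>Potentials for swaps of adjacent blocks\<close>

text \<open>The cocycle \<open>f B Y Z\<close> is attached to the move of a word \<open>B @ Y @ Z\<close> to \<open>B @ Z @ Y\<close>.\<close>

locale word_swap =
  fixes f :: "'x list \<Rightarrow> 'x list \<Rightarrow> 'x list \<Rightarrow> 'q::ab_group_add" and L :: "'x set"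
  assumes finL: "finite L"
    \<comment> \<open>Both identities hold for f B Y Z = t(BYZ) - t(BZY). In \<open>rot\<close> the
      passage from BWXY to BYWX goes through BXYW; in \<open>four\<close> both sides pair up the
      same four words.\<close>
    and rot: "\<And>B W X Y. distinct (B @ W @ X @ Y) \<Longrightarrow> set (B @ W @ X @ Y) = L \<Longrightarrow>
      f B (W @ X) Y = f B X (Y @ W) + f B W (X @ Y)"
    and four: "\<And>B Y A Z. distinct (B @ Y @ A @ Z) \<Longrightarrow> set (B @ Y @ A @ Z) = L \<Longrightarrow>
      f B (Y @ A) Z + f B (Z @ A) Y = f (B @ Y) A Z + f (B @ Z) A Y"
begin

lemma nil_left: "distinct (B @ Y) \<Longrightarrow> set (B @ Y) = L \<Longrightarrow> f B [] Y = 0"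
  using rot[of B "[]" "[]" Y] by simp

lemma anti:
  assumes "distinct (B @ Y @ Z)" "set (B @ Y @ Z) = L"
  shows "f B Y Z = - f B Z Y"
proof -
  have "f (B @ Y) [] Z = 0" "f (B @ Z) [] Y = 0"
    using assms by (auto intro!: nil_left)
  then show ?thesis using four[of B Y "[]" Z] assms by (simp add: eq_neg_iff_add_eq_0)
qed

lemma nil_right: "distinct (B @ Y) \<Longrightarrow> set (B @ Y) = L \<Longrightarrow> f B Y [] = 0"
  using anti[of B Y "[]"] nil_left[of B Y] by simp

text \<open>Potentials \<open>s c\<close> on the words with prefix \<open>B @ [c]\<close> have to be adjusted by constants \<open>\<kappa> c\<close>. The
  defect \<open>g c Y d Z\<close> of the given potentials turns out to depend only on the letters \<open>c\<close> and \<open>d\<close>, and as a function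
  \<open>K c d\<close> of these it is a cocycle.\<close>

lemma potential_step:
  fixes B s
  assumes s: "\<And>c X Y Z. distinct (B @ c # X @ Y @ Z) \<Longrightarrow> set (B @ c # X @ Y @ Z) = L \<Longrightarrow>
      f (B @ c # X) Y Z = s c (X @ Y @ Z) - s c (X @ Z @ Y)"
  shows "\<exists>t. \<forall>X Y Z. distinct (B @ X @ Y @ Z) \<longrightarrow> set (B @ X @ Y @ Z) = L \<longrightarrow>
      f (B @ X) Y Z = t (X @ Y @ Z) - t (X @ Z @ Y)"
proof (cases "distinct B \<and> set B \<subset> L")
  \<comment> \<open>Either no word of the required kind has prefix \<open>B\<close>, or
    \<open>B\<close> already uses every letter of \<open>L\<close> and X, Y, Z are all
    empty.\<close>
  case False
  have "f (B @ X) Y Z = 0" if "distinct (B @ X @ Y @ Z)" "set (B @ X @ Y @ Z) = L" for X Y Z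
  proof -
    from that False have "X = [] \<and> Y = [] \<and> Z = []"
      by (cases X; cases Y; cases Z) auto
    then show ?thesis using nil_left[of B "[]"] that by simp
  qed
  then show ?thesis by (intro exI[of _ "\<lambda>_. 0"]) simp
next
  case True
  define ok where "ok c d u \<longleftrightarrow> distinct (B @ c # d # u) \<and> set (B @ c # d # u) = L" for c d u
  define g where "g c Y d Z = f B (c # Y) (d # Z) - s c (Y @ d # Z) + s d (Z @ c # Y)" for c Y d Z
  define G where "G c d u = g c [] d u" for c d u
  have g_anti: "g c Y d Z = - g d Z c Y" if "ok c d (Y @ Z)" for c Y d Z
    using anti[of B "c # Y" "d # Z"] that unfolding g_def ok_def by auto
  \<comment> \<open>This is \<open>four\<close> for the blocks cY, A, dZ. Its right side consists of
    values behind the longer prefixes, which \<open>s c\<close> and \<open>s d\<close> express and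
    which absorb the corrections built into \<open>g\<close>.\<close>
  have g_shift: "g c (Y @ A) d Z = g c Y d (Z @ A)" if ok: "ok c d (Y @ A @ Z)" for c Y A d Z
  proof -
    have e: "f (B @ c # Y) A (d # Z) = s c (Y @ A @ d # Z) - s c (Y @ d # Z @ A)"
      "f (B @ d # Z) A (c # Y) = s d (Z @ A @ c # Y) - s d (Z @ c # Y @ A)"
      using ok unfolding ok_def by (auto intro!: s[of _ _ _ "_ # _", simplified])
    have "f B (c # Y @ A) (d # Z) + f B (d # Z @ A) (c # Y)
        = f (B @ c # Y) A (d # Z) + f (B @ d # Z) A (c # Y)"
      using four[of B "c # Y" A "d # Z"] ok unfolding ok_def by auto
    then have "f B (c # Y @ A) (d # Z) + f B (d # Z @ A) (c # Y)
        - (s c (Y @ A @ d # Z) - s c (Y @ d # Z @ A) + (s d (Z @ A @ c # Y) - s d (Z @ c # Y @ A))) = 0"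
      unfolding e by simp
    then have "g c (Y @ A) d Z + g d (Z @ A) c Y = 0"
      unfolding g_def by (simp add: algebra_simps)
    moreover have "g d (Z @ A) c Y = - g c Y d (Z @ A)"
      using ok by (intro g_anti) (auto simp: ok_def)
    ultimately show ?thesis by simp
  qed
  have g_G: "g c Y d Z = G c d (Z @ Y)" if "ok c d (Y @ Z)" for c Y d Z
    using g_shift[of c d "[]" Y Z] that unfolding G_def by simp
  \<comment> \<open>This is \<open>rot\<close> for blocks beginning with the letters c, e, d. The
    potentials enter \<open>g\<close> as a coboundary, so they cancel in the sum.\<close>
  have G_cocycle: "G c d (Y @ W @ e # X) = G e d (Y @ c # W @ X) + G c e (X @ d # Y @ W)"
    if ok: "ok c d (Y @ W @ e # X)" for c d e Y W X
  proof -
    have "f B (c # W @ e # X) (d # Y) = f B (e # X) (d # Y @ c # W) + f B (c # W) (e # X @ d # Y)"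
      using rot[of B "c # W" "e # X" "d # Y"] ok unfolding ok_def by auto
    then have "g c (W @ e # X) d Y = g e X d (Y @ c # W) + g c W e (X @ d # Y)"
      unfolding g_def by simp
    moreover have "g c (W @ e # X) d Y = G c d (Y @ W @ e # X)"
      "g e X d (Y @ c # W) = G e d (Y @ c # W @ X)"
      "g c W e (X @ d # Y) = G c e (X @ d # Y @ W)"
      using ok by (subst g_G; auto simp: ok_def)+
    ultimately show ?thesis by simp
  qed
  \<comment> \<open>Two ways of dividing the same word between Y and W give the same left side and
    the same last term in \<open>G_cocycle\<close>; comparing the remaining terms moves
    \<open>c\<close> to the front.\<close>
  have G_front: "G e d (U @ c # X) = G e d (c # U @ X)" if ok: "ok e d (U @ c # X)" for e d c U X
    using G_cocycle[of c d U "[]" e X] G_cocycle[of c d "[]" U e X] ok by (auto simp: ok_def)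
  have G_perm: "G e d u = G e d v" if ok: "ok e d u" and v: "distinct v" "set u = set v" for e d u v
  proof (rule move_to_front_invariant[of "set u"])
    fix U c X assume "distinct (U @ c # X)" "set (U @ c # X) = set u"
    then have "ok e d (U @ c # X)" using ok unfolding ok_def by simp
    then show "G e d (U @ c # X) = G e d (c # U @ X)" by (rule G_front)
  qed (use ok v in \<open>simp_all add: ok_def\<close>)
  define K where "K c d = G c d (SOME u. ok c d u)" for c d
  have G_K: "G c d u = K c d" if ok: "ok c d u" for c d u
  proof -
    define w where "w = (SOME u. ok c d u)"
    have w: "ok c d w" unfolding w_def using ok by (rule someI)
    have "distinct v \<and> set v = L - set B - {c, d}" if "ok c d v" for v
      using that unfolding ok_def by auto
    from this[OF ok] this[OF w] have "G c d u = G c d w" by (intro G_perm[OF ok]) simp_all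
    then show ?thesis unfolding K_def w_def .
  qed
  have ex_ok: "\<exists>u. ok c d u" if "c \<in> L - set B" "d \<in> L - set B" "c \<noteq> d" for c d
  proof -
    obtain u where "set u = L - set B - {c, d}" "distinct u"
      using finite_distinct_list[of "L - set B - {c, d}"] finL by auto
    then show ?thesis using that True by (intro exI[of _ u]) (auto simp: ok_def)
  qed
  have K_anti: "K c d = - K d c" if cd: "c \<in> L - set B" "d \<in> L - set B" "c \<noteq> d" for c d
  proof -
    obtain u where u: "ok c d u" using ex_ok[OF cd] by blast
    then have "ok d c u" unfolding ok_def by auto
    then have "g d u c [] = K d c" using g_G[of d c u "[]"] G_K[of d c u] by simp
    then show ?thesis using g_anti[of c d "[]" u] G_K[OF u] u unfolding G_def by simp
  qed
  have K_cocycle: "K c d = K e d + K c e"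
    if cd: "c \<in> L - set B" "d \<in> L - set B" "e \<in> L - set B" "c \<noteq> d" "c \<noteq> e" "d \<noteq> e" for c d e
  proof -
    obtain u where u: "ok c d u" using ex_ok[of c d] cd by blast
    then have "e \<in> set u" using cd unfolding ok_def by auto
    then obtain U X where "u = U @ e # X" by (meson split_list)
    with u have ok: "ok c d (U @ [] @ e # X)" by simp
    have "ok c d (U @ e # X)" "ok e d (U @ c # X)" "ok c e (X @ d # U)"
      using ok unfolding ok_def by auto
    from this[THEN G_K] show ?thesis using G_cocycle[OF ok] by simp
  qed
  obtain c0 where c0: "c0 \<in> L - set B" using True by auto
  \<comment> \<open>An additive cocycle on letters is a coboundary, with primitive obtained by
    fixing one argument at \<open>c0\<close>. The value at \<open>c0\<close> itself is set to 0,
    since \<open>K c0 c0\<close> would refer to words with a repeated letter.\<close>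
  define \<kappa> where "\<kappa> c = (if c = c0 then 0 else K c c0)" for c
  have K_\<kappa>: "K c d = \<kappa> c - \<kappa> d" if cd: "c \<in> L - set B" "d \<in> L - set B" "c \<noteq> d" for c d
    using K_anti[of c0 d] K_cocycle[of c d c0] K_anti[of d c0] c0 cd unfolding \<kappa>_def by auto
  define t where "t w = (case w of [] \<Rightarrow> 0 | c # u \<Rightarrow> s c u + \<kappa> c)" for w
  have "f (B @ X) Y Z = t (X @ Y @ Z) - t (X @ Z @ Y)"
    if ok: "distinct (B @ X @ Y @ Z)" "set (B @ X @ Y @ Z) = L" for X Y Z
  proof (cases X)
    case (Cons c X')
    then show ?thesis using s[of c X' Y Z] ok unfolding t_def by simp
  next
    case Nil
    show ?thesis
    proof (cases Y)
      case [simp]: Nil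
      show ?thesis using nil_left[of "B" Z] ok \<open>X = []\<close> by simp
    next
      case Y: (Cons c Y')
      show ?thesis
      proof (cases Z)
        case [simp]: Nil
        show ?thesis using nil_right[of "B" Y] ok \<open>X = []\<close> by simp
      next
        case Z: (Cons d Z')
        have "ok c d (Y' @ Z')" using ok Nil Y Z unfolding ok_def by auto
        moreover from this have "ok c d (Z' @ Y')" unfolding ok_def by auto
        ultimately have "g c Y' d Z' = K c d" using g_G[of c d Y' Z'] G_K by simp
        also have "\<dots> = \<kappa> c - \<kappa> d" using ok Nil Y Z by (intro K_\<kappa>) auto
        finally show ?thesis using Nil Y Z unfolding g_def t_def by (simp add: algebra_simps)
      qed
    qed
  qed
  then show ?thesis by blast
qed

text \<open>Induction on the number of letters still missing from the prefix: a prefix as long as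
  \<open>L\<close> leaves only empty words, and a shorter one glues the potentials of its one-letter
  extensions. The later application is to the empty prefix.\<close>

lemma potential_prefix:
  "\<exists>t. \<forall>X Y Z. distinct (B @ X @ Y @ Z) \<longrightarrow> set (B @ X @ Y @ Z) = L \<longrightarrow>
      f (B @ X) Y Z = t (X @ Y @ Z) - t (X @ Z @ Y)"
proof (induction "card L - length B" arbitrary: B rule: less_induct)
  case less
  show ?case
  proof (cases "length B < card L")
    case True
    then have "\<forall>c. \<exists>t. \<forall>X Y Z. distinct ((B @ [c]) @ X @ Y @ Z) \<longrightarrow> set ((B @ [c]) @ X @ Y @ Z) = L \<longrightarrow>
      f ((B @ [c]) @ X) Y Z = t (X @ Y @ Z) - t (X @ Z @ Y)"
      by (intro allI less) simp
    then obtain s where "\<forall>c. \<forall>X Y Z. distinct ((B @ [c]) @ X @ Y @ Z) \<longrightarrow> set ((B @ [c]) @ X @ Y @ Z) = L \<longrightarrow>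
      f ((B @ [c]) @ X) Y Z = s c (X @ Y @ Z) - s c (X @ Z @ Y)" by metis
    then show ?thesis by (intro potential_step[of B s]) simp
  next
    case False
    have "f (B @ X) Y Z = 0" if "distinct (B @ X @ Y @ Z)" "set (B @ X @ Y @ Z) = L" for X Y Z
    proof -
      have "length (B @ X @ Y @ Z) = card L" using that distinct_card by metis
      with False have "X = [] \<and> Y = [] \<and> Z = []" by (simp flip: length_0_conv)
      then show ?thesis using nil_left[of B "[]"] that by simp
    qed
    then show ?thesis by (intro exI[of _ "\<lambda>_. 0"]) simp
  qed
qed

end

section \<open>Potentials for the four-term relation\<close>

definition splits :: "'x set \<Rightarrow> 'x list \<Rightarrow> 'x list \<Rightarrow> 'x list \<Rightarrow> bool" where
  "splits L X Y Z \<longleftrightarrow> distinct (X @ Y @ Z) \<and> set (X @ Y @ Z) = L"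

text \<open>\<open>br X Y Z\<close> stands for the class of the triple (X, Y, Z) modulo the proposed
  relations; \<open>z\<close> is the letter at which cyclic words will be cut.\<close>

locale word_block =
  fixes br :: "'x list \<Rightarrow> 'x list \<Rightarrow> 'x list \<Rightarrow> 'q::ab_group_add" and L :: "'x set" and z :: 'x
  assumes fin: "finite L" and zL: "z \<in> L"
    and four: "\<And>W X Y Z. distinct (W @ X @ Y @ Z) \<Longrightarrow> set (W @ X @ Y @ Z) = L \<Longrightarrow>
      br (W @ X) Y Z + br Z (Y @ W) X + br (X @ Y @ W) [] Z + br Z (X @ Y) W = 0"
    and one: "\<And>X. distinct X \<Longrightarrow> set X = L \<Longrightarrow> br [] X [] = 0"
begin

abbreviation ok :: "'x list \<Rightarrow> 'x list \<Rightarrow> 'x list \<Rightarrow> bool" where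
  "ok \<equiv> splits L"

text \<open>Instances of \<open>four\<close> with empty words give a chain of sign rules. Each rule
  cancels terms in the next instance, ending with antisymmetry under reversal in
  \<open>br_anti\<close>.\<close>

lemma br_first: "ok X [] [] \<Longrightarrow> br X [] [] = 0"
  using four[of "[]" "[]" X "[]"] one[of X] by (simp add: splits_def)

lemma br_nil_left: "ok X Y [] \<Longrightarrow> br [] Y X = - br X Y []"
  using four[of "[]" X Y "[]"] one[of "X @ Y"] br_first[of "X @ Y"]
  by (simp add: splits_def eq_neg_iff_add_eq_0 add.commute)

lemma br_nil_right: "ok Z Y [] \<Longrightarrow> br Z Y [] = - br Y [] Z"
  using four[of "[]" "[]" Y Z] br_nil_left[of Z Y]
  by (auto simp: splits_def Int_commute Un_commute eq_neg_iff_add_eq_0 add.commute)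

lemma br_mid_anti: "ok X [] Z \<Longrightarrow> br X [] Z = - br Z [] X"
  using four[of "[]" X "[]" Z] br_nil_right[of Z X]
  by (auto simp: splits_def Int_commute Un_commute eq_neg_iff_add_eq_0 add.commute)

lemma br_anti: "ok X Y Z \<Longrightarrow> br X Y Z = - br Z Y X"
  using four[of "[]" X Y Z] br_nil_right[of Z "X @ Y"]
  by (auto simp: splits_def Int_commute Un_commute Un_left_commute Int_Un_distrib Int_Un_distrib2
      eq_neg_iff_add_eq_0)

lemma br_split:
  assumes "ok (W @ X) Y Z"
  shows "br (W @ X) Y Z = br X (Y @ W) Z - br (X @ Y @ W) [] Z + br W (X @ Y) Z"
proof -
  have "br Z (Y @ W) X = - br X (Y @ W) Z" "br Z (X @ Y) W = - br W (X @ Y) Z"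
    using assms by (auto intro!: br_anti simp: splits_def)
  then show ?thesis using four[of W X Y Z] assms by (auto simp: splits_def algebra_simps)
qed

text \<open>The rotation from YWX to WXY factors through XYW. The identity comes from
  \<open>br_split\<close> with empty last word, where the middle term vanishes by
  \<open>br_first\<close>.\<close>

lemma br_rot:
  assumes "ok Y W X"
  shows "br Y [] (W @ X) = br (Y @ W) [] X + br (X @ Y) [] W"
proof -
  have "br (W @ X) Y [] = br X (Y @ W) [] - br (X @ Y @ W) [] [] + br W (X @ Y) []"
    using assms by (intro br_split) (auto simp: splits_def)
  moreover have "br (W @ X) Y [] = - br Y [] (W @ X)" "br X (Y @ W) [] = - br (Y @ W) [] X"
    "br W (X @ Y) [] = - br (X @ Y) [] W" "br (X @ Y @ W) [] [] = 0"
    using assms by (auto intro!: br_nil_right br_first simp: splits_def)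
  ultimately have "- br Y [] (W @ X) = - (br (Y @ W) [] X + br (X @ Y) [] W)" by simp
  then show ?thesis by (simp only: neg_equal_iff_equal)
qed

text \<open>\<open>t\<close> is a potential for the rotations \<open>Z @ X \<rightarrow> X @ Z\<close>, normalised to vanish on words starting with
  \<open>z\<close>. Subtracting its coboundary leaves a cocycle \<open>c\<close> on cyclic words.\<close>

definition t :: "'x list \<Rightarrow> 'q" where
  "t w = br (takeWhile (\<lambda>x. x \<noteq> z) w) [] (dropWhile (\<lambda>x. x \<noteq> z) w)"

lemma t_split: "distinct (A @ z # B) \<Longrightarrow> t (A @ z # B) = br A [] (z # B)"
  unfolding t_def by (subst takeWhile_append2 dropWhile_append2, force)+ simp

lemma br_t:
  assumes "ok X [] Z"
  shows "br X [] Z = t (X @ Z) - t (Z @ X)"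
proof -
  have *: "br X [] Z = t (X @ Z) - t (Z @ X)" if ok: "ok X [] Z" and z: "z \<in> set X" for X Z
  proof -
    obtain A B where X: "X = A @ z # B" using z by (meson split_list)
    \<comment> \<open>Cutting X at \<open>z\<close> makes the two terms on the right values of
      \<open>t\<close>, at ZX directly and at XZ after a change of sign.\<close>
    have "br Z [] (A @ z # B) = br (Z @ A) [] (z # B) + br ((z # B) @ Z) [] A"
      using ok unfolding X by (intro br_rot) (auto simp: splits_def)
    moreover have "br ((z # B) @ Z) [] A = - br A [] ((z # B) @ Z)" "br X [] Z = - br Z [] X"
      using ok unfolding X by (auto intro!: br_mid_anti simp: splits_def)
    moreover have "t (X @ Z) = br A [] ((z # B) @ Z)"
      using t_split[of A "B @ Z"] ok unfolding X by (auto simp: splits_def)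
    moreover have "t (Z @ X) = br (Z @ A) [] (z # B)"
      using t_split[of "Z @ A" B] ok unfolding X by (auto simp: splits_def)
    ultimately show ?thesis unfolding X by simp
  qed
  show ?thesis
  proof (cases "z \<in> set X")
    case True
    then show ?thesis using * assms by blast
  next
    case False
    then have "br Z [] X = t (Z @ X) - t (X @ Z)"
      using assms zL by (intro *) (auto simp: splits_def)
    then show ?thesis using br_mid_anti[OF assms] by simp
  qed
qed

definition c :: "'x list \<Rightarrow> 'x list \<Rightarrow> 'x list \<Rightarrow> 'q" where
  "c X Y Z = br X Y Z - t (X @ Y @ Z) + t (Z @ Y @ X)"

lemma c_mid: "ok X [] Z \<Longrightarrow> c X [] Z = 0"
  unfolding c_def by (simp add: br_t)

lemma c_anti: "ok X Y Z \<Longrightarrow> c X Y Z = - c Z Y X"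
  unfolding c_def by (simp add: br_anti[of X Y Z])

text \<open>The correction by \<open>t\<close> removes exactly the rotation term of
  \<open>br_split\<close>.\<close>

lemma c_split:
  assumes "ok (W @ X) Y Z"
  shows "c (W @ X) Y Z = c X (Y @ W) Z + c W (X @ Y) Z"
proof -
  have "br (X @ Y @ W) [] Z = t ((X @ Y @ W) @ Z) - t (Z @ X @ Y @ W)"
    using assms by (intro br_t) (auto simp: splits_def)
  then show ?thesis using br_split[OF assms] unfolding c_def by simp
qed

text \<open>Split WX over an empty middle word, where \<open>c\<close> vanishes. Together with
  \<open>c_anti\<close> this makes \<open>c\<close> alternating in its three words.\<close>

lemma c_swap:
  assumes "ok X W Z"
  shows "c X W Z = - c W X Z"
proof -
  have "ok (W @ X) [] Z" using assms by (auto simp: splits_def)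
  then show ?thesis using c_split[of W X "[]" Z] c_mid[of "W @ X" Z]
    by (simp add: eq_neg_iff_add_eq_0)
qed

lemma c_rot: 
  assumes "ok X Y Z"
  shows "c X Y Z = c Z X Y"
proof -
  have "c X Y Z = - c Z Y X" using assms by (rule c_anti)
  also have "c Z Y X = - c Y Z X" using assms by (intro c_swap) (auto simp: splits_def)
  also have "c Y Z X = - c X Z Y" using assms by (intro c_anti) (auto simp: splits_def)
  also have "c X Z Y = - c Z X Y" using assms by (intro c_swap) (auto simp: splits_def)
  finally show ?thesis by simp
qed

lemma c_swap_right:
  assumes "ok X Y Z"
  shows "c X Y Z = - c X Z Y"
proof -
  have "c Z X Y = - c X Z Y" using assms by (intro c_swap) (auto simp: splits_def)
  then show ?thesis using c_rot[OF assms] by simp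
qed

text \<open>As a cyclic word ZYX is the same as XZY. For X = zB the value \<open>c X Y Z\<close>
  therefore belongs to the swap zBYZ -> zBZY, and reading what follows \<open>z\<close> gives linear
  words in the other letters.\<close>

sublocale swap: word_swap "\<lambda>B. c (z # B)" "L - {z}"
proof
  show "finite (L - {z})" using fin by simp
next
  fix B W X Y assume "distinct (B @ W @ X @ Y)" and "set (B @ W @ X @ Y) = L - {z}"
  then have ok: "ok (W @ X) Y (z # B)" using zL by (auto simp: splits_def)
  have "c (W @ X) Y (z # B) = c (z # B) (W @ X) Y" "c X (Y @ W) (z # B) = c (z # B) X (Y @ W)"
    "c W (X @ Y) (z # B) = c (z # B) W (X @ Y)"
    using ok by (auto intro!: c_rot simp: splits_def)
  then show "c (z # B) (W @ X) Y = c (z # B) X (Y @ W) + c (z # B) W (X @ Y)"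
    using c_split[OF ok] by simp
next
  fix B Y A Z assume "distinct (B @ Y @ A @ Z)" and "set (B @ Y @ A @ Z) = L - {z}"
  then have ok: "ok (A @ z # B) Y Z" and ok': "ok (A @ z # B) Z Y" using zL by (auto simp: splits_def)
  have "c A (z # B @ Y) Z = - c (z # B @ Y) A Z" "c A (z # B @ Z) Y = - c (z # B @ Z) A Y"
    using ok by (auto intro!: c_swap simp: splits_def)
  moreover have "c (A @ z # B) Y Z = - c (A @ z # B) Z Y"
    using ok by (rule c_swap_right)
  ultimately show "c (z # B) (Y @ A) Z + c (z # B) (Z @ A) Y = c (z # B @ Y) A Z + c (z # B @ Z) A Y"
    using c_split[OF ok] c_split[OF ok'] by (simp add: algebra_simps)
qed

theorem potential: "\<exists>s. \<forall>X Y Z. ok X Y Z \<longrightarrow> br X Y Z = s (X @ Y @ Z) - s (Z @ Y @ X)"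
proof -
  obtain u where u: "\<And>X Y Z. distinct (X @ Y @ Z) \<Longrightarrow> set (X @ Y @ Z) = L - {z} \<Longrightarrow>
      c (z # X) Y Z = u (X @ Y @ Z) - u (X @ Z @ Y)"
    using swap.potential_prefix[of "[]"] by auto
  \<comment> \<open>\<open>v\<close> applies \<open>u\<close> to the cyclic word read from just
    behind \<open>z\<close>, so it is invariant under rotation.\<close>
  define v where "v w = u (tl (dropWhile (\<lambda>x. x \<noteq> z) w) @ takeWhile (\<lambda>x. x \<noteq> z) w)" for w
  have v: "v (A @ z # B) = u (B @ A)" if "distinct (A @ z # B)" for A B
  proof -
    have "takeWhile (\<lambda>x. x \<noteq> z) (A @ z # B) = A" "dropWhile (\<lambda>x. x \<noteq> z) (A @ z # B) = z # B"
      using that by (subst takeWhile_append2 dropWhile_append2, force, simp)+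
    then show ?thesis unfolding v_def by simp
  qed
  have first: "c X Y Z = v (X @ Y @ Z) - v (Z @ Y @ X)" if ok: "ok X Y Z" and z: "z \<in> set X" for X Y Z
  proof -
    obtain A B where X: "X = A @ z # B" using z by (meson split_list)
    \<comment> \<open>Splitting off the part A in front of \<open>z\<close> yields two swaps behind
      \<open>z\<close>. Their values of \<open>u\<close> at BYAZ cancel, which leaves BYZA and
      BZYA.\<close>
    have *: "c X Y Z = c (z # B) (Y @ A) Z + c A (z # B @ Y) Z"
      using c_split[of A "z # B" Y Z] ok unfolding X by simp
    have "c (z # B) (Y @ A) Z = u (B @ (Y @ A) @ Z) - u (B @ Z @ Y @ A)"
      using ok unfolding X by (intro u) (auto simp: splits_def)
    moreover have "c A (z # B @ Y) Z = - c (z # B @ Y) A Z"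
      using ok unfolding X by (intro c_swap) (auto simp: splits_def)
    moreover have "c (z # B @ Y) A Z = u ((B @ Y) @ A @ Z) - u ((B @ Y) @ Z @ A)"
      using ok unfolding X by (intro u) (auto simp: splits_def)
    moreover have "v (X @ Y @ Z) = u (B @ Y @ Z @ A)"
      using v[of A "B @ Y @ Z"] ok unfolding X by (auto simp: splits_def)
    moreover have "v (Z @ Y @ X) = u (B @ Z @ Y @ A)"
      using v[of "Z @ Y @ A" B] ok unfolding X by (auto simp: splits_def)
    ultimately show ?thesis using * by simp
  qed
  have cv: "c X Y Z = v (X @ Y @ Z) - v (Z @ Y @ X)" if ok: "ok X Y Z" for X Y Z
  proof -
    consider "z \<in> set X" | "z \<in> set Y" | "z \<in> set Z" using ok zL by (auto simp: splits_def)
    then show ?thesis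
    proof cases
      case 1
      then show ?thesis using first ok by blast
    next
      case 3
      then have "c Z Y X = v (Z @ Y @ X) - v (X @ Y @ Z)"
        using ok by (intro first) (auto simp: splits_def)
      then show ?thesis using c_anti[OF ok] by simp
    next
      \<comment> \<open>Exchanging X and Y brings \<open>z\<close> into the first word. The
        resulting words are rotations of the desired ones, on which \<open>v\<close> agrees.\<close>
      case 2
      obtain A B where Y: "Y = A @ z # B" using 2 by (meson split_list)
      have "c Y X Z = v (Y @ X @ Z) - v (Z @ X @ Y)"
        using ok 2 by (intro first) (auto simp: splits_def)
      moreover have "v (Y @ X @ Z) = v (Z @ Y @ X)"
        unfolding Y using v[of A "B @ X @ Z"] v[of "Z @ A" "B @ X"] ok[unfolded Y]
        by (simp add: splits_def Int_Un_distrib Int_Un_distrib2 Int_commute)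
      moreover have "v (Z @ X @ Y) = v (X @ Y @ Z)"
        unfolding Y using v[of "Z @ X @ A" B] v[of "X @ A" "B @ Z"] ok[unfolded Y]
        by (simp add: splits_def Int_Un_distrib Int_Un_distrib2 Int_commute)
      ultimately show ?thesis using c_swap[OF ok] by simp
    qed
  qed
  have "br X Y Z = (t (X @ Y @ Z) + v (X @ Y @ Z)) - (t (Z @ Y @ X) + v (Z @ Y @ X))"
    if "ok X Y Z" for X Y Z
    using cv[OF that] unfolding c_def by (simp add: algebra_simps)
  then show ?thesis by (intro exI[of _ "\<lambda>w. t w + v w"]) simp
qed

end


section \<open>Transfer to abelian groups given by records\<close>

text \<open>Type classes do not apply to record-based groups. The potential is therefore constructed in the
  universal example, formal expressions modulo the group laws and the relations, and then evaluated.\<close>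

datatype 'x wexp = Gen "'x list" "'x list" "'x list" | Zero | Add "'x wexp" "'x wexp" | Neg "'x wexp"

inductive weq :: "'x wexp \<Rightarrow> 'x wexp \<Rightarrow> bool" where
  wrefl: "weq a a"
| wsym: "weq a b \<Longrightarrow> weq b a"
| wtrans: "weq a b \<Longrightarrow> weq b c \<Longrightarrow> weq a c"
| wcong_add: "weq a a' \<Longrightarrow> weq b b' \<Longrightarrow> weq (Add a b) (Add a' b')"
| wcong_neg: "weq a a' \<Longrightarrow> weq (Neg a) (Neg a')"
| wassoc: "weq (Add (Add a b) c) (Add a (Add b c))"
| wcomm: "weq (Add a b) (Add b a)"
| wzero: "weq (Add Zero a) a"
| wneg: "weq (Add (Neg a) a) Zero"
| wfour: "distinct (W @ X @ Y @ Z) \<Longrightarrow>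
    weq (Add (Add (Add (Gen (W @ X) Y Z) (Gen Z (Y @ W) X)) (Gen (X @ Y @ W) [] Z)) (Gen Z (X @ Y) W)) Zero"
| wone: "distinct X \<Longrightarrow> weq (Gen [] X []) Zero"

quotient_type 'x wgrp = "'x wexp" / weq
  by (intro equivpI reflpI sympI transpI) (auto intro: weq.wrefl weq.wsym weq.wtrans)

instantiation wgrp :: (type) ab_group_add
begin

lift_definition zero_wgrp :: "'x wgrp" is Zero .
lift_definition plus_wgrp :: "'x wgrp \<Rightarrow> 'x wgrp \<Rightarrow> 'x wgrp" is Add by (rule weq.wcong_add)
lift_definition uminus_wgrp :: "'x wgrp \<Rightarrow> 'x wgrp" is Neg by (rule weq.wcong_neg)
definition minus_wgrp :: "'x wgrp \<Rightarrow> 'x wgrp \<Rightarrow> 'x wgrp" where "minus_wgrp a b = a + - b"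

instance
  by standard (transfer; auto intro: weq.intros simp: minus_wgrp_def; fail
    | simp add: minus_wgrp_def)+

end

lift_definition wgen :: "'x list \<Rightarrow> 'x list \<Rightarrow> 'x list \<Rightarrow> 'x wgrp" is Gen .

text \<open>The relations of \<open>weq\<close> carry no letter set, so a single group serves all
  finite \<open>L\<close>; restricting to words that exhaust \<open>L\<close> makes it a
  \<open>word_block\<close>.\<close>

lemma wgen_potential:
  assumes "finite L" "z \<in> L"
  shows "\<exists>s. \<forall>X Y Z. splits L X Y Z \<longrightarrow> wgen X Y Z = s (X @ Y @ Z) - s (Z @ Y @ X)"
proof -
  interpret word_block wgen L z
  proof
    fix W X Y Z :: "'a list" assume "distinct (W @ X @ Y @ Z)"
    then show "wgen (W @ X) Y Z + wgen Z (Y @ W) X + wgen (X @ Y @ W) [] Z + wgen Z (X @ Y) W = 0"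
      by transfer (rule weq.wfour)
  next
    fix X :: "'a list" assume "distinct X"
    then show "wgen [] X [] = 0" by transfer (rule weq.wone)
  qed (use assms in auto)
  show ?thesis by (rule potential)
qed

context abelian_group
begin

primrec wev :: "('x list \<Rightarrow> 'x list \<Rightarrow> 'x list \<Rightarrow> 'a) \<Rightarrow> 'x wexp \<Rightarrow> 'a" where
  "wev g (Gen X Y Z) = g X Y Z"
| "wev g Zero = \<zero>"
| "wev g (Add a b) = wev g a \<oplus> wev g b"
| "wev g (Neg a) = \<ominus> wev g a"

lemma wev_closed: "(\<And>X Y Z. g X Y Z \<in> carrier G) \<Longrightarrow> wev g a \<in> carrier G"
  by (induction a) auto

lemma wev_weq:
  assumes "weq a b" and g: "\<And>X Y Z. g X Y Z \<in> carrier G"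
    and "\<And>W X Y Z. distinct (W @ X @ Y @ Z) \<Longrightarrow>
      g (W @ X) Y Z \<oplus> g Z (Y @ W) X \<oplus> g (X @ Y @ W) [] Z \<oplus> g Z (X @ Y) W = \<zero>"
    and "\<And>X. distinct X \<Longrightarrow> g [] X [] = \<zero>"
  shows "wev g a = wev g b"
  using assms(1)
proof induction
  case (wfour W X Y Z)
  then show ?case using assms(3) by simp
qed (auto simp: assms(2,4) wev_closed a_assoc l_neg intro: a_comm)

theorem word_potential:
  fixes g :: "'x list \<Rightarrow> 'x list \<Rightarrow> 'x list \<Rightarrow> 'a"
  assumes L: "finite L" "z \<in> L"
    and closed: "\<And>X Y Z. splits L X Y Z \<Longrightarrow> g X Y Z \<in> carrier G"
    and four: "\<And>W X Y Z. splits L (W @ X) Y Z \<Longrightarrow>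
      g (W @ X) Y Z \<oplus> g Z (Y @ W) X \<oplus> g (X @ Y @ W) [] Z \<oplus> g Z (X @ Y) W = \<zero>"
    and one: "\<And>X. splits L [] X [] \<Longrightarrow> g [] X [] = \<zero>"
  obtains s where "\<And>w. s w \<in> carrier G"
    and "\<And>X Y Z. splits L X Y Z \<Longrightarrow> g X Y Z = s (X @ Y @ Z) \<ominus> s (Z @ Y @ X)"
proof -
  \<comment> \<open>Extension by zero preserves the relations: the four triples of one instance use
    the same letters, so either all of them are splittings of \<open>L\<close> or none is.\<close>
  define g' where "g' X Y Z = (if splits L X Y Z then g X Y Z else \<zero>)" for X Y Z
  obtain s where s: "\<And>X Y Z. splits L X Y Z \<Longrightarrow> wgen X Y Z = s (X @ Y @ Z) - s (Z @ Y @ X)"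
    using wgen_potential[OF L] by blast
  have g'_closed: "g' X Y Z \<in> carrier G" for X Y Z by (simp add: g'_def closed)
  have eq: "wev g' a = wev g' b" if "weq a b" for a b
  proof (rule wev_weq[OF that])
    fix W X Y Z :: "'x list" assume d: "distinct (W @ X @ Y @ Z)"
    show "g' (W @ X) Y Z \<oplus> g' Z (Y @ W) X \<oplus> g' (X @ Y @ W) [] Z \<oplus> g' Z (X @ Y) W = \<zero>"
    proof (cases "splits L (W @ X) Y Z")
      case True
      then have "splits L Z (Y @ W) X" "splits L (X @ Y @ W) [] Z" "splits L Z (X @ Y) W"
        by (auto simp: splits_def)
      with True show ?thesis by (simp add: g'_def four)
    next
      case False
      with d have "set (W @ X @ Y @ Z) \<noteq> L" by (auto simp: splits_def)
      then have "\<not> splits L Z (Y @ W) X" "\<not> splits L (X @ Y @ W) [] Z" "\<not> splits L Z (X @ Y) W"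
        by (auto simp: splits_def)
      with False show ?thesis by (simp add: g'_def)
    qed
  qed (auto simp: g'_def one g'_closed closed)
  show thesis
  proof
    show "wev g' (rep_wgrp (s w)) \<in> carrier G" for w by (intro wev_closed g'_closed)
    fix X Y Z assume ok: "splits L X Y Z"
    \<comment> \<open>The subtraction is moved to the other side because addition, unlike
      difference, corresponds to a constructor of formal expressions and can be read back as a
      statement about \<open>weq\<close>.\<close>
    have "wgen X Y Z + s (Z @ Y @ X) = s (X @ Y @ Z)" using s[OF ok] by simp
    then have "weq (Add (Gen X Y Z) (rep_wgrp (s (Z @ Y @ X)))) (rep_wgrp (s (X @ Y @ Z)))"
      by (metis Quotient3_rep_reflp Quotient3_wgrp plus_wgrp.abs_eq wgen.abs_eq Quotient3_abs_rep
          wgrp.abs_eq_iff)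
    from eq[OF this] have "g X Y Z \<oplus> wev g' (rep_wgrp (s (Z @ Y @ X))) = wev g' (rep_wgrp (s (X @ Y @ Z)))"
      using ok by (simp add: g'_def)
    then show "g X Y Z = wev g' (rep_wgrp (s (X @ Y @ Z))) \<ominus> wev g' (rep_wgrp (s (Z @ Y @ X)))"
      using closed[OF ok] by (metis add.inv_solve_right' g'_closed minus_eq wev_closed a_closed)
  qed
qed

end

section \<open>Modules, quotients and homology\<close>


context abelian_group
begin

lemma minus_zero_right [simp]: "x \<in> carrier G \<Longrightarrow> x \<ominus> \<zero> = x"
  using add.inv_one by (simp add: a_minus_def a_inv_def)

lemma minus_self [simp]: "x \<in> carrier G \<Longrightarrow> x \<ominus> x = \<zero>"
  by (simp add: a_minus_def r_neg)

lemma minus_eq_zero_iff: "x \<in> carrier G \<Longrightarrow> y \<in> carrier G \<Longrightarrow> x \<ominus> y = \<zero> \<longleftrightarrow> x = y"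
  by (metis a_minus_def add.inv_equality add.inv_inv add.inv_closed r_neg a_inv_def)

lemma neg_minus: "x \<in> carrier G \<Longrightarrow> y \<in> carrier G \<Longrightarrow> \<ominus> (x \<ominus> y) = y \<ominus> x"
  by (simp add: a_minus_def minus_add a_comm)

end

lemma mod_homI:
  assumes "\<And>x. x \<in> carrier M \<Longrightarrow> h x \<in> carrier N"
    and "\<And>x y. x \<in> carrier M \<Longrightarrow> y \<in> carrier M \<Longrightarrow> h (x \<oplus>\<^bsub>M\<^esub> y) = h x \<oplus>\<^bsub>N\<^esub> h y"
    and "\<And>r x. r \<in> carrier R \<Longrightarrow> x \<in> carrier M \<Longrightarrow> h (r \<odot>\<^bsub>M\<^esub> x) = r \<odot>\<^bsub>N\<^esub> h x"
  shows "h \<in> mod_hom R M N"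
  using assms unfolding mod_hom_def by auto

lemma mod_hom_closed: "h \<in> mod_hom R M N \<Longrightarrow> x \<in> carrier M \<Longrightarrow> h x \<in> carrier N"
  and mod_hom_add: "h \<in> mod_hom R M N \<Longrightarrow> x \<in> carrier M \<Longrightarrow> y \<in> carrier M \<Longrightarrow>
    h (x \<oplus>\<^bsub>M\<^esub> y) = h x \<oplus>\<^bsub>N\<^esub> h y"
  and mod_hom_smult: "h \<in> mod_hom R M N \<Longrightarrow> r \<in> carrier R \<Longrightarrow> x \<in> carrier M \<Longrightarrow>
    h (r \<odot>\<^bsub>M\<^esub> x) = r \<odot>\<^bsub>N\<^esub> h x"
  unfolding mod_hom_def by auto

lemma mod_hom_zero:
  assumes "module R M" "module R N" "h \<in> mod_hom R M N"
  shows "h \<zero>\<^bsub>M\<^esub> = \<zero>\<^bsub>N\<^esub>"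
proof -
  interpret M: module R M by fact
  interpret N: module R N by fact
  have "h (\<zero>\<^bsub>R\<^esub> \<odot>\<^bsub>M\<^esub> \<zero>\<^bsub>M\<^esub>) = \<zero>\<^bsub>R\<^esub> \<odot>\<^bsub>N\<^esub> h \<zero>\<^bsub>M\<^esub>"
    by (intro mod_hom_smult[OF assms(3)]) auto
  then show ?thesis using mod_hom_closed[OF assms(3)] by simp
qed

lemma mod_hom_neg:
  assumes "module R M" "module R N" "h \<in> mod_hom R M N" "x \<in> carrier M"
  shows "h (\<ominus>\<^bsub>M\<^esub> x) = \<ominus>\<^bsub>N\<^esub> h x"
proof -
  interpret M: module R M by fact
  interpret N: module R N by fact
  have "h (\<ominus>\<^bsub>M\<^esub> x) \<oplus>\<^bsub>N\<^esub> h x = \<zero>\<^bsub>N\<^esub>"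
    using assms by (simp add: mod_hom_zero M.l_neg flip: mod_hom_add)
  then show ?thesis
    using assms mod_hom_closed[OF assms(3)] by (intro N.minus_equality[symmetric]) auto
qed

lemma mod_hom_minus:
  assumes "module R M" "module R N" "h \<in> mod_hom R M N" "x \<in> carrier M" "y \<in> carrier M"
  shows "h (x \<ominus>\<^bsub>M\<^esub> y) = h x \<ominus>\<^bsub>N\<^esub> h y"
proof -
  interpret M: module R M by fact
  interpret N: module R N by fact
  show ?thesis using assms by (simp add: a_minus_def mod_hom_add mod_hom_neg)
qed

lemma mod_hom_comp:
  assumes "h \<in> mod_hom R M N" "k \<in> mod_hom R N P"
  shows "(\<lambda>x. k (h x)) \<in> mod_hom R M P"
  using assms by (intro mod_homI) (auto simp: mod_hom_closed mod_hom_add mod_hom_smult)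

lemma mod_hom_ident: "(\<lambda>x. x) \<in> mod_hom R M M"
  by (rule mod_homI) auto

lemma mod_hom_zero_map:
  assumes "module R N" shows "(\<lambda>x. \<zero>\<^bsub>N\<^esub>) \<in> mod_hom R M N"
proof -
  interpret N: module R N by fact
  show ?thesis by (intro mod_homI) auto
qed

lemma mod_hom_plus:
  assumes "module R N" "h \<in> mod_hom R M N" "k \<in> mod_hom R M N"
  shows "(\<lambda>x. h x \<oplus>\<^bsub>N\<^esub> k x) \<in> mod_hom R M N"
proof -
  interpret N: module R N by fact
  show ?thesis using assms
    by (intro mod_homI) (auto simp: mod_hom_closed mod_hom_add mod_hom_smult N.smult_r_distr N.a_ac)
qed

lemma mod_hom_diff:
  assumes "module R N" "h \<in> mod_hom R M N" "k \<in> mod_hom R M N"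
  shows "(\<lambda>x. h x \<ominus>\<^bsub>N\<^esub> k x) \<in> mod_hom R M N"
proof -
  interpret N: module R N by fact
  show ?thesis using assms
    by (intro mod_homI) (auto simp: mod_hom_closed mod_hom_add mod_hom_smult N.smult_r_distr
        N.smult_r_minus N.a_ac a_minus_def N.minus_add)
qed

lemma mod_hom_submodule_carrier:
  "h \<in> mod_hom R M N \<Longrightarrow> K \<subseteq> carrier M \<Longrightarrow> h \<in> mod_hom R (M\<lparr>carrier := K\<rparr>) N"
  unfolding mod_hom_def by (auto simp: subset_iff)

lemma submodule_vimage:
  assumes "module R M" "module R N" "h \<in> mod_hom R M N" "submodule H R N"
  shows "submodule {x \<in> carrier M. h x \<in> H} R M"
proof -
  interpret M: module R M by fact
  interpret N: module R N by fact
  note H = N.submoduleE[OF assms(4)]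
  have "\<zero>\<^bsub>N\<^esub> \<in> H" using subgroup.one_closed[OF submodule.axioms(1)[OF assms(4)]] by simp
  with assms H show ?thesis
    by (intro M.submoduleI)
      (auto simp: mod_hom_zero mod_hom_neg mod_hom_add mod_hom_smult)
qed

lemma submodule_zero: "module R M \<Longrightarrow> submodule {\<zero>\<^bsub>M\<^esub>} R M"
proof -
  assume "module R M"
  then interpret M: module R M .
  show ?thesis by (intro M.submoduleI) auto
qed

lemma submodule_kernel:
  assumes "module R M" "module R N" "h \<in> mod_hom R M N"
  shows "submodule {x \<in> carrier M. h x = \<zero>\<^bsub>N\<^esub>} R M"
  using submodule_vimage[OF assms submodule_zero[OF assms(2)]] by simp

lemma submodule_equalizer:
  assumes "module R M" "module R N" "h \<in> mod_hom R M N" "k \<in> mod_hom R M N"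
  shows "submodule {x \<in> carrier M. h x = k x} R M"
proof -
  interpret M: module R M by fact
  interpret N: module R N by fact
  show ?thesis using assms
    by (intro M.submoduleI) (auto simp: mod_hom_zero mod_hom_neg mod_hom_add mod_hom_smult)
qed

lemma submodule_image:
  assumes "module R M" "module R N" "h \<in> mod_hom R M N"
  shows "submodule (h ` carrier M) R N"
proof -
  interpret M: module R M by fact
  interpret N: module R N by fact
  show ?thesis
  proof (intro N.submoduleI)
    show "\<zero>\<^bsub>N\<^esub> \<in> h ` carrier M" using mod_hom_zero[OF assms] by force
  next
    fix a assume "a \<in> h ` carrier M"
    then show "\<ominus>\<^bsub>N\<^esub> a \<in> h ` carrier M" using mod_hom_neg[OF assms, symmetric] by auto
  next
    fix a b assume "a \<in> h ` carrier M" "b \<in> h ` carrier M"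
    then show "a \<oplus>\<^bsub>N\<^esub> b \<in> h ` carrier M" using mod_hom_add[OF assms(3), symmetric] by auto
  next
    fix a x assume "a \<in> carrier R" "x \<in> h ` carrier M"
    then show "a \<odot>\<^bsub>N\<^esub> x \<in> h ` carrier M" using mod_hom_smult[OF assms(3), symmetric] by auto
  qed (use mod_hom_closed[OF assms(3)] in auto)
qed

lemma zero_in_submodule: "submodule H R M \<Longrightarrow> \<zero>\<^bsub>M\<^esub> \<in> H"
  using subgroup.one_closed[OF submodule.axioms(1), of H R M] by simp

lemma mod_span_submodule:
  assumes "module R M" "Q \<subseteq> carrier M"
  shows "submodule (mod_span R M Q) R M"
proof -
  interpret M: module R M by fact
  have c: "submodule (carrier M) R M" by (rule M.carrier_is_submodule)
  show ?thesis unfolding mod_span_def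
  proof (intro M.submoduleI)
    show "\<Inter> {H. submodule H R M \<and> Q \<subseteq> H} \<subseteq> carrier M" using c assms(2) by blast
  next
    show "\<zero>\<^bsub>M\<^esub> \<in> \<Inter> {H. submodule H R M \<and> Q \<subseteq> H}" by (auto intro: zero_in_submodule)
  next
    fix a assume "a \<in> \<Inter> {H. submodule H R M \<and> Q \<subseteq> H}"
    then show "\<ominus>\<^bsub>M\<^esub> a \<in> \<Inter> {H. submodule H R M \<and> Q \<subseteq> H}"
      by (auto intro: M.submoduleE(3))
  next
    fix a b assume "a \<in> \<Inter> {H. submodule H R M \<and> Q \<subseteq> H}" "b \<in> \<Inter> {H. submodule H R M \<and> Q \<subseteq> H}"
    then show "a \<oplus>\<^bsub>M\<^esub> b \<in> \<Inter> {H. submodule H R M \<and> Q \<subseteq> H}"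
      by (auto intro: M.submoduleE(5))
  next
    fix a x assume "a \<in> carrier R" "x \<in> \<Inter> {H. submodule H R M \<and> Q \<subseteq> H}"
    then show "a \<odot>\<^bsub>M\<^esub> x \<in> \<Inter> {H. submodule H R M \<and> Q \<subseteq> H}"
      by (auto intro: M.submoduleE(4))
  qed
qed

lemma mod_span_incl: "Q \<subseteq> mod_span R M Q"
  unfolding mod_span_def by blast

lemma mod_span_least: "submodule H R M \<Longrightarrow> Q \<subseteq> H \<Longrightarrow> mod_span R M Q \<subseteq> H"
  unfolding mod_span_def by blast

locale mod_quotient = module R M for R :: "'k ring" and M :: "('k, 'm) module" +
  fixes H assumes sub: "submodule H R M"
begin

lemma abelian_subgroup: "abelian_subgroup H M"
  by (intro abelian_subgroupI3 additive_subgroup.intro submodule.axioms(1)[OF sub] abelian_group_axioms)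

lemma H_subset: "H \<subseteq> carrier M"
  using submoduleE(1)[OF sub] .

lemma quot_carrier: "carrier (quot_mod M H) = (\<lambda>x. H +>\<^bsub>M\<^esub> x) ` carrier M"
  unfolding quot_mod_def by (auto simp: A_RCOSETS_def')

lemma quot_eq_iff:
  assumes "x \<in> carrier M" "y \<in> carrier M"
  shows "H +>\<^bsub>M\<^esub> x = H +>\<^bsub>M\<^esub> y \<longleftrightarrow> x \<ominus>\<^bsub>M\<^esub> y \<in> H"
proof -
  interpret abelian_subgroup H M by (rule abelian_subgroup)
  have "x \<ominus>\<^bsub>M\<^esub> y \<in> H \<longleftrightarrow> x \<in> H +>\<^bsub>M\<^esub> y" using assms by (metis a_rcos_module minus_eq)
  also have "\<dots> \<longleftrightarrow> H +>\<^bsub>M\<^esub> x = H +>\<^bsub>M\<^esub> y"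
    using a_repr_independence'[of x y] a_rcos_self[of x] assms by auto
  finally show ?thesis by simp
qed

lemma quot_add:
  assumes "x \<in> carrier M" "y \<in> carrier M"
  shows "(H +>\<^bsub>M\<^esub> x) \<oplus>\<^bsub>quot_mod M H\<^esub> (H +>\<^bsub>M\<^esub> y) = H +>\<^bsub>M\<^esub> (x \<oplus>\<^bsub>M\<^esub> y)"
  using abelian_subgroup.a_rcos_sum[OF abelian_subgroup assms] by (simp add: quot_mod_def)

lemma quot_zero: "\<zero>\<^bsub>quot_mod M H\<^esub> = H +>\<^bsub>M\<^esub> \<zero>\<^bsub>M\<^esub>"
  using a_coset_add_zero[OF H_subset] by (simp add: quot_mod_def)

lemma quot_smult:
  assumes "r \<in> carrier R" "x \<in> carrier M"
  shows "r \<odot>\<^bsub>quot_mod M H\<^esub> (H +>\<^bsub>M\<^esub> x) = H +>\<^bsub>M\<^esub> (r \<odot>\<^bsub>M\<^esub> x)"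
proof -
  interpret abelian_subgroup H M by (rule abelian_subgroup)
  \<comment> \<open>Scalar multiplication on the quotient is a union over all representatives; it is
    a single coset because every representative contributes the same one.\<close>
  have const: "H +>\<^bsub>M\<^esub> (r \<odot>\<^bsub>M\<^esub> y) = H +>\<^bsub>M\<^esub> (r \<odot>\<^bsub>M\<^esub> x)" if "y \<in> H +>\<^bsub>M\<^esub> x" for y
  proof -
    have y: "y \<in> carrier M" using that a_elemrcos_carrier assms by blast
    have "x \<ominus>\<^bsub>M\<^esub> y \<in> H"
      using that assms y a_repr_independence' quot_eq_iff by blast
    then have "r \<odot>\<^bsub>M\<^esub> (y \<ominus>\<^bsub>M\<^esub> x) \<in> H"
      using submoduleE(3,4)[OF sub] assms y by (metis neg_minus)
    then show ?thesis using y assms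
      by (subst quot_eq_iff) (auto simp: a_minus_def smult_r_distr smult_r_minus)
  qed
  have "(\<Union>y \<in> H +>\<^bsub>M\<^esub> x. H +>\<^bsub>M\<^esub> (r \<odot>\<^bsub>M\<^esub> y)) = H +>\<^bsub>M\<^esub> (r \<odot>\<^bsub>M\<^esub> x)"
    by (rule UN_constant_eq[OF a_rcos_self[OF assms(2)]]) (rule ballI, rule const)
  then show ?thesis unfolding quot_mod_def by simp
qed

lemma quot_module: "module R (quot_mod M H)"
proof (intro moduleI abelian_groupI)
  show "cring R" ..
  fix x assume "x \<in> carrier (quot_mod M H)"
  then obtain x' where "x' \<in> carrier M" "x = H +>\<^bsub>M\<^esub> x'" unfolding quot_carrier by auto
  then show "\<exists>y \<in> carrier (quot_mod M H). y \<oplus>\<^bsub>quot_mod M H\<^esub> x = \<zero>\<^bsub>quot_mod M H\<^esub>"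
    by (intro bexI[of _ "H +>\<^bsub>M\<^esub> (\<ominus>\<^bsub>M\<^esub> x')"]) (auto simp: quot_carrier quot_add quot_zero l_neg)
qed (auto simp: quot_carrier quot_add quot_smult quot_zero a_ac smult_l_distr smult_r_distr smult_assoc1)

lemma quot_proj: "(\<lambda>x. H +>\<^bsub>M\<^esub> x) \<in> mod_hom R M (quot_mod M H)"
  by (intro mod_homI) (auto simp: quot_carrier quot_add quot_smult)

lemma quot_zero_iff: "x \<in> carrier M \<Longrightarrow> H +>\<^bsub>M\<^esub> x = \<zero>\<^bsub>quot_mod M H\<^esub> \<longleftrightarrow> x \<in> H"
  unfolding quot_zero by (subst quot_eq_iff) auto

lemma quot_lift:
  assumes "module R N" "h \<in> mod_hom R M N" "\<And>x. x \<in> H \<Longrightarrow> h x = \<zero>\<^bsub>N\<^esub>"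
  obtains k where "k \<in> mod_hom R (quot_mod M H) N" "\<And>x. x \<in> carrier M \<Longrightarrow> k (H +>\<^bsub>M\<^esub> x) = h x"
proof
  interpret N: module R N by fact
  define k where "k X = h (SOME x. x \<in> carrier M \<and> X = H +>\<^bsub>M\<^esub> x)" for X
  show k: "k (H +>\<^bsub>M\<^esub> x) = h x" if x: "x \<in> carrier M" for x
  proof -
    define y where "y = (SOME y. y \<in> carrier M \<and> H +>\<^bsub>M\<^esub> x = H +>\<^bsub>M\<^esub> y)"
    have y: "y \<in> carrier M \<and> H +>\<^bsub>M\<^esub> x = H +>\<^bsub>M\<^esub> y"
      unfolding y_def by (rule someI[of _ x]) (use x in simp)
    then have "h x \<ominus>\<^bsub>N\<^esub> h y = \<zero>\<^bsub>N\<^esub>"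
      using x assms(3) quot_eq_iff[of x y] mod_hom_minus[OF module_axioms assms(1,2), of x y] by simp
    then have "h x = h y" using x y mod_hom_closed[OF assms(2)] by (simp add: N.minus_eq_zero_iff)
    then show ?thesis unfolding k_def y_def by simp
  qed
  show "k \<in> mod_hom R (quot_mod M H) N"
    by (intro mod_homI) (auto simp: quot_carrier quot_add quot_smult k mod_hom_closed[OF assms(2)]
        mod_hom_add[OF assms(2)] mod_hom_smult[OF assms(2)])
qed

end

lemma module_zero_mod: "cring R \<Longrightarrow> module R zero_mod"
  by (intro moduleI abelian_groupI) (auto simp: zero_mod_def)

lemma mod_hom_to_zero_mod: "(\<lambda>_. ()) \<in> mod_hom R M zero_mod"
  by (intro mod_homI) (auto simp: zero_mod_def)

lemma homology_quotient:
  assumes "module R L" "module R M" "module R N" "f \<in> mod_hom R L M" "g \<in> mod_hom R M N"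
    and "\<And>x. x \<in> carrier L \<Longrightarrow> g (f x) = \<zero>\<^bsub>N\<^esub>"
  shows "mod_quotient R (M\<lparr>carrier := {x \<in> carrier M. g x = \<zero>\<^bsub>N\<^esub>}\<rparr>) (f ` carrier L)"
proof -
  let ?K = "{x \<in> carrier M. g x = \<zero>\<^bsub>N\<^esub>}"
  interpret K: module R "M\<lparr>carrier := ?K\<rparr>"
    using submodule.submodule_is_module[OF submodule_kernel[OF assms(2,3,5)] assms(2)] .
  have "f \<in> mod_hom R L (M\<lparr>carrier := ?K\<rparr>)"
    using assms(4,6) unfolding mod_hom_def by auto
  then show ?thesis
    by (intro mod_quotient.intro mod_quotient_axioms.intro K.module_axioms
        submodule_image[OF assms(1) K.module_axioms])
qed

text \<open>The modules \<open>L\<close> and \<open>L'\<close> enter only through the images of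
  \<open>f\<close> and \<open>f'\<close>. The homotopy conditions are pointwise memberships in these
  images and concern cycles only, so no maps between \<open>L\<close> and \<open>L'\<close> have to
  be constructed.\<close>

lemma homology_iso:
  assumes mods: "module R L" "module R M" "module R N" "module R L'" "module R M'" "module R N'"
    and fg: "f \<in> mod_hom R L M" "g \<in> mod_hom R M N" "\<And>x. x \<in> carrier L \<Longrightarrow> g (f x) = \<zero>\<^bsub>N\<^esub>"
    and fg': "f' \<in> mod_hom R L' M'" "g' \<in> mod_hom R M' N'"
      "\<And>x. x \<in> carrier L' \<Longrightarrow> g' (f' x) = \<zero>\<^bsub>N'\<^esub>"
    and \<alpha>: "\<alpha> \<in> mod_hom R M M'" "\<And>x. x \<in> carrier M \<Longrightarrow> g x = \<zero>\<^bsub>N\<^esub> \<Longrightarrow> g' (\<alpha> x) = \<zero>\<^bsub>N'\<^esub>"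
      "\<And>x. x \<in> carrier L \<Longrightarrow> \<alpha> (f x) \<in> f' ` carrier L'"
    and \<beta>: "\<beta> \<in> mod_hom R M' M" "\<And>x. x \<in> carrier M' \<Longrightarrow> g' x = \<zero>\<^bsub>N'\<^esub> \<Longrightarrow> g (\<beta> x) = \<zero>\<^bsub>N\<^esub>"
      "\<And>x. x \<in> carrier L' \<Longrightarrow> \<beta> (f' x) \<in> f ` carrier L"
    and \<beta>\<alpha>: "\<And>x. x \<in> carrier M \<Longrightarrow> g x = \<zero>\<^bsub>N\<^esub> \<Longrightarrow> x \<ominus>\<^bsub>M\<^esub> \<beta> (\<alpha> x) \<in> f ` carrier L"
    and \<alpha>\<beta>: "\<And>x. x \<in> carrier M' \<Longrightarrow> g' x = \<zero>\<^bsub>N'\<^esub> \<Longrightarrow> x \<ominus>\<^bsub>M'\<^esub> \<alpha> (\<beta> x) \<in> f' ` carrier L'"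
  shows "mod_iso R (homology L f M g N) (homology L' f' M' g' N')"
proof -
  let ?K = "M\<lparr>carrier := {x \<in> carrier M. g x = \<zero>\<^bsub>N\<^esub>}\<rparr>"
  let ?K' = "M'\<lparr>carrier := {x \<in> carrier M'. g' x = \<zero>\<^bsub>N'\<^esub>}\<rparr>"
  let ?H = "f ` carrier L" and ?H' = "f' ` carrier L'"
  interpret M: module R M by fact
  interpret M': module R M' by fact
  interpret Q: mod_quotient R ?K ?H
    using homology_quotient[OF mods(1-3) fg] .
  interpret Q': mod_quotient R ?K' ?H'
    using homology_quotient[OF mods(4-6) fg'] .
  \<comment> \<open>The additive inverse is defined relative to the carrier, so restricting the
    carrier could change subtraction; the inclusion being a homomorphism shows that it does
    not.\<close>
  have minus: "x \<ominus>\<^bsub>?K\<^esub> y = x \<ominus>\<^bsub>M\<^esub> y" if "x \<in> carrier ?K" "y \<in> carrier ?K" for x y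
    using mod_hom_minus[OF Q.module_axioms mods(2) mod_hom_submodule_carrier[OF mod_hom_ident] that]
    by auto
  have minus': "x \<ominus>\<^bsub>?K'\<^esub> y = x \<ominus>\<^bsub>M'\<^esub> y" if "x \<in> carrier ?K'" "y \<in> carrier ?K'" for x y
    using mod_hom_minus[OF Q'.module_axioms mods(5) mod_hom_submodule_carrier[OF mod_hom_ident] that]
    by auto
  have \<alpha>K: "\<alpha> \<in> mod_hom R ?K ?K'" and \<beta>K: "\<beta> \<in> mod_hom R ?K' ?K"
    using \<alpha>(1,2) \<beta>(1,2) unfolding mod_hom_def by auto
  have h: "(\<lambda>x. ?H' +>\<^bsub>?K'\<^esub> \<alpha> x) \<in> mod_hom R ?K (quot_mod ?K' ?H')"
    by (rule mod_hom_comp[OF \<alpha>K Q'.quot_proj])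
  have h0: "?H' +>\<^bsub>?K'\<^esub> \<alpha> x = \<zero>\<^bsub>quot_mod ?K' ?H'\<^esub>" if "x \<in> ?H" for x
    using that \<alpha>(3) Q.H_subset mod_hom_closed[OF \<alpha>K]
    by (subst Q'.quot_zero_iff) auto
  obtain k where k: "k \<in> mod_hom R (quot_mod ?K ?H) (quot_mod ?K' ?H')"
    and kx: "\<And>x. x \<in> carrier ?K \<Longrightarrow> k (?H +>\<^bsub>?K\<^esub> x) = ?H' +>\<^bsub>?K'\<^esub> \<alpha> x"
    using Q.quot_lift[OF Q'.quot_module h h0] by blast
  have inj: "?H +>\<^bsub>?K\<^esub> x = ?H +>\<^bsub>?K\<^esub> y"
    if x: "x \<in> carrier ?K" and y: "y \<in> carrier ?K" and eq: "?H' +>\<^bsub>?K'\<^esub> \<alpha> x = ?H' +>\<^bsub>?K'\<^esub> \<alpha> y" for x y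
  proof -
    have "\<alpha> x \<ominus>\<^bsub>?K'\<^esub> \<alpha> y \<in> ?H'"
      using eq x y mod_hom_closed[OF \<alpha>K] by (subst (asm) Q'.quot_eq_iff) auto
    then have "\<beta> (\<alpha> x \<ominus>\<^bsub>?K'\<^esub> \<alpha> y) \<in> ?H" using \<beta>(3) by auto
    then have "\<beta> (\<alpha> x) \<ominus>\<^bsub>?K\<^esub> \<beta> (\<alpha> y) \<in> ?H"
      using mod_hom_minus[OF Q'.module_axioms Q.module_axioms \<beta>K] mod_hom_closed[OF \<alpha>K] x y by auto
    then have "?H +>\<^bsub>?K\<^esub> \<beta> (\<alpha> x) = ?H +>\<^bsub>?K\<^esub> \<beta> (\<alpha> y)"
      using mod_hom_closed[OF \<alpha>K] mod_hom_closed[OF \<beta>K] x y by (subst Q.quot_eq_iff) auto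
    note eq' = this
    have "?H +>\<^bsub>?K\<^esub> u = ?H +>\<^bsub>?K\<^esub> \<beta> (\<alpha> u)" if "u \<in> carrier ?K" for u
      using \<beta>\<alpha>[of u] that mod_hom_closed[OF \<alpha>K that] mod_hom_closed[OF \<beta>K mod_hom_closed[OF \<alpha>K that]]
      by (subst Q.quot_eq_iff) (auto simp: minus)
    from this[OF x] this[OF y] eq' show ?thesis by simp
  qed
  have surj: "\<exists>x \<in> carrier ?K. ?H' +>\<^bsub>?K'\<^esub> \<alpha> x = ?H' +>\<^bsub>?K'\<^esub> y" if y: "y \<in> carrier ?K'" for y
  proof
    show "\<beta> y \<in> carrier ?K" using mod_hom_closed[OF \<beta>K y] .
    show "?H' +>\<^bsub>?K'\<^esub> \<alpha> (\<beta> y) = ?H' +>\<^bsub>?K'\<^esub> y"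
      using \<alpha>\<beta>[of y] y mod_hom_closed[OF \<beta>K y] mod_hom_closed[OF \<alpha>K mod_hom_closed[OF \<beta>K y]]
      by (subst eq_commute, subst Q'.quot_eq_iff) (auto simp: minus')
  qed
  have "bij_betw k (carrier (quot_mod ?K ?H)) (carrier (quot_mod ?K' ?H'))"
    unfolding bij_betw_def
  proof
    show "inj_on k (carrier (quot_mod ?K ?H))"
    proof (rule inj_onI)
      fix X Y assume "X \<in> carrier (quot_mod ?K ?H)" "Y \<in> carrier (quot_mod ?K ?H)" and k_eq: "k X = k Y"
      then obtain x y where xy: "x \<in> carrier ?K" "X = ?H +>\<^bsub>?K\<^esub> x" "y \<in> carrier ?K" "Y = ?H +>\<^bsub>?K\<^esub> y"
        unfolding Q.quot_carrier by blast
      then show "X = Y" using inj[of x y] k_eq by (simp only: kx)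
    qed
    show "k ` carrier (quot_mod ?K ?H) = carrier (quot_mod ?K' ?H')"
    proof (intro equalityI subsetI)
      fix z assume "z \<in> k ` carrier (quot_mod ?K ?H)"
      then show "z \<in> carrier (quot_mod ?K' ?H')" using mod_hom_closed[OF k] by auto
    next
      fix z assume "z \<in> carrier (quot_mod ?K' ?H')"
      then obtain y where y: "y \<in> carrier ?K'" "z = ?H' +>\<^bsub>?K'\<^esub> y" unfolding Q'.quot_carrier by auto
      obtain x where x: "x \<in> carrier ?K" "?H' +>\<^bsub>?K'\<^esub> \<alpha> x = ?H' +>\<^bsub>?K'\<^esub> y"
        using surj[OF y(1)] by blast
      have "z = k (?H +>\<^bsub>?K\<^esub> x)" using kx[OF x(1)] x(2) y(2) by simp
      with x(1) show "z \<in> k ` carrier (quot_mod ?K ?H)" unfolding Q.quot_carrier by blast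
    qed
  qed
  then show ?thesis unfolding mod_iso_def homology_def using k by blast
qed

section \<open>Free and presented modules\<close>


text \<open>The linear extension of \<phi>. Summing over the support of \<open>f\<close> keeps the
  generating set out of the definition.\<close>

definition lin :: "'k ring \<Rightarrow> ('k, 'n) module \<Rightarrow> ('s \<Rightarrow> 'n) \<Rightarrow> ('s \<Rightarrow> 'k) \<Rightarrow> 'n" where
  "lin R N \<phi> f = (\<Oplus>\<^bsub>N\<^esub>s\<in>{s. f s \<noteq> \<zero>\<^bsub>R\<^esub>}. f s \<odot>\<^bsub>N\<^esub> \<phi> s)"

lemma free_carrierD:
  assumes "f \<in> carrier (free_mod R S)"
  shows "s \<in> S \<Longrightarrow> f s \<in> carrier R" "s \<notin> S \<Longrightarrow> f s = \<zero>\<^bsub>R\<^esub>" "finite {s. f s \<noteq> \<zero>\<^bsub>R\<^esub>}" "{s. f s \<noteq> \<zero>\<^bsub>R\<^esub>} \<subseteq> S"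
  using assms unfolding free_mod_def by auto

lemma free_simps:
  "\<zero>\<^bsub>free_mod R S\<^esub> = (\<lambda>_. \<zero>\<^bsub>R\<^esub>)"
  "f \<oplus>\<^bsub>free_mod R S\<^esub> g = (\<lambda>s. f s \<oplus>\<^bsub>R\<^esub> g s)"
  "r \<odot>\<^bsub>free_mod R S\<^esub> f = (\<lambda>s. r \<otimes>\<^bsub>R\<^esub> f s)"
  unfolding free_mod_def by auto

locale base_ring = cring R for R :: "'k ring" (structure)
begin

lemma free_closed: "f \<in> carrier (free_mod R S) \<Longrightarrow> f s \<in> carrier R"
  using free_carrierD(1,2)[of f R S s] by (cases "s \<in> S") simp_all

lemma free_carrierI:
  assumes "finite T" "T \<subseteq> S" "\<And>s. f s \<in> carrier R" "\<And>s. s \<notin> T \<Longrightarrow> f s = \<zero>"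
  shows "f \<in> carrier (free_mod R S)"
proof -
  have "{s. f s \<noteq> \<zero>} \<subseteq> T" using assms(4) by auto
  then have "finite {s. f s \<noteq> \<zero>}" using assms(1) finite_subset by auto
  then show ?thesis using assms unfolding free_mod_def by auto
qed

lemma basis_closed: "s \<in> S \<Longrightarrow> basis_vec R s \<in> carrier (free_mod R S)"
  by (rule free_carrierI[of "{s}"]) (auto simp: basis_vec_def)

lemma free_module: "module R (free_mod R S)"
proof (intro moduleI abelian_groupI)
  show "cring R" by (rule is_cring)
  show zero: "\<zero>\<^bsub>free_mod R S\<^esub> \<in> carrier (free_mod R S)"
    by (rule free_carrierI[of "{}"]) (auto simp: free_simps)
  fix f assume f: "f \<in> carrier (free_mod R S)"
  note fc = free_closed[OF f] and fD = free_carrierD[OF f]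
  show "r \<odot>\<^bsub>free_mod R S\<^esub> f \<in> carrier (free_mod R S)" if "r \<in> carrier R" for r
    using that fc fD by (intro free_carrierI[of "{s. f s \<noteq> \<zero>}"]) (auto simp: free_simps)
  show "\<zero>\<^bsub>free_mod R S\<^esub> \<oplus>\<^bsub>free_mod R S\<^esub> f = f" "\<one> \<odot>\<^bsub>free_mod R S\<^esub> f = f"
    using fc by (auto simp: free_simps)
  show "\<exists>g \<in> carrier (free_mod R S). g \<oplus>\<^bsub>free_mod R S\<^esub> f = \<zero>\<^bsub>free_mod R S\<^esub>"
  proof
    show "(\<lambda>s. \<ominus> f s) \<in> carrier (free_mod R S)"
      using fc fD by (intro free_carrierI[of "{s. f s \<noteq> \<zero>}"]) auto
  qed (use fc in \<open>auto simp: free_simps l_neg\<close>)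
  fix g assume g: "g \<in> carrier (free_mod R S)"
  note gc = free_closed[OF g] and gD = free_carrierD[OF g]
  show "f \<oplus>\<^bsub>free_mod R S\<^esub> g \<in> carrier (free_mod R S)"
    using fc fD gc gD
    by (intro free_carrierI[of "{s. f s \<noteq> \<zero>} \<union> {s. g s \<noteq> \<zero>}"]) (auto simp: free_simps)
  show "f \<oplus>\<^bsub>free_mod R S\<^esub> g = g \<oplus>\<^bsub>free_mod R S\<^esub> f"
    using fc gc by (auto simp: free_simps a_comm)
  show "r \<odot>\<^bsub>free_mod R S\<^esub> (f \<oplus>\<^bsub>free_mod R S\<^esub> g) = r \<odot>\<^bsub>free_mod R S\<^esub> f \<oplus>\<^bsub>free_mod R S\<^esub> r \<odot>\<^bsub>free_mod R S\<^esub> g"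
    if "r \<in> carrier R" for r
    using fc gc that by (auto simp: free_simps r_distr)
  show "(r \<oplus> r') \<odot>\<^bsub>free_mod R S\<^esub> f = r \<odot>\<^bsub>free_mod R S\<^esub> f \<oplus>\<^bsub>free_mod R S\<^esub> r' \<odot>\<^bsub>free_mod R S\<^esub> f"
    "(r \<otimes> r') \<odot>\<^bsub>free_mod R S\<^esub> f = r \<odot>\<^bsub>free_mod R S\<^esub> (r' \<odot>\<^bsub>free_mod R S\<^esub> f)"
    if "r \<in> carrier R" "r' \<in> carrier R" for r r'
    using fc that by (auto simp: free_simps l_distr m_assoc)
  show "f \<oplus>\<^bsub>free_mod R S\<^esub> g \<oplus>\<^bsub>free_mod R S\<^esub> h = f \<oplus>\<^bsub>free_mod R S\<^esub> (g \<oplus>\<^bsub>free_mod R S\<^esub> h)"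
    if h: "h \<in> carrier (free_mod R S)" for h
    using fc gc free_closed[OF h] by (auto simp: free_simps a_assoc)
qed

lemma lin_superset:
  assumes N: "module R N" and \<phi>: "\<phi> \<in> S \<rightarrow> carrier N" and f: "f \<in> carrier (free_mod R S)"
    and T: "finite T" "{s. f s \<noteq> \<zero>} \<subseteq> T" "T \<subseteq> S"
  shows "lin R N \<phi> f = (\<Oplus>\<^bsub>N\<^esub>s\<in>T. f s \<odot>\<^bsub>N\<^esub> \<phi> s)"
proof -
  interpret N: module R N by fact
  note fc = free_closed[OF f] and fD = free_carrierD[OF f]
  show ?thesis unfolding lin_def
    by (rule N.add.finprod_mono_neutral_cong_left) (use T \<phi> fc in \<open>auto simp: Pi_iff subset_iff\<close>)
qed

lemma lin_hom:
  assumes N: "module R N" and \<phi>: "\<phi> \<in> S \<rightarrow> carrier N"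
  shows "lin R N \<phi> \<in> mod_hom R (free_mod R S) N"
proof (rule mod_homI)
  interpret N: module R N by fact
  have \<phi>': "\<phi> s \<in> carrier N" if "s \<in> T" "T \<subseteq> S" for s T using \<phi> that by auto
  fix f assume f: "f \<in> carrier (free_mod R S)"
  note fc = free_closed[OF f] and fD = free_carrierD[OF f]
  show "lin R N \<phi> f \<in> carrier N"
    unfolding lin_def using fc \<phi>'[OF _ fD(4)] by (intro N.finsum_closed) auto
  show "lin R N \<phi> (r \<odot>\<^bsub>free_mod R S\<^esub> f) = r \<odot>\<^bsub>N\<^esub> lin R N \<phi> f" if r: "r \<in> carrier R" for r
  proof -
    interpret F: module R "free_mod R S" by (rule free_module)
    have "lin R N \<phi> (r \<odot>\<^bsub>free_mod R S\<^esub> f)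
        = (\<Oplus>\<^bsub>N\<^esub>s\<in>{s. f s \<noteq> \<zero>}. (r \<odot>\<^bsub>free_mod R S\<^esub> f) s \<odot>\<^bsub>N\<^esub> \<phi> s)"
      using r fD F.smult_closed[OF r f] by (intro lin_superset[OF N \<phi>]) (auto simp: free_simps(3))
    also have "\<dots> = (\<Oplus>\<^bsub>N\<^esub>s\<in>{s. f s \<noteq> \<zero>}. r \<odot>\<^bsub>N\<^esub> (f s \<odot>\<^bsub>N\<^esub> \<phi> s))"
      using fc \<phi>'[OF _ fD(4)] r by (intro N.finsum_cong') (auto simp: free_simps N.smult_assoc1)
    also have "\<dots> = r \<odot>\<^bsub>N\<^esub> lin R N \<phi> f"
      unfolding lin_def using fc \<phi>'[OF _ fD(4)] r fD(3) by (subst N.finsum_smult_ldistr) auto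
    finally show ?thesis .
  qed
  fix g assume g: "g \<in> carrier (free_mod R S)"
  note gc = free_closed[OF g] and gD = free_carrierD[OF g]
  show "lin R N \<phi> (f \<oplus>\<^bsub>free_mod R S\<^esub> g) = lin R N \<phi> f \<oplus>\<^bsub>N\<^esub> lin R N \<phi> g"
  proof -
    interpret F: module R "free_mod R S" by (rule free_module)
    let ?T = "{s. f s \<noteq> \<zero>} \<union> {s. g s \<noteq> \<zero>}"
    have T: "finite ?T" "?T \<subseteq> S" using fD gD by auto
    have "lin R N \<phi> (f \<oplus>\<^bsub>free_mod R S\<^esub> g) = (\<Oplus>\<^bsub>N\<^esub>s\<in>?T. (f \<oplus>\<^bsub>free_mod R S\<^esub> g) s \<odot>\<^bsub>N\<^esub> \<phi> s)"
      using T F.a_closed[OF f g] by (intro lin_superset[OF N \<phi>]) (auto simp: free_simps(2))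
    also have "\<dots> = (\<Oplus>\<^bsub>N\<^esub>s\<in>?T. f s \<odot>\<^bsub>N\<^esub> \<phi> s \<oplus>\<^bsub>N\<^esub> g s \<odot>\<^bsub>N\<^esub> \<phi> s)"
      using fc gc \<phi>'[OF _ T(2)] by (intro N.finsum_cong') (auto simp: free_simps N.smult_l_distr)
    also have "\<dots> = (\<Oplus>\<^bsub>N\<^esub>s\<in>?T. f s \<odot>\<^bsub>N\<^esub> \<phi> s) \<oplus>\<^bsub>N\<^esub> (\<Oplus>\<^bsub>N\<^esub>s\<in>?T. g s \<odot>\<^bsub>N\<^esub> \<phi> s)"
      using fc gc \<phi>'[OF _ T(2)] by (intro N.finsum_addf) auto
    also have "\<dots> = lin R N \<phi> f \<oplus>\<^bsub>N\<^esub> lin R N \<phi> g"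
      using lin_superset[OF N \<phi> f T(1) _ T(2)] lin_superset[OF N \<phi> g T(1) _ T(2)] by simp
    finally show ?thesis .
  qed
qed

lemma lin_basis:
  assumes N: "module R N" and \<phi>: "\<phi> \<in> S \<rightarrow> carrier N" and s: "s \<in> S"
  shows "lin R N \<phi> (basis_vec R s) = \<phi> s"
proof -
  interpret N: module R N by fact
  have "lin R N \<phi> (basis_vec R s) = (\<Oplus>\<^bsub>N\<^esub>t\<in>{s}. basis_vec R s t \<odot>\<^bsub>N\<^esub> \<phi> t)"
    using basis_closed[OF s] s by (intro lin_superset[OF N \<phi>]) (auto simp: basis_vec_def)
  also have "\<dots> = \<phi> s" using \<phi> s by (subst N.finsum_insert) (auto simp: basis_vec_def Pi_iff)
  finally show ?thesis .
qed

text \<open>Induction on a finite set containing the support, splitting off one coordinate. Applied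
  to equalizers and preimages of submodules, it reduces linear claims to basis vectors.\<close>

lemma free_submodule_full:
  assumes H: "submodule H R (free_mod R S)" and b: "\<And>s. s \<in> S \<Longrightarrow> basis_vec R s \<in> H"
    and f: "f \<in> carrier (free_mod R S)"
  shows "f \<in> H"
proof -
  interpret F: module R "free_mod R S" by (rule free_module)
  note HE = F.submoduleE[OF H]
  have "f \<in> H" if "finite T" "f \<in> carrier (free_mod R S)" "{s. f s \<noteq> \<zero>} \<subseteq> T" for T f
    using that
  proof (induction T arbitrary: f rule: finite_induct)
    case empty
    then have "f = \<zero>\<^bsub>free_mod R S\<^esub>" by (auto simp: free_simps)
    then show ?case using zero_in_submodule[OF H] by simp
  next
    case (insert t T)
    note fc = free_closed[OF insert.prems(1)] and fD = free_carrierD[OF insert.prems(1)]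
    let ?g = "\<lambda>s. if s = t then \<zero> else f s"
    have "?g \<in> carrier (free_mod R S)"
      using fc fD by (intro free_carrierI[of "{s. f s \<noteq> \<zero>}"]) auto
    then have g: "?g \<in> H" using insert.prems by (intro insert.IH) auto
    show ?case
    proof (cases "t \<in> S")
      case False
      then have "?g = f" using fD(2) by auto
      with g show ?thesis by simp
    next
      case True
      have "f = ?g \<oplus>\<^bsub>free_mod R S\<^esub> f t \<odot>\<^bsub>free_mod R S\<^esub> basis_vec R t"
        using fc by (auto simp: free_simps basis_vec_def fun_eq_iff)
      then show ?thesis using HE(4)[OF fc b[OF True]] HE(5)[OF g] by metis
    qed
  qed
  then show ?thesis using f free_carrierD(3)[OF f] by blast
qed

lemma free_hom_eq:
  assumes "module R N" "h \<in> mod_hom R (free_mod R S) N" "k \<in> mod_hom R (free_mod R S) N"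
    and "\<And>s. s \<in> S \<Longrightarrow> h (basis_vec R s) = k (basis_vec R s)" and "f \<in> carrier (free_mod R S)"
  shows "h f = k f"
proof -
  have "f \<in> {f \<in> carrier (free_mod R S). h f = k f}"
    by (rule free_submodule_full[OF submodule_equalizer[OF free_module assms(1-3)] _ assms(5)])
      (simp add: basis_closed assms(4))
  then show ?thesis by simp
qed

lemma lin_unique:
  assumes "module R N" "h \<in> mod_hom R (free_mod R S) N" "f \<in> carrier (free_mod R S)"
    and "\<phi> \<in> S \<rightarrow> carrier N" "\<And>s. s \<in> S \<Longrightarrow> h (basis_vec R s) = \<phi> s"
  shows "h f = lin R N \<phi> f"
  using assms by (intro free_hom_eq[OF assms(1,2) lin_hom[OF assms(1,4)] _ assms(3)]) (simp add: lin_basis)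

lemma lin_comp:
  assumes "module R N" "module R N'" "h \<in> mod_hom R N N'" "\<phi> \<in> S \<rightarrow> carrier N"
    "f \<in> carrier (free_mod R S)"
  shows "h (lin R N \<phi> f) = lin R N' (\<lambda>s. h (\<phi> s)) f"
proof (rule lin_unique[OF assms(2) mod_hom_comp[OF lin_hom[OF assms(1,4)] assms(3)] assms(5)])
  show "(\<lambda>s. h (\<phi> s)) \<in> S \<rightarrow> carrier N'" using assms(4) mod_hom_closed[OF assms(3)] by auto
qed (simp add: lin_basis[OF assms(1,4)])

lemma lin_cong:
  assumes "f \<in> carrier (free_mod R S)" "\<And>s. s \<in> S \<Longrightarrow> \<phi> s = \<psi> s" "\<psi> \<in> S \<rightarrow> carrier N" "module R N"
  shows "lin R N \<phi> f = lin R N \<psi> f"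
proof (rule lin_unique[OF assms(4) _ assms(1,3)])
  have \<phi>: "\<phi> \<in> S \<rightarrow> carrier N" using assms(2,3) by (auto simp: Pi_iff)
  then show "lin R N \<phi> \<in> mod_hom R (free_mod R S) N" using lin_hom assms(4) by blast
  show "lin R N \<phi> (basis_vec R s) = \<psi> s" if "s \<in> S" for s
    using lin_basis[OF assms(4) \<phi> that] assms(2) that by simp
qed

lemma lin_add:
  assumes "module R N" "\<phi> \<in> S \<rightarrow> carrier N" "\<psi> \<in> S \<rightarrow> carrier N" "f \<in> carrier (free_mod R S)"
  shows "lin R N (\<lambda>s. \<phi> s \<oplus>\<^bsub>N\<^esub> \<psi> s) f = lin R N \<phi> f \<oplus>\<^bsub>N\<^esub> lin R N \<psi> f"
proof -
  interpret N: module R N by fact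
  have "lin R N \<phi> f \<oplus>\<^bsub>N\<^esub> lin R N \<psi> f = lin R N (\<lambda>s. \<phi> s \<oplus>\<^bsub>N\<^esub> \<psi> s) f"
    using assms
    by (intro lin_unique[OF assms(1) mod_hom_plus[OF assms(1) lin_hom lin_hom] assms(4)])
      (auto simp: lin_basis Pi_iff)
  then show ?thesis by simp
qed

lemma lin_smult:
  assumes "module R N" "\<phi> \<in> S \<rightarrow> carrier N" "r \<in> carrier R" "f \<in> carrier (free_mod R S)"
  shows "lin R N (\<lambda>s. r \<odot>\<^bsub>N\<^esub> \<phi> s) f = r \<odot>\<^bsub>N\<^esub> lin R N \<phi> f"
proof -
  interpret N: module R N by fact
  have "(\<lambda>x. r \<odot>\<^bsub>N\<^esub> x) \<in> mod_hom R N N"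
    using assms(3) by (intro mod_homI) (auto simp: N.smult_r_distr m_comm simp flip: N.smult_assoc1)
  from lin_comp[OF assms(1,1) this assms(2,4)] show ?thesis by simp
qed

lemma lin_mem_submodule:
  assumes "module R N" "submodule H R N" "\<phi> \<in> S \<rightarrow> H" "f \<in> carrier (free_mod R S)"
  shows "lin R N \<phi> f \<in> H"
proof -
  interpret N: module R N by fact
  have \<phi>: "\<phi> \<in> S \<rightarrow> carrier N" using assms(3) N.submoduleE(1)[OF assms(2)] by auto
  have "f \<in> {f \<in> carrier (free_mod R S). lin R N \<phi> f \<in> H}"
    using assms(3)
    by (intro free_submodule_full[OF submodule_vimage[OF free_module assms(1) lin_hom[OF assms(1) \<phi>] assms(2)] _ assms(4)])
      (simp add: basis_closed Pi_iff lin_basis[OF assms(1) \<phi>])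
  then show ?thesis by simp
qed

end

locale presentation = base_ring R for R :: "'k ring" (structure) +
  fixes S :: "'s set" and Q
  assumes rels: "Q \<subseteq> carrier (free_mod R S)"
begin

sublocale F: module R "free_mod R S" by (rule free_module)

sublocale quot: mod_quotient R "free_mod R S" "mod_span R (free_mod R S) Q"
  by (intro mod_quotient.intro mod_quotient_axioms.intro F.module_axioms
      mod_span_submodule[OF F.module_axioms rels])

lemma pres_module: "module R (pres_mod R S Q)"
  unfolding pres_mod_def by (rule quot.quot_module)

lemma pres_gen_closed: "s \<in> S \<Longrightarrow> pres_gen R S Q s \<in> carrier (pres_mod R S Q)"
  unfolding pres_mod_def pres_gen_def quot.quot_carrier by (intro imageI basis_closed)

lemma lin_pres_gen:
  assumes "f \<in> carrier (free_mod R S)"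
  shows "lin R (pres_mod R S Q) (pres_gen R S Q) f = mod_span R (free_mod R S) Q +>\<^bsub>free_mod R S\<^esub> f"
  by (rule lin_unique[OF pres_module quot.quot_proj[folded pres_mod_def] assms, symmetric])
    (rule funcsetI, erule pres_gen_closed, simp add: pres_gen_def)

lemma pres_carrier: "carrier (pres_mod R S Q) = lin R (pres_mod R S Q) (pres_gen R S Q) ` carrier (free_mod R S)"
  using lin_pres_gen by (auto simp: pres_mod_def quot.quot_carrier)

lemma pres_submodule_full:
  assumes "submodule H R (pres_mod R S Q)" "\<And>s. s \<in> S \<Longrightarrow> pres_gen R S Q s \<in> H"
    and "x \<in> carrier (pres_mod R S Q)"
  shows "x \<in> H"
  using assms(2,3) lin_mem_submodule[OF pres_module assms(1), of "pres_gen R S Q" S]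
  by (auto simp: pres_carrier)

lemma pres_hom_eq:
  assumes "module R N" "h \<in> mod_hom R (pres_mod R S Q) N" "k \<in> mod_hom R (pres_mod R S Q) N"
    and "\<And>s. s \<in> S \<Longrightarrow> h (pres_gen R S Q s) = k (pres_gen R S Q s)" and "x \<in> carrier (pres_mod R S Q)"
  shows "h x = k x"
proof -
  have "x \<in> {x \<in> carrier (pres_mod R S Q). h x = k x}"
    by (rule pres_submodule_full[OF submodule_equalizer[OF pres_module assms(1-3)] _ assms(5)])
      (simp add: pres_gen_closed assms(4))
  then show ?thesis by simp
qed

lemma pres_rel:
  assumes "q \<in> Q"
  shows "lin R (pres_mod R S Q) (pres_gen R S Q) q = \<zero>\<^bsub>pres_mod R S Q\<^esub>"
proof -
  have "q \<in> carrier (free_mod R S)" "q \<in> mod_span R (free_mod R S) Q"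
    using assms rels mod_span_incl[of Q R "free_mod R S"] by auto
  then show ?thesis using quot.quot_zero_iff[of q] by (simp only: lin_pres_gen) (simp add: pres_mod_def)
qed

lemma pres_lift:
  assumes N: "module R N" and \<phi>: "\<phi> \<in> S \<rightarrow> carrier N"
    and 0: "\<And>q. q \<in> Q \<Longrightarrow> lin R N \<phi> q = \<zero>\<^bsub>N\<^esub>"
  shows pres_lift_hom: "pres_lift R S Q N \<phi> \<in> mod_hom R (pres_mod R S Q) N"
    and pres_lift_gen: "\<And>s. s \<in> S \<Longrightarrow> pres_lift R S Q N \<phi> (pres_gen R S Q s) = \<phi> s"
proof -
  have "mod_span R (free_mod R S) Q \<subseteq> {f \<in> carrier (free_mod R S). lin R N \<phi> f = \<zero>\<^bsub>N\<^esub>}"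
    using 0 rels by (intro mod_span_least submodule_kernel[OF F.module_axioms N lin_hom[OF N \<phi>]]) auto
  then obtain k where k: "k \<in> mod_hom R (pres_mod R S Q) N"
    "\<And>x. x \<in> carrier (free_mod R S) \<Longrightarrow> k (mod_span R (free_mod R S) Q +>\<^bsub>free_mod R S\<^esub> x) = lin R N \<phi> x"
    using quot.quot_lift[OF N lin_hom[OF N \<phi>]] unfolding pres_mod_def by blast
  \<comment> \<open>\<open>pres_lift\<close> is a definite description among extensional functions,
    so the map obtained from the quotient is cut off outside the carrier before uniqueness is
    argued.\<close>
  define k' where "k' = restrict k (carrier (pres_mod R S Q))"
  interpret Pm: module R "pres_mod R S Q" by (rule pres_module)
  have k': "k' \<in> mod_hom R (pres_mod R S Q) N"
    using k(1) unfolding mod_hom_def k'_def by auto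
  moreover have "k' \<in> extensional (carrier (pres_mod R S Q))" unfolding k'_def by auto
  moreover have gen: "k' (pres_gen R S Q s) = \<phi> s" if "s \<in> S" for s
    using k(2)[OF basis_closed[OF that]] pres_gen_closed[OF that] lin_basis[OF N \<phi> that]
    unfolding k'_def by (simp add: pres_gen_def)
  moreover have "h = k'" if "h \<in> mod_hom R (pres_mod R S Q) N \<and>
     h \<in> extensional (carrier (pres_mod R S Q)) \<and> (\<forall>s \<in> S. h (pres_gen R S Q s) = \<phi> s)" for h
    using that pres_hom_eq[OF N _ k', of h] gen by (intro extensionalityI[of _ "carrier (pres_mod R S Q)"]) (auto simp: k'_def)
  ultimately have "pres_lift R S Q N \<phi> = k'"
    unfolding pres_lift_def by (intro the_equality) auto
  then show "pres_lift R S Q N \<phi> \<in> mod_hom R (pres_mod R S Q) N"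
    "\<And>s. s \<in> S \<Longrightarrow> pres_lift R S Q N \<phi> (pres_gen R S Q s) = \<phi> s"
    using k' gen by auto
qed

end

section \<open>Tensor powers and the symmetric bar construction\<close>


locale tensor = base_ring R + A: module R A for R :: "'k ring" (structure) and A :: "('k, 'a) module"
begin

lemma tens_rels_closed: "tens_rels R A n \<subseteq> carrier (free_mod R (tens_gens A n))"
proof -
  interpret F: module R "free_mod R (tens_gens A n)" by (rule free_module)
  show ?thesis
    unfolding tens_rels_def Let_def
    by (intro subsetI, elim UnE CollectE exE conjE; hypsubst;
        intro F.minus_closed F.a_closed F.smult_closed basis_closed) (auto simp: tens_gens_def)
qed

sublocale tens: presentation R "tens_gens A n" "tens_rels R A n" for n
  by (intro presentation.intro base_ring_axioms presentation_axioms.intro tens_rels_closed)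

lemma tens_module: "module R (tens_pow R A n)"
  unfolding tens_pow_def by (rule tens.pres_module)

lemma pure_closed: "as \<in> tens_gens A n \<Longrightarrow> pure R A as \<in> carrier (tens_pow R A n)"
  using tens.pres_gen_closed[of as n] unfolding pure_def tens_pow_def tens_gens_def by auto

lemma tens_hom_eq:
  assumes "module R N" "h \<in> mod_hom R (tens_pow R A n) N" "k \<in> mod_hom R (tens_pow R A n) N"
    and "\<And>as. as \<in> tens_gens A n \<Longrightarrow> h (pure R A as) = k (pure R A as)"
    and "x \<in> carrier (tens_pow R A n)"
  shows "h x = k x"
  using assms tens.pres_hom_eq[of N h n k x] unfolding pure_def tens_pow_def tens_gens_def by auto

lemma lin_tens_rel:
  assumes N: "module R N" and \<phi>: "\<phi> \<in> tens_gens A n \<rightarrow> carrier N"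
    and add: "\<And>us a b vs. us @ [a] @ vs \<in> tens_gens A n \<Longrightarrow> b \<in> carrier A \<Longrightarrow>
      \<phi> (us @ [a \<oplus>\<^bsub>A\<^esub> b] @ vs) = \<phi> (us @ [a] @ vs) \<oplus>\<^bsub>N\<^esub> \<phi> (us @ [b] @ vs)"
    and smult: "\<And>us a r vs. us @ [a] @ vs \<in> tens_gens A n \<Longrightarrow> r \<in> carrier R \<Longrightarrow>
      \<phi> (us @ [r \<odot>\<^bsub>A\<^esub> a] @ vs) = r \<odot>\<^bsub>N\<^esub> \<phi> (us @ [a] @ vs)"
    and q: "q \<in> tens_rels R A n"
  shows "lin R N \<phi> q = \<zero>\<^bsub>N\<^esub>"
proof -
  let ?F = "free_mod R (tens_gens A n)"
  interpret N: module R N by fact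
  note hom = lin_hom[OF N \<phi>]
  note simps = mod_hom_minus[OF free_module N hom] mod_hom_add[OF hom] mod_hom_smult[OF hom]
    lin_basis[OF N \<phi>] basis_closed
  from q consider
    (1) us vs a b where "q = basis_vec R (us @ [a \<oplus>\<^bsub>A\<^esub> b] @ vs) \<ominus>\<^bsub>?F\<^esub>
        (basis_vec R (us @ [a] @ vs) \<oplus>\<^bsub>?F\<^esub> basis_vec R (us @ [b] @ vs))"
      "us @ [a] @ vs \<in> tens_gens A n" "b \<in> carrier A"
  | (2) us vs a r where "q = basis_vec R (us @ [r \<odot>\<^bsub>A\<^esub> a] @ vs) \<ominus>\<^bsub>?F\<^esub>
        (r \<odot>\<^bsub>?F\<^esub> basis_vec R (us @ [a] @ vs))"
      "us @ [a] @ vs \<in> tens_gens A n" "r \<in> carrier R"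
    unfolding tens_rels_def Let_def by auto
  then show ?thesis
  proof cases
    case 1
    then have "us @ [a \<oplus>\<^bsub>A\<^esub> b] @ vs \<in> tens_gens A n" "us @ [b] @ vs \<in> tens_gens A n"
      by (auto simp: tens_gens_def)
    then show ?thesis using 1 add[OF 1(2,3)] \<phi>
      by (simp add: simps del: append_Cons append_Nil) (simp add: Pi_iff)
  next
    case 2
    then have "us @ [r \<odot>\<^bsub>A\<^esub> a] @ vs \<in> tens_gens A n"
      by (auto simp: tens_gens_def)
    then show ?thesis using 2 smult[OF 2(2,3)] \<phi>
      by (simp add: simps del: append_Cons append_Nil) (simp add: Pi_iff)
  qed
qed

lemma tens_lift:
  assumes "module R N" "\<phi> \<in> tens_gens A n \<rightarrow> carrier N"
    and "\<And>us a b vs. us @ [a] @ vs \<in> tens_gens A n \<Longrightarrow> b \<in> carrier A \<Longrightarrow>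
      \<phi> (us @ [a \<oplus>\<^bsub>A\<^esub> b] @ vs) = \<phi> (us @ [a] @ vs) \<oplus>\<^bsub>N\<^esub> \<phi> (us @ [b] @ vs)"
    and "\<And>us a r vs. us @ [a] @ vs \<in> tens_gens A n \<Longrightarrow> r \<in> carrier R \<Longrightarrow>
      \<phi> (us @ [r \<odot>\<^bsub>A\<^esub> a] @ vs) = r \<odot>\<^bsub>N\<^esub> \<phi> (us @ [a] @ vs)"
  shows tens_lift_hom: "tens_lift R A n N \<phi> \<in> mod_hom R (tens_pow R A n) N"
    and tens_lift_pure: "\<And>as. as \<in> tens_gens A n \<Longrightarrow> tens_lift R A n N \<phi> (pure R A as) = \<phi> as"
  using tens.pres_lift_hom[OF assms(1,2) lin_tens_rel[OF assms]]
    tens.pres_lift_gen[OF assms(1,2) lin_tens_rel[OF assms]]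
  unfolding tens_lift_def tens_pow_def pure_def tens_gens_def by auto

lemma pure_add:
  assumes "us @ [a] @ vs \<in> tens_gens A n" "b \<in> carrier A"
  shows "pure R A (us @ [a \<oplus>\<^bsub>A\<^esub> b] @ vs)
    = pure R A (us @ [a] @ vs) \<oplus>\<^bsub>tens_pow R A n\<^esub> pure R A (us @ [b] @ vs)"
proof -
  let ?F = "free_mod R (tens_gens A n)"
  let ?g = "pres_gen R (tens_gens A n) (tens_rels R A n)"
  interpret N: module R "tens_pow R A n" by (rule tens_module)
  have \<phi>: "?g \<in> tens_gens A n \<rightarrow> carrier (tens_pow R A n)"
    using tens.pres_gen_closed unfolding tens_pow_def by blast
  note hom = lin_hom[OF N.module_axioms \<phi>]
  have gens: "us @ [a \<oplus>\<^bsub>A\<^esub> b] @ vs \<in> tens_gens A n" "us @ [b] @ vs \<in> tens_gens A n"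
    using assms by (auto simp: tens_gens_def)
  have "basis_vec R (us @ [a \<oplus>\<^bsub>A\<^esub> b] @ vs) \<ominus>\<^bsub>?F\<^esub>
      (basis_vec R (us @ [a] @ vs) \<oplus>\<^bsub>?F\<^esub> basis_vec R (us @ [b] @ vs)) \<in> tens_rels R A n"
    unfolding tens_rels_def Let_def using assms by blast
  from tens.pres_rel[OF this, folded tens_pow_def]
  have "?g (us @ [a \<oplus>\<^bsub>A\<^esub> b] @ vs) \<ominus>\<^bsub>tens_pow R A n\<^esub>
      (?g (us @ [a] @ vs) \<oplus>\<^bsub>tens_pow R A n\<^esub> ?g (us @ [b] @ vs)) = \<zero>\<^bsub>tens_pow R A n\<^esub>"
    using gens assms(1)
    by (simp add: mod_hom_minus[OF free_module N.module_axioms hom] mod_hom_add[OF hom]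
      lin_basis[OF N.module_axioms \<phi>] basis_closed del: append_Cons append_Nil)
  then have "?g (us @ [a \<oplus>\<^bsub>A\<^esub> b] @ vs) =
      ?g (us @ [a] @ vs) \<oplus>\<^bsub>tens_pow R A n\<^esub> ?g (us @ [b] @ vs)"
    using \<phi> gens assms(1) by (subst (asm) N.minus_eq_zero_iff) (auto simp: Pi_iff)
  moreover have "pure R A w = ?g w" if "w \<in> tens_gens A n" for w
    using that by (simp add: pure_def tens_gens_def)
  ultimately show ?thesis using gens assms(1) by simp
qed

lemma pure_smult:
  assumes "us @ [a] @ vs \<in> tens_gens A n" "r \<in> carrier R"
  shows "pure R A (us @ [r \<odot>\<^bsub>A\<^esub> a] @ vs) = r \<odot>\<^bsub>tens_pow R A n\<^esub> pure R A (us @ [a] @ vs)"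
proof -
  let ?F = "free_mod R (tens_gens A n)"
  let ?g = "pres_gen R (tens_gens A n) (tens_rels R A n)"
  interpret N: module R "tens_pow R A n" by (rule tens_module)
  have \<phi>: "?g \<in> tens_gens A n \<rightarrow> carrier (tens_pow R A n)"
    using tens.pres_gen_closed unfolding tens_pow_def by blast
  note hom = lin_hom[OF N.module_axioms \<phi>]
  have gens: "us @ [r \<odot>\<^bsub>A\<^esub> a] @ vs \<in> tens_gens A n"
    using assms by (auto simp: tens_gens_def)
  have "basis_vec R (us @ [r \<odot>\<^bsub>A\<^esub> a] @ vs) \<ominus>\<^bsub>?F\<^esub>
      (r \<odot>\<^bsub>?F\<^esub> basis_vec R (us @ [a] @ vs)) \<in> tens_rels R A n"
    unfolding tens_rels_def Let_def using assms by blast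
  from tens.pres_rel[OF this, folded tens_pow_def]
  have "?g (us @ [r \<odot>\<^bsub>A\<^esub> a] @ vs) \<ominus>\<^bsub>tens_pow R A n\<^esub>
      (r \<odot>\<^bsub>tens_pow R A n\<^esub> ?g (us @ [a] @ vs)) = \<zero>\<^bsub>tens_pow R A n\<^esub>"
    using gens assms
    by (simp add: mod_hom_minus[OF free_module N.module_axioms hom] mod_hom_smult[OF hom]
      lin_basis[OF N.module_axioms \<phi>] basis_closed del: append_Cons append_Nil)
  then have "?g (us @ [r \<odot>\<^bsub>A\<^esub> a] @ vs) = r \<odot>\<^bsub>tens_pow R A n\<^esub> ?g (us @ [a] @ vs)"
    using \<phi> gens assms by (subst (asm) N.minus_eq_zero_iff) (auto simp: Pi_iff)
  moreover have "pure R A w = ?g w" if "w \<in> tens_gens A n" for w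
    using that by (simp add: pure_def tens_gens_def)
  ultimately show ?thesis using gens assms(1) by simp
qed

end

section \<open>The category \<open>DeltaS\<close> and functoriality of the bar construction\<close>

locale small_cat =
  fixes C :: "('o, 'm) cat"
  assumes Dom_Ob: "f \<in> Ar C \<Longrightarrow> Dom C f \<in> Ob C" and Cod_Ob: "f \<in> Ar C \<Longrightarrow> Cod C f \<in> Ob C"
    and Idn_arrow: "x \<in> Ob C \<Longrightarrow> Idn C x \<in> Ar C"
    and Dom_Idn: "x \<in> Ob C \<Longrightarrow> Dom C (Idn C x) = x" and Cod_Idn: "x \<in> Ob C \<Longrightarrow> Cod C (Idn C x) = x"
    and Cmp_arrow: "f \<in> Ar C \<Longrightarrow> g \<in> Ar C \<Longrightarrow> Cod C f = Dom C g \<Longrightarrow> Cmp C g f \<in> Ar C"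
    and Dom_Cmp: "f \<in> Ar C \<Longrightarrow> g \<in> Ar C \<Longrightarrow> Cod C f = Dom C g \<Longrightarrow> Dom C (Cmp C g f) = Dom C f"
    and Cod_Cmp: "f \<in> Ar C \<Longrightarrow> g \<in> Ar C \<Longrightarrow> Cod C f = Dom C g \<Longrightarrow> Cod C (Cmp C g f) = Cod C g"
    and Cmp_assoc: "f \<in> Ar C \<Longrightarrow> g \<in> Ar C \<Longrightarrow> h \<in> Ar C \<Longrightarrow> Cod C f = Dom C g \<Longrightarrow> Cod C g = Dom C h \<Longrightarrow>
      Cmp C h (Cmp C g f) = Cmp C (Cmp C h g) f"
    and Cmp_Idn_right: "f \<in> Ar C \<Longrightarrow> Cmp C f (Idn C (Dom C f)) = f"
    and Cmp_Idn_left: "f \<in> Ar C \<Longrightarrow> Cmp C (Idn C (Cod C f)) f = f"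
begin

lemmas cat_simps = Dom_Ob Cod_Ob Idn_arrow Dom_Idn Cod_Idn Cmp_arrow Dom_Cmp Cod_Cmp
  Cmp_Idn_right Cmp_Idn_left

end

lemma DeltaS_simps [simp]:
  "Ob DeltaS = UNIV" "Ar DeltaS = {f. is_ds_arrow f}" "Dom DeltaS = src" "Cod DeltaS = tgt"
  "src (Idn DeltaS n) = n" "tgt (Idn DeltaS n) = n"
  "fib (Idn DeltaS n) j = (if j \<le> n then [j] else [])" "und (Idn DeltaS n) = restrict id {..n}"
  "src (Cmp DeltaS g f) = src f" "tgt (Cmp DeltaS g f) = tgt g"
  "fib (Cmp DeltaS g f) i = concat (map (fib f) (fib g i))"
  "und (Cmp DeltaS g f) = compose {..src f} (und g) (und f)"
  unfolding DeltaS_def by auto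

lemma fib_Cmp: "fib (Cmp DeltaS g f) = (\<lambda>i. concat (map (fib f) (fib g i)))"
  by (simp add: fun_eq_iff)

lemma ds_arrowD:
  assumes "is_ds_arrow f"
  shows "distinct (fib f j)" "set (fib f j) = {i. i \<le> src f \<and> und f i = j}"
    "i \<le> src f \<Longrightarrow> und f i \<le> tgt f" "\<not> i \<le> src f \<Longrightarrow> und f i = undefined"
    "und f \<in> extensional {..src f}"
  using assms unfolding is_ds_arrow_def by (auto simp: PiE_iff extensional_def)

text \<open>The underlying map can be read off from the fibres over the target, and the default
  values outside source and target are forced. Equations between composites thus become equations
  between lists.\<close>

lemma ds_arrow_eqI:
  assumes "is_ds_arrow f" "is_ds_arrow g" "src f = src g" "tgt f = tgt g"
    and "\<And>j. j \<le> tgt f \<Longrightarrow> fib f j = fib g j"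
  shows "f = g"
proof -
  have "und f i = und g i" for i
  proof (cases "i \<le> src f")
    case True
    then have "i \<in> set (fib g (und f i))"
      using ds_arrowD(2,3)[OF assms(1)] assms(5) by (metis (mono_tags, lifting) mem_Collect_eq)
    then show ?thesis using ds_arrowD(2)[OF assms(2)] by auto
  next
    case False
    then show ?thesis using ds_arrowD(4)[OF assms(1)] ds_arrowD(4)[OF assms(2)] assms(3) by simp
  qed
  moreover have "fib f j = fib g j" for j
  proof (cases "j \<le> tgt f")
    case False
    have "set (fib f j) = {}" "set (fib g j) = {}"
      using False ds_arrowD(2,3)[OF assms(1)] ds_arrowD(2,3)[OF assms(2)] assms(4) by auto
    then show ?thesis by simp
  qed (use assms in simp)
  ultimately show ?thesis using assms by (intro ds_arrow.equality) auto
qed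

lemma ds_Idn: "is_ds_arrow (Idn DeltaS n)"
  unfolding is_ds_arrow_def by (auto simp: PiE_iff)

lemma ds_Cmp:
  assumes f: "is_ds_arrow f" and g: "is_ds_arrow g" and fg: "tgt f = src g"
  shows "is_ds_arrow (Cmp DeltaS g f)"
proof -
  note fD = ds_arrowD[OF f] and gD = ds_arrowD[OF g]
  have "distinct (concat (map (fib f) js))" if "distinct js" for js
    using that fD(1,2) by (induction js) auto
  then show ?thesis
    unfolding is_ds_arrow_def using fD gD fg by (auto simp: PiE_iff compose_def extensional_def)
qed

interpretation DeltaS: small_cat DeltaS
proof
  fix f g h assume fgh: "f \<in> Ar DeltaS" "g \<in> Ar DeltaS" "h \<in> Ar DeltaS"
    "Cod DeltaS f = Dom DeltaS g" "Cod DeltaS g = Dom DeltaS h"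
  have c: "concat (map (fib f) (concat (map (fib g) xs))) = concat (map (\<lambda>j. concat (map (fib f) (fib g j))) xs)" for xs
    by (induction xs) auto
  show "Cmp DeltaS h (Cmp DeltaS g f) = Cmp DeltaS (Cmp DeltaS h g) f"
    using fgh by (intro ds_arrow_eqI ds_Cmp) (auto simp: c fib_Cmp)
next
  fix f assume "f \<in> Ar DeltaS"
  moreover have "concat (map (fib (Idn DeltaS (src f))) xs) = xs" if "set xs \<subseteq> {..src f}" for xs
    using that by (induction xs) auto
  ultimately show "Cmp DeltaS f (Idn DeltaS (Dom DeltaS f)) = f"
    using ds_arrowD(2)[of f] by (intro ds_arrow_eqI ds_Cmp ds_Idn) auto
next
  fix f assume "f \<in> Ar DeltaS"
  then show "Cmp DeltaS (Idn DeltaS (Cod DeltaS f)) f = f"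
    by (intro ds_arrow_eqI ds_Cmp ds_Idn) auto
qed (auto intro: ds_Idn ds_Cmp)

locale algebra_over = base_ring R for R :: "'k ring" (structure) and A :: "('k, 'a) module" +
  assumes ua: "unital_algebra R A"
begin

sublocale A: module R A
  using ua unfolding unital_algebra_def by auto

sublocale AR: ring A
  using ua unfolding unital_algebra_def by auto

sublocale tensor R A
  by (intro tensor.intro base_ring_axioms A.module_axioms)

lemma smult_mult:
  assumes "r \<in> carrier R" "a \<in> carrier A" "b \<in> carrier A"
  shows "(r \<odot>\<^bsub>A\<^esub> a) \<otimes>\<^bsub>A\<^esub> b = r \<odot>\<^bsub>A\<^esub> (a \<otimes>\<^bsub>A\<^esub> b)" "a \<otimes>\<^bsub>A\<^esub> (r \<odot>\<^bsub>A\<^esub> b) = r \<odot>\<^bsub>A\<^esub> (a \<otimes>\<^bsub>A\<^esub> b)"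
  using ua assms unfolding unital_algebra_def by auto

lemma list_prod_simps [simp]:
  "list_prod A [] = \<one>\<^bsub>A\<^esub>" "list_prod A (a # as) = a \<otimes>\<^bsub>A\<^esub> list_prod A as"
  by (auto simp: list_prod_def)

lemma list_prod_closed: "set as \<subseteq> carrier A \<Longrightarrow> list_prod A as \<in> carrier A"
  by (induction as) auto

lemma list_prod_append:
  "set as \<subseteq> carrier A \<Longrightarrow> set bs \<subseteq> carrier A \<Longrightarrow> list_prod A (as @ bs) = list_prod A as \<otimes>\<^bsub>A\<^esub> list_prod A bs"
  by (induction as) (auto simp: list_prod_closed AR.m_assoc)

lemma list_prod_concat:
  "(\<And>as. as \<in> set ass \<Longrightarrow> set as \<subseteq> carrier A) \<Longrightarrow>
    list_prod A (concat ass) = list_prod A (map (list_prod A) ass)"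
  by (induction ass) (auto simp: list_prod_append UN_subset_iff)

definition act :: "ds_arrow \<Rightarrow> 'a list \<Rightarrow> 'a list" where
  "act \<alpha> as = map (\<lambda>j. list_prod A (map ((!) as) (fib \<alpha> j))) [0..<tgt \<alpha> + 1]"

lemma act_entry_closed:
  assumes "is_ds_arrow \<alpha>" "as \<in> tens_gens A (src \<alpha> + 1)"
  shows "i \<in> set (fib \<alpha> j) \<Longrightarrow> as ! i \<in> carrier A"
  using assms ds_arrowD(2)[OF assms(1)] by (auto simp: tens_gens_def subset_iff)

lemma act_closed:
  assumes "is_ds_arrow \<alpha>" "as \<in> tens_gens A (src \<alpha> + 1)"
  shows "act \<alpha> as \<in> tens_gens A (tgt \<alpha> + 1)"
  using act_entry_closed[OF assms] by (auto simp: act_def tens_gens_def intro!: list_prod_closed)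

lemma act_Idn: "as \<in> tens_gens A (n + 1) \<Longrightarrow> act (Idn DeltaS n) as = as"
  unfolding act_def by (intro nth_equalityI) (auto simp: tens_gens_def nth_append subset_iff simp del: upt_Suc)

text \<open>Fibres of a composite are concatenated fibres, and by associativity the product over a
  concatenation is the product of the partial products.\<close>

lemma act_Cmp:
  assumes "is_ds_arrow f" "is_ds_arrow g" "tgt f = src g" "as \<in> tens_gens A (src f + 1)"
  shows "act (Cmp DeltaS g f) as = act g (act f as)"
proof -
  have "list_prod A (map ((!) as) (concat (map (fib f) (fib g i)))) = list_prod A (map ((!) (act f as)) (fib g i))" for i
  proof -
    have "list_prod A (map ((!) as) (concat (map (fib f) (fib g i))))
        = list_prod A (map (list_prod A) (map (map ((!) as)) (map (fib f) (fib g i))))"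
      unfolding map_concat using act_entry_closed[OF assms(1,4)] by (intro list_prod_concat) auto
    also have "map (list_prod A) (map (map ((!) as)) (map (fib f) (fib g i))) = map ((!) (act f as)) (fib g i)"
      using ds_arrowD(2)[OF assms(2)] assms(3) by (auto simp: act_def simp del: upt_Suc)
    finally show ?thesis .
  qed
  then show ?thesis by (simp add: act_def)
qed

text \<open>When a single tensor entry varies, only the output slot containing it changes, and there
  it is multiplied by fixed products on both sides. Multilinearity of the action is thereby reduced
  to bilinearity of the product in one slot.\<close>

lemma act_split:
  assumes \<alpha>: "is_ds_arrow \<alpha>" and gens: "us @ [a] @ vs \<in> tens_gens A (src \<alpha> + 1)"
  obtains ws zs xs ys where "set (ws @ zs @ xs @ ys) \<subseteq> carrier A"
    "\<And>b. b \<in> carrier A \<Longrightarrow> act \<alpha> (us @ [b] @ vs) = ws @ [list_prod A xs \<otimes>\<^bsub>A\<^esub> (b \<otimes>\<^bsub>A\<^esub> list_prod A ys)] @ zs"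
proof -
  define p where "p = length us"
  define j where "j = und \<alpha> p"
  note D = ds_arrowD[OF \<alpha>]
  have p: "p \<le> src \<alpha>" using gens by (auto simp: tens_gens_def p_def)
  then have j: "j \<le> tgt \<alpha>" "p \<in> set (fib \<alpha> j)" using D by (auto simp: j_def)
  then obtain l1 l2 where l: "fib \<alpha> j = l1 @ p # l2" by (meson split_list)
  have e: "((us @ [b] @ vs) ! i) = (us @ [a] @ vs) ! i" if "i \<noteq> p" for i b
    using that by (auto simp: nth_append p_def nth_Cons')
  let ?e = "\<lambda>i. (us @ [a] @ vs) ! i"
  let ?m = "\<lambda>i. list_prod A (map ?e (fib \<alpha> i))"
  have nl: "p \<notin> set l1" "p \<notin> set l2" using D(1)[of j] l by auto
  have cl: "set (map ?e (fib \<alpha> i)) \<subseteq> carrier A" for i using act_entry_closed[OF \<alpha> gens] by auto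
  have up: "[0..<tgt \<alpha> + 1] = [0..<j] @ [j] @ [Suc j..<tgt \<alpha> + 1]"
    using j(1) upt_add_eq_append[of 0 j "tgt \<alpha> + 1 - j"] by (simp add: upt_conv_Cons del: upt_Suc)
  show thesis
  proof
    have m: "set (map ?m is) \<subseteq> carrier A" for "is" using list_prod_closed[OF cl] by auto
    show "set (map ?m [0..<j] @ map ?m [Suc j..<tgt \<alpha> + 1] @ map ?e l1 @ map ?e l2) \<subseteq> carrier A"
      using m[of "[0..<j]"] m[of "[Suc j..<tgt \<alpha> + 1]"] cl[of j] l by (simp del: upt_Suc)
    fix b assume b: "b \<in> carrier A"
    let ?f = "\<lambda>i. (us @ [b] @ vs) ! i"
    have other: "list_prod A (map ?f (fib \<alpha> i)) = ?m i" if "i \<noteq> j" for i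
    proof -
      have "p \<notin> set (fib \<alpha> i)" using that D(2) by (auto simp: j_def)
      then have "map ?f (fib \<alpha> i) = map ?e (fib \<alpha> i)" by (intro map_cong[OF refl] e) auto
      then show ?thesis by (simp only:)
    qed
    have others: "map (\<lambda>i. list_prod A (map ?f (fib \<alpha> i))) is = map ?m is" if "j \<notin> set is" for "is"
      using that by (intro map_cong[OF refl] other) blast
    have mid: "list_prod A (map ?f (fib \<alpha> j)) = list_prod A (map ?e l1) \<otimes>\<^bsub>A\<^esub> (b \<otimes>\<^bsub>A\<^esub> list_prod A (map ?e l2))"
    proof -
      have "map ?f l1 = map ?e l1" "map ?f l2 = map ?e l2" using nl by (intro map_cong[OF refl] e; blast)+
      moreover have "?f p = b" by (simp add: p_def)
      ultimately have "map ?f (fib \<alpha> j) = map ?e l1 @ b # map ?e l2"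
        by (simp only: l map_append list.map)
      moreover have "set (map ?e l1) \<subseteq> carrier A" "set (b # map ?e l2) \<subseteq> carrier A"
        using cl[of j] b l by auto
      ultimately show ?thesis by (simp only: list_prod_append list_prod_simps)
    qed
    have "j \<notin> set [0..<j]" "j \<notin> set [Suc j..<tgt \<alpha> + 1]" by simp_all
    note o = this[THEN others]
    show "act \<alpha> (us @ [b] @ vs) = map ?m [0..<j] @
        [list_prod A (map ?e l1) \<otimes>\<^bsub>A\<^esub> (b \<otimes>\<^bsub>A\<^esub> list_prod A (map ?e l2))] @ map ?m [Suc j..<tgt \<alpha> + 1]"
      unfolding act_def up by (simp only: map_append list.map o mid)
  qed
qed

lemma Bsym_fob: "fob (Bsym R A) n = tens_pow R A (n + 1)"
  by (simp add: Bsym_def)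

lemma Bsym_far:
  assumes \<alpha>: "is_ds_arrow \<alpha>"
  shows Bsym_hom: "far (Bsym R A) \<alpha> \<in> mod_hom R (tens_pow R A (src \<alpha> + 1)) (tens_pow R A (tgt \<alpha> + 1))"
    and Bsym_pure: "\<And>as. as \<in> tens_gens A (src \<alpha> + 1) \<Longrightarrow> far (Bsym R A) \<alpha> (pure R A as) = pure R A (act \<alpha> as)"
proof -
  let ?\<phi> = "\<lambda>as. pure R A (act \<alpha> as)"
  have *: "?\<phi> (us @ [a \<oplus>\<^bsub>A\<^esub> b] @ vs) = ?\<phi> (us @ [a] @ vs) \<oplus>\<^bsub>tens_pow R A (tgt \<alpha> + 1)\<^esub> ?\<phi> (us @ [b] @ vs)"
    if g: "us @ [a] @ vs \<in> tens_gens A (src \<alpha> + 1)" and b: "b \<in> carrier A" for us a b vs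
  proof -
    obtain ws zs xs ys where s: "set (ws @ zs @ xs @ ys) \<subseteq> carrier A"
      "\<And>b. b \<in> carrier A \<Longrightarrow> act \<alpha> (us @ [b] @ vs) = ws @ [list_prod A xs \<otimes>\<^bsub>A\<^esub> (b \<otimes>\<^bsub>A\<^esub> list_prod A ys)] @ zs"
      using act_split[OF \<alpha> g] by metis
    have a: "a \<in> carrier A" using g by (auto simp: tens_gens_def)
    have c: "list_prod A xs \<in> carrier A" "list_prod A ys \<in> carrier A" using s(1) by (auto intro: list_prod_closed)
    show ?thesis using a b c act_closed[OF \<alpha> g]
      by (simp only: s(2) A.a_closed AR.l_distr AR.r_distr AR.m_closed) (intro pure_add, auto)
  qed
  have **: "?\<phi> (us @ [r \<odot>\<^bsub>A\<^esub> a] @ vs) = r \<odot>\<^bsub>tens_pow R A (tgt \<alpha> + 1)\<^esub> ?\<phi> (us @ [a] @ vs)"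
    if g: "us @ [a] @ vs \<in> tens_gens A (src \<alpha> + 1)" and r: "r \<in> carrier R" for us a r vs
  proof -
    obtain ws zs xs ys where s: "set (ws @ zs @ xs @ ys) \<subseteq> carrier A"
      "\<And>b. b \<in> carrier A \<Longrightarrow> act \<alpha> (us @ [b] @ vs) = ws @ [list_prod A xs \<otimes>\<^bsub>A\<^esub> (b \<otimes>\<^bsub>A\<^esub> list_prod A ys)] @ zs"
      using act_split[OF \<alpha> g] by metis
    have a: "a \<in> carrier A" using g by (auto simp: tens_gens_def)
    have c: "list_prod A xs \<in> carrier A" "list_prod A ys \<in> carrier A" using s(1) by (auto intro: list_prod_closed)
    show ?thesis using a r c act_closed[OF \<alpha> g]
      by (simp only: s(2) A.smult_closed smult_mult AR.m_closed) (intro pure_smult, auto)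
  qed
  have \<phi>: "?\<phi> \<in> tens_gens A (src \<alpha> + 1) \<rightarrow> carrier (tens_pow R A (tgt \<alpha> + 1))"
    using act_closed[OF \<alpha>] by (auto intro!: pure_closed)
  have far: "far (Bsym R A) \<alpha> = tens_lift R A (src \<alpha> + 1) (tens_pow R A (tgt \<alpha> + 1)) ?\<phi>"
    by (simp add: Bsym_def act_def)
  show "far (Bsym R A) \<alpha> \<in> mod_hom R (tens_pow R A (src \<alpha> + 1)) (tens_pow R A (tgt \<alpha> + 1))"
    unfolding far by (rule tens_lift_hom[OF tens_module \<phi> * **])
  show "far (Bsym R A) \<alpha> (pure R A as) = pure R A (act \<alpha> as)" if "as \<in> tens_gens A (src \<alpha> + 1)" for as
    unfolding far by (rule tens_lift_pure[OF tens_module \<phi> * ** that])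
qed

lemma Bsym_functor: "co_functor R DeltaS (Bsym R A)"
  unfolding co_functor_def
proof (intro conjI ballI impI)
  fix n v assume v: "v \<in> carrier (fob (Bsym R A) n)"
  show "far (Bsym R A) (Idn DeltaS n) v = v"
  proof (rule tens_hom_eq[OF tens_module _ mod_hom_ident])
    show "far (Bsym R A) (Idn DeltaS n) \<in> mod_hom R (tens_pow R A (n + 1)) (tens_pow R A (n + 1))"
      using Bsym_hom[OF ds_Idn, of n] by simp
    show "far (Bsym R A) (Idn DeltaS n) (pure R A as) = pure R A as" if "as \<in> tens_gens A (n + 1)" for as
      using Bsym_pure[OF ds_Idn, of as n] act_Idn[OF that] that by simp
  qed (use v in \<open>simp add: Bsym_fob\<close>)
next
  fix f g v assume fg: "f \<in> Ar DeltaS" "g \<in> Ar DeltaS" "Cod DeltaS f = Dom DeltaS g"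
    and v: "v \<in> carrier (fob (Bsym R A) (Dom DeltaS f))"
  let ?T = "\<lambda>n. tens_pow R A (n + 1)"
  have f: "is_ds_arrow f" and g: "is_ds_arrow g" and eq: "tgt f = src g" using fg by auto
  note gf = ds_Cmp[OF f g eq]
  have "far (Bsym R A) f \<in> mod_hom R (?T (src f)) (?T (src g))"
    using Bsym_hom[OF f] eq by simp
  from mod_hom_comp[OF this Bsym_hom[OF g]] 
  have h: "(\<lambda>v. far (Bsym R A) g (far (Bsym R A) f v)) \<in> mod_hom R (?T (src f)) (?T (tgt g))" .
  have k: "far (Bsym R A) (Cmp DeltaS g f) \<in> mod_hom R (?T (src f)) (?T (tgt g))"
    using Bsym_hom[OF gf] by simp
  show "far (Bsym R A) (Cmp DeltaS g f) v = far (Bsym R A) g (far (Bsym R A) f v)"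
  proof (rule tens_hom_eq[OF tens_module k h])
    fix as assume as: "as \<in> tens_gens A (src f + 1)"
    then have "as \<in> tens_gens A (src (Cmp DeltaS g f) + 1)" "act f as \<in> tens_gens A (src g + 1)"
      using act_closed[OF f] eq by auto
    then show "far (Bsym R A) (Cmp DeltaS g f) (pure R A as) = far (Bsym R A) g (far (Bsym R A) f (pure R A as))"
      by (simp only: Bsym_pure[OF gf] Bsym_pure[OF f as] Bsym_pure[OF g] act_Cmp[OF f g eq as])
  qed (use v in \<open>simp add: Bsym_fob\<close>)
qed (auto simp: Bsym_fob intro: tens_module Bsym_hom[simplified])

end

section \<open>Free functors and projective lifting\<close>


lemma co_functorD:
  assumes "co_functor R C F"
  shows "x \<in> Ob C \<Longrightarrow> module R (fob F x)"
    and "f \<in> Ar C \<Longrightarrow> far F f \<in> mod_hom R (fob F (Dom C f)) (fob F (Cod C f))"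
    and "x \<in> Ob C \<Longrightarrow> v \<in> carrier (fob F x) \<Longrightarrow> far F (Idn C x) v = v"
    and "f \<in> Ar C \<Longrightarrow> g \<in> Ar C \<Longrightarrow> Cod C f = Dom C g \<Longrightarrow> v \<in> carrier (fob F (Dom C f)) \<Longrightarrow>
      far F (Cmp C g f) v = far F g (far F f v)"
  using assms unfolding co_functor_def by auto

lemma contra_functorD:
  assumes "contra_functor R C F"
  shows "x \<in> Ob C \<Longrightarrow> module R (fob F x)"
    and "f \<in> Ar C \<Longrightarrow> far F f \<in> mod_hom R (fob F (Cod C f)) (fob F (Dom C f))"
    and "x \<in> Ob C \<Longrightarrow> v \<in> carrier (fob F x) \<Longrightarrow> far F (Idn C x) v = v"
    and "f \<in> Ar C \<Longrightarrow> g \<in> Ar C \<Longrightarrow> Cod C f = Dom C g \<Longrightarrow> v \<in> carrier (fob F (Cod C g)) \<Longrightarrow>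
      far F (Cmp C g f) v = far F f (far F g v)"
  using assms unfolding contra_functor_def by auto

lemma contra_natD:
  assumes "contra_nat R C F G \<eta>"
  shows "x \<in> Ob C \<Longrightarrow> \<eta> x \<in> mod_hom R (fob F x) (fob G x)"
    and "f \<in> Ar C \<Longrightarrow> v \<in> carrier (fob F (Cod C f)) \<Longrightarrow> \<eta> (Dom C f) (far F f v) = far G f (\<eta> (Cod C f) v)"
  using assms unfolding contra_nat_def by auto

locale cat_over = base_ring R + small_cat C for R :: "'k ring" (structure) and C :: "('o, 'm) cat"
begin

lemma contra_nat_comp:
  assumes "contra_nat R C F G \<eta>" "contra_nat R C G H \<theta>"
  shows "contra_nat R C F H (\<lambda>x v. \<theta> x (\<eta> x v))"
  unfolding contra_nat_def
proof (intro conjI ballI)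
  fix x assume x: "x \<in> Ob C"
  show "(\<lambda>v. \<theta> x (\<eta> x v)) \<in> mod_hom R (fob F x) (fob H x)"
    by (rule mod_hom_comp[OF contra_natD(1)[OF assms(1) x] contra_natD(1)[OF assms(2) x]])
next
  fix f v assume f: "f \<in> Ar C" and v: "v \<in> carrier (fob F (Cod C f))"
  have "\<eta> (Cod C f) v \<in> carrier (fob G (Cod C f))"
    using mod_hom_closed[OF contra_natD(1)[OF assms(1)] v] f Cod_Ob by blast
  then show "\<theta> (Dom C f) (\<eta> (Dom C f) (far F f v)) = far H f (\<theta> (Cod C f) (\<eta> (Cod C f) v))"
    using contra_natD(2)[OF assms(1) f v] contra_natD(2)[OF assms(2) f] by simp
qed

lemma contra_nat_id: "contra_nat R C F F (\<lambda>x v. v)"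
  unfolding contra_nat_def by (auto intro: mod_hom_ident)

lemma contra_nat_diff:
  assumes G: "contra_functor R C G" and \<eta>: "contra_nat R C F G \<eta>" and \<theta>: "contra_nat R C F G \<theta>"
  shows "contra_nat R C F G (\<lambda>x v. \<eta> x v \<ominus>\<^bsub>fob G x\<^esub> \<theta> x v)"
  unfolding contra_nat_def
proof (intro conjI ballI)
  fix x assume "x \<in> Ob C"
  then show "(\<lambda>v. \<eta> x v \<ominus>\<^bsub>fob G x\<^esub> \<theta> x v) \<in> mod_hom R (fob F x) (fob G x)"
    using assms by (intro mod_hom_diff) (auto intro: contra_natD contra_functorD)
next
  fix f v assume f: "f \<in> Ar C" and v: "v \<in> carrier (fob F (Cod C f))"
  have "\<eta> (Cod C f) v \<in> carrier (fob G (Cod C f))" "\<theta> (Cod C f) v \<in> carrier (fob G (Cod C f))"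
    using mod_hom_closed[OF contra_natD(1)[OF \<eta>] v] mod_hom_closed[OF contra_natD(1)[OF \<theta>] v] f Cod_Ob
    by blast+
  then show "\<eta> (Dom C f) (far F f v) \<ominus>\<^bsub>fob G (Dom C f)\<^esub> \<theta> (Dom C f) (far F f v)
      = far G f (\<eta> (Cod C f) v \<ominus>\<^bsub>fob G (Cod C f)\<^esub> \<theta> (Cod C f) v)"
    using contra_natD(2)[OF \<eta> f v] contra_natD(2)[OF \<theta> f v]
      mod_hom_minus[OF contra_functorD(1)[OF G] contra_functorD(1)[OF G] contra_functorD(2)[OF G f]]
      Dom_Ob[OF f] Cod_Ob[OF f] by simp
qed

lemma self_module: "module R (self_mod R)"
proof (intro moduleI abelian_groupI)
  fix x assume "x \<in> carrier (self_mod R)"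
  then show "\<exists>y \<in> carrier (self_mod R). y \<oplus>\<^bsub>self_mod R\<^esub> x = \<zero>\<^bsub>self_mod R\<^esub>"
    using l_neg[of x] a_inv_closed[of x] by (auto simp: self_mod_def)
qed (simp_all add: self_mod_def is_cring a_ac m_assoc l_distr r_distr)

lemma const_contra: "contra_functor R C (const_functor R)"
  unfolding contra_functor_def const_functor_def using self_module by (simp add: mod_hom_ident)

text \<open>The free contravariant functor on a family of sets \<open>I\<close>: a copy of the representable functor of
  \<open>y\<close> for every element of \<open>I y\<close>.\<close>

definition free_arrows :: "('o \<Rightarrow> 't set) \<Rightarrow> 'o \<Rightarrow> ('t \<times> 'm) set" where
  "free_arrows I x = {(t, f). f \<in> Ar C \<and> Dom C f = x \<and> t \<in> I (Cod C f)}"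

definition free_fun :: "('o \<Rightarrow> 't set) \<Rightarrow> ('o, 'm, 'k, 't \<times> 'm \<Rightarrow> 'k) catmod" where
  "free_fun I = \<lparr>fob = (\<lambda>x. free_mod R (free_arrows I x)),
     far = (\<lambda>g. lin R (free_mod R (free_arrows I (Dom C g))) (\<lambda>(t, f). basis_vec R (t, Cmp C f g)))\<rparr>"

lemma free_fun_fob: "fob (free_fun I) x = free_mod R (free_arrows I x)"
  by (simp add: free_fun_def)

lemma free_fun_far:
  assumes g: "g \<in> Ar C"
  shows free_fun_far_hom: "far (free_fun I) g \<in> mod_hom R (free_mod R (free_arrows I (Cod C g))) (free_mod R (free_arrows I (Dom C g)))"
    and free_fun_far_basis: "\<And>t f. (t, f) \<in> free_arrows I (Cod C g) \<Longrightarrow>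
      far (free_fun I) g (basis_vec R (t, f)) = basis_vec R (t, Cmp C f g)"
proof -
  have "(\<lambda>(t, f). basis_vec R (t, Cmp C f g)) \<in> free_arrows I (Cod C g) \<rightarrow> carrier (free_mod R (free_arrows I (Dom C g)))"
    using g by (auto simp: free_arrows_def cat_simps intro!: basis_closed)
  from lin_hom[OF free_module this] lin_basis[OF free_module this]
  show "far (free_fun I) g \<in> mod_hom R (free_mod R (free_arrows I (Cod C g))) (free_mod R (free_arrows I (Dom C g)))"
    "\<And>t f. (t, f) \<in> free_arrows I (Cod C g) \<Longrightarrow>
      far (free_fun I) g (basis_vec R (t, f)) = basis_vec R (t, Cmp C f g)"
    by (auto simp: free_fun_def)
qed

lemma free_arrows_Cmp:
  "g \<in> Ar C \<Longrightarrow> (t, f) \<in> free_arrows I (Cod C g) \<Longrightarrow> (t, Cmp C f g) \<in> free_arrows I (Dom C g)"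
  by (auto simp: free_arrows_def cat_simps)

lemma free_fun_contra: "contra_functor R C (free_fun I)"
  unfolding contra_functor_def
proof (intro conjI ballI impI)
  fix x v assume x: "x \<in> Ob C" and v: "v \<in> carrier (fob (free_fun I) x)"
  have h: "far (free_fun I) (Idn C x) \<in> mod_hom R (free_mod R (free_arrows I x)) (free_mod R (free_arrows I x))"
    using free_fun_far_hom[OF Idn_arrow[OF x], of I] x by (simp add: cat_simps)
  show "far (free_fun I) (Idn C x) v = v"
  proof (rule free_hom_eq[OF free_module h mod_hom_ident])
    fix s assume s: "s \<in> free_arrows I x"
    then obtain t f where tf: "s = (t, f)" "f \<in> Ar C" "Dom C f = x" by (auto simp: free_arrows_def)
    then show "far (free_fun I) (Idn C x) (basis_vec R s) = basis_vec R s"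
      using free_fun_far_basis[OF Idn_arrow[OF x], of t f I] s x Cmp_Idn_right[of f] by (simp add: cat_simps)
  qed (use v in \<open>simp add: free_fun_fob\<close>)
next
  fix f g v assume f: "f \<in> Ar C" and g: "g \<in> Ar C" and fg: "Cod C f = Dom C g"
    and v: "v \<in> carrier (fob (free_fun I) (Cod C g))"
  let ?F = "\<lambda>x. free_mod R (free_arrows I x)"
  note gf = Cmp_arrow[OF f g fg]
  have h: "far (free_fun I) (Cmp C g f) \<in> mod_hom R (?F (Cod C g)) (?F (Dom C f))"
    using free_fun_far_hom[OF gf, of I] f g fg by (simp add: cat_simps)
  have k: "(\<lambda>v. far (free_fun I) f (far (free_fun I) g v)) \<in> mod_hom R (?F (Cod C g)) (?F (Dom C f))"
    using mod_hom_comp[OF free_fun_far_hom[OF g, of I] free_fun_far_hom[OF f, of I, unfolded fg]] .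
  show "far (free_fun I) (Cmp C g f) v = far (free_fun I) f (far (free_fun I) g v)"
  proof (rule free_hom_eq[OF free_module h k])
    fix s assume s: "s \<in> free_arrows I (Cod C g)"
    then obtain t h where th: "s = (t, h)" "h \<in> Ar C" "Dom C h = Cod C g" by (auto simp: free_arrows_def)
    have s': "(t, Cmp C h g) \<in> free_arrows I (Cod C f)" "(t, h) \<in> free_arrows I (Cod C (Cmp C g f))"
      using free_arrows_Cmp[OF g] s th fg by (auto simp: Cod_Cmp f g)
    show "far (free_fun I) (Cmp C g f) (basis_vec R s) = far (free_fun I) f (far (free_fun I) g (basis_vec R s))"
      using free_fun_far_basis[OF g, of t h I] free_fun_far_basis[OF f s'(1)] free_fun_far_basis[OF gf s'(2)]
        s th Cmp_assoc[OF f g th(2) fg] by simp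
  qed (use v in \<open>simp add: free_fun_fob\<close>)
next
  fix f assume f: "f \<in> Ar C"
  show "far (free_fun I) f \<in> mod_hom R (fob (free_fun I) (Cod C f)) (fob (free_fun I) (Dom C f))"
    using free_fun_far_hom[OF f, of I] by (simp add: free_fun_fob)
qed (simp add: free_fun_fob free_module)

definition free_ext :: "('o, 'm, 'k, 'g) catmod \<Rightarrow> ('o \<Rightarrow> 't \<Rightarrow> 'g) \<Rightarrow> 'o \<Rightarrow> ('t \<times> 'm \<Rightarrow> 'k) \<Rightarrow> 'g" where
  "free_ext G \<tau> x = lin R (fob G x) (\<lambda>(t, f). far G f (\<tau> (Cod C f) t))"

context
  fixes G :: "('o, 'm, 'k, 'g) catmod" and I :: "'o \<Rightarrow> 't set" and \<tau>
  assumes G: "contra_functor R C G" and \<tau>: "\<And>y t. y \<in> Ob C \<Longrightarrow> t \<in> I y \<Longrightarrow> \<tau> y t \<in> carrier (fob G y)"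
begin

lemma free_ext_values: "(\<lambda>(t, f). far G f (\<tau> (Cod C f) t)) \<in> free_arrows I x \<rightarrow> carrier (fob G x)"
  using mod_hom_closed[OF contra_functorD(2)[OF G]] \<tau> Cod_Ob by (fastforce simp: free_arrows_def)

lemma free_ext_hom: "x \<in> Ob C \<Longrightarrow> free_ext G \<tau> x \<in> mod_hom R (fob (free_fun I) x) (fob G x)"
  unfolding free_ext_def free_fun_fob by (intro lin_hom free_ext_values contra_functorD(1)[OF G])

lemma free_ext_basis:
  "x \<in> Ob C \<Longrightarrow> (t, f) \<in> free_arrows I x \<Longrightarrow> free_ext G \<tau> x (basis_vec R (t, f)) = far G f (\<tau> (Cod C f) t)"
  unfolding free_ext_def using lin_basis[OF contra_functorD(1)[OF G] free_ext_values] by auto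

lemma free_ext_nat: "contra_nat R C (free_fun I) G (free_ext G \<tau>)"
  unfolding contra_nat_def
proof (intro conjI ballI)
  fix g v assume g: "g \<in> Ar C" and v: "v \<in> carrier (fob (free_fun I) (Cod C g))"
  note ob = Dom_Ob[OF g] Cod_Ob[OF g]
  have h: "(\<lambda>v. free_ext G \<tau> (Dom C g) (far (free_fun I) g v)) \<in> mod_hom R (free_mod R (free_arrows I (Cod C g))) (fob G (Dom C g))"
    using mod_hom_comp[OF free_fun_far_hom[OF g] free_ext_hom[OF ob(1), unfolded free_fun_fob]] .
  have k: "(\<lambda>v. far G g (free_ext G \<tau> (Cod C g) v)) \<in> mod_hom R (free_mod R (free_arrows I (Cod C g))) (fob G (Dom C g))"
    using mod_hom_comp[OF free_ext_hom[OF ob(2), unfolded free_fun_fob] contra_functorD(2)[OF G g]] .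
  show "free_ext G \<tau> (Dom C g) (far (free_fun I) g v) = far G g (free_ext G \<tau> (Cod C g) v)"
  proof (rule free_hom_eq[OF contra_functorD(1)[OF G ob(1)] h k])
    fix s assume s: "s \<in> free_arrows I (Cod C g)"
    then obtain t f where tf: "s = (t, f)" "f \<in> Ar C" "Dom C f = Cod C g" "t \<in> I (Cod C f)" by (auto simp: free_arrows_def)
    have tf': "(t, f) \<in> free_arrows I (Cod C g)" using s tf(1) by simp
    have c: "\<tau> (Cod C f) t \<in> carrier (fob G (Cod C f))" using \<tau> tf Cod_Ob by blast
    have "free_ext G \<tau> (Dom C g) (far (free_fun I) g (basis_vec R s)) = far G (Cmp C f g) (\<tau> (Cod C f) t)"
      unfolding tf(1) free_fun_far_basis[OF g tf'] free_ext_basis[OF ob(1) free_arrows_Cmp[OF g tf']]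
        Cod_Cmp[OF g tf(2) tf(3)[symmetric]] ..
    also have "\<dots> = far G g (free_ext G \<tau> (Cod C g) (basis_vec R s))"
      unfolding tf(1) free_ext_basis[OF ob(2) tf'] by (rule contra_functorD(4)[OF G g tf(2) tf(3)[symmetric] c])
    finally show "free_ext G \<tau> (Dom C g) (far (free_fun I) g (basis_vec R s)) = far G g (free_ext G \<tau> (Cod C g) (basis_vec R s))" .
  qed (use v in \<open>simp add: free_fun_fob\<close>)
qed (rule free_ext_hom)

end

text \<open>A section of the free cover \<open>free_fun (\<lambda>y. carrier (fob P y)) \<rightarrow> P\<close> reduces the lifting problem to
  the free functor, where it is solved on generators. No restriction on the types of \<open>G\<close> and \<open>G'\<close> is needed.\<close>

lemma projective_lift:
  fixes P :: "('o, 'm, 'k, 'p) catmod"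
  assumes P: "projective R C P" and G: "contra_functor R C G" and G': "contra_functor R C G'"
    and \<eta>: "contra_nat R C G G' \<eta>" and \<phi>: "contra_nat R C P G' \<phi>"
    and surj: "\<And>x p. x \<in> Ob C \<Longrightarrow> p \<in> carrier (fob P x) \<Longrightarrow> \<phi> x p \<in> \<eta> x ` carrier (fob G x)"
  obtains \<psi> where "contra_nat R C P G \<psi>"
    "\<And>x p. x \<in> Ob C \<Longrightarrow> p \<in> carrier (fob P x) \<Longrightarrow> \<eta> x (\<psi> x p) = \<phi> x p"
proof -
  let ?I = "\<lambda>y. carrier (fob P y)"
  let ?X = "free_fun ?I"
  have Pc: "contra_functor R C P" using P unfolding projective_def by blast
  define \<pi> where "\<pi> = free_ext P (\<lambda>y p. p)"
  have \<pi>: "contra_nat R C ?X P \<pi>" unfolding \<pi>_def by (rule free_ext_nat[OF Pc])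
  have \<pi>_basis: "\<pi> x (basis_vec R (p, f)) = far P f p" if "x \<in> Ob C" "(p, f) \<in> free_arrows ?I x" for x p f
    using free_ext_basis[OF Pc, of ?I "\<lambda>y p. p"] that unfolding \<pi>_def by simp
  have onto: "\<pi> x ` carrier (fob ?X x) = carrier (fob P x)" if x: "x \<in> Ob C" for x
  proof (intro equalityI subsetI)
    fix p assume "p \<in> \<pi> x ` carrier (fob ?X x)"
    then show "p \<in> carrier (fob P x)" using mod_hom_closed[OF contra_natD(1)[OF \<pi> x]] by auto
  next
    fix p assume p: "p \<in> carrier (fob P x)"
    then have fa: "(p, Idn C x) \<in> free_arrows ?I x" using x by (simp add: free_arrows_def cat_simps)
    have "\<pi> x (basis_vec R (p, Idn C x)) = p"
      using \<pi>_basis[OF x fa] contra_functorD(3)[OF Pc x p] by simp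
    then show "p \<in> \<pi> x ` carrier (fob ?X x)" using basis_closed[OF fa] unfolding free_fun_fob by force
  qed
  \<comment> \<open>This instance fits the two types fixed in the definition of
    \<open>projective\<close>: the free cover plays the part of X, and \<open>P\<close> with its
    identity map that of Y.\<close>
  have "\<exists>\<sigma>. contra_nat R C P ?X \<sigma> \<and> (\<forall>x \<in> Ob C. \<forall>p \<in> carrier (fob P x). \<pi> x (\<sigma> x p) = p)"
    using free_fun_contra Pc \<pi> onto contra_nat_id
    by (intro P[unfolded projective_def, THEN conjunct2, rule_format, of ?X P \<pi> "\<lambda>x v. v"]) blast
  then obtain \<sigma> where \<sigma>: "contra_nat R C P ?X \<sigma>" "\<And>x p. x \<in> Ob C \<Longrightarrow> p \<in> carrier (fob P x) \<Longrightarrow> \<pi> x (\<sigma> x p) = p"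
    by blast
  \<comment> \<open>The preimages may be chosen arbitrarily for each \<open>p\<close>: the cover is
    free on the elements of \<open>P\<close> as sets, so neither linearity nor naturality of \<tau>
    is demanded.\<close>
  define \<tau> where "\<tau> y p = (SOME g. g \<in> carrier (fob G y) \<and> \<eta> y g = \<phi> y p)" for y p
  have \<tau>: "\<tau> y p \<in> carrier (fob G y) \<and> \<eta> y (\<tau> y p) = \<phi> y p" if yp: "y \<in> Ob C" "p \<in> carrier (fob P y)" for y p
  proof -
    obtain g where "g \<in> carrier (fob G y) \<and> \<eta> y g = \<phi> y p" using surj[OF yp] by (metis imageE)
    then show ?thesis unfolding \<tau>_def by (rule someI)
  qed
  have \<tau>1: "\<And>y t. y \<in> Ob C \<Longrightarrow> t \<in> carrier (fob P y) \<Longrightarrow> \<tau> y t \<in> carrier (fob G y)" using \<tau> by blast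
  have ext: "contra_nat R C ?X G (free_ext G \<tau>)"
    by (rule free_ext_nat[OF G]) (rule \<tau>1)
  have ext_basis: "free_ext G \<tau> x (basis_vec R (p, f)) = far G f (\<tau> (Cod C f) p)"
    if "x \<in> Ob C" "(p, f) \<in> free_arrows ?I x" for x p f
    using that by (intro free_ext_basis[OF G, of ?I \<tau>] \<tau>1)
  have eq: "\<eta> x (free_ext G \<tau> x w) = \<phi> x (\<pi> x w)" if x: "x \<in> Ob C" and w: "w \<in> carrier (fob ?X x)" for x w
  proof -
    have h: "(\<lambda>w. \<eta> x (free_ext G \<tau> x w)) \<in> mod_hom R (free_mod R (free_arrows ?I x)) (fob G' x)"
      using mod_hom_comp[OF contra_natD(1)[OF ext x] contra_natD(1)[OF \<eta> x]] by (simp add: free_fun_fob)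
    have k: "(\<lambda>w. \<phi> x (\<pi> x w)) \<in> mod_hom R (free_mod R (free_arrows ?I x)) (fob G' x)"
      using mod_hom_comp[OF contra_natD(1)[OF \<pi> x] contra_natD(1)[OF \<phi> x]] by (simp add: free_fun_fob)
    have "\<eta> x (free_ext G \<tau> x (basis_vec R s)) = \<phi> x (\<pi> x (basis_vec R s))"
      if s: "s \<in> free_arrows ?I x" for s
    proof -
      from s obtain p f where pf: "s = (p, f)" "f \<in> Ar C" "Dom C f = x" "p \<in> carrier (fob P (Cod C f))" by (auto simp: free_arrows_def)
      show ?thesis
      using ext_basis[OF x, of p f] \<pi>_basis[OF x, of p f] s pf \<tau>[OF Cod_Ob[OF pf(2)] pf(4)]
        contra_natD(2)[OF \<eta> pf(2)] contra_natD(2)[OF \<phi> pf(2)] by auto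
    qed
    with free_hom_eq[OF contra_functorD(1)[OF G' x] h k] w show ?thesis by (simp add: free_fun_fob)
  qed
  show thesis
  proof
    show "contra_nat R C P G (\<lambda>x p. free_ext G \<tau> x (\<sigma> x p))"
      by (rule contra_nat_comp[OF \<sigma>(1) ext])
    fix x p assume x: "x \<in> Ob C" and p: "p \<in> carrier (fob P x)"
    show "\<eta> x (free_ext G \<tau> x (\<sigma> x p)) = \<phi> x p"
      using eq[OF x mod_hom_closed[OF contra_natD(1)[OF \<sigma>(1) x] p]] \<sigma>(2)[OF x p] by simp
  qed
qed

end

section \<open>The tensor product of functors\<close>


text \<open>These are the bilinear families compatible with arrows, that is, the data of a linear
  map out of the tensor product of functors.\<close>

definition balanced ::
  "'k ring \<Rightarrow> ('o, 'm) cat \<Rightarrow> ('o, 'm, 'k, 'p) catmod \<Rightarrow> ('o, 'm, 'k, 'v) catmod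
    \<Rightarrow> ('k, 'n) module \<Rightarrow> ('o \<Rightarrow> 'p \<Rightarrow> 'v \<Rightarrow> 'n) \<Rightarrow> bool" where
  "balanced R C P M N \<phi> \<longleftrightarrow>
     (\<forall>x \<in> Ob C. \<forall>m \<in> carrier (fob M x). (\<lambda>p. \<phi> x p m) \<in> mod_hom R (fob P x) N) \<and>
     (\<forall>x \<in> Ob C. \<forall>p \<in> carrier (fob P x). \<phi> x p \<in> mod_hom R (fob M x) N) \<and>
     (\<forall>f \<in> Ar C. \<forall>p \<in> carrier (fob P (Cod C f)). \<forall>m \<in> carrier (fob M (Dom C f)).
        \<phi> (Dom C f) (far P f p) m = \<phi> (Cod C f) p (far M f m))"

lemma balancedD:
  assumes "balanced R C P M N \<phi>"
  shows "x \<in> Ob C \<Longrightarrow> m \<in> carrier (fob M x) \<Longrightarrow> (\<lambda>p. \<phi> x p m) \<in> mod_hom R (fob P x) N"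
    and "x \<in> Ob C \<Longrightarrow> p \<in> carrier (fob P x) \<Longrightarrow> \<phi> x p \<in> mod_hom R (fob M x) N"
    and "f \<in> Ar C \<Longrightarrow> p \<in> carrier (fob P (Cod C f)) \<Longrightarrow> m \<in> carrier (fob M (Dom C f)) \<Longrightarrow>
      \<phi> (Dom C f) (far P f p) m = \<phi> (Cod C f) p (far M f m)"
  using assms unfolding balanced_def by auto

definition elt ::
  "'k ring \<Rightarrow> ('o, 'm) cat \<Rightarrow> ('o, 'm, 'k, 'p) catmod \<Rightarrow> ('o, 'm, 'k, 'v) catmod
    \<Rightarrow> 'o \<Rightarrow> 'p \<Rightarrow> 'v \<Rightarrow> ('o \<times> 'p \<times> 'v \<Rightarrow> 'k) set" where
  "elt R C P M x p m = pres_gen R (ftens_gens C P M) (ftens_rels R C P M) (x, p, m)"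

lemma ball_Collect4: "(\<forall>q \<in> {F a b c e | a b c e. B a b c e}. L q) \<longleftrightarrow> (\<forall>a b c e. B a b c e \<longrightarrow> L (F a b c e))"
  and ball_Collect3: "(\<forall>q \<in> {F' a b c | a b c. B' a b c}. L q) \<longleftrightarrow> (\<forall>a b c. B' a b c \<longrightarrow> L (F' a b c))"
  by blast+

locale ftensor = cat_over R C for R :: "'k ring" (structure) and C :: "('o, 'm) cat" +
  fixes P :: "('o, 'm, 'k, 'p) catmod" and M :: "('o, 'm, 'k, 'v) catmod"
  assumes P: "contra_functor R C P" and M: "co_functor R C M"
begin

abbreviation gens where "gens \<equiv> ftens_gens C P M"

lemma gens_iff: "(x, p, m) \<in> gens \<longleftrightarrow> x \<in> Ob C \<and> p \<in> carrier (fob P x) \<and> m \<in> carrier (fob M x)"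
  by (simp add: ftens_gens_def)

lemma P_add: "(x, p, m) \<in> gens \<Longrightarrow> (x, q, m) \<in> gens \<Longrightarrow> (x, p \<oplus>\<^bsub>fob P x\<^esub> q, m) \<in> gens"
proof -
  assume a: "(x, p, m) \<in> gens" "(x, q, m) \<in> gens"
  then interpret X: module R "fob P x" using contra_functorD(1)[OF P] by (simp add: gens_iff)
  show ?thesis using a by (simp add: gens_iff)
qed

lemma M_add: "(x, p, m) \<in> gens \<Longrightarrow> (x, p, n) \<in> gens \<Longrightarrow> (x, p, m \<oplus>\<^bsub>fob M x\<^esub> n) \<in> gens"
proof -
  assume a: "(x, p, m) \<in> gens" "(x, p, n) \<in> gens"
  then interpret X: module R "fob M x" using co_functorD(1)[OF M] by (simp add: gens_iff)
  show ?thesis using a by (simp add: gens_iff)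
qed

lemma P_smult: "(x, p, m) \<in> gens \<Longrightarrow> r \<in> carrier R \<Longrightarrow> (x, r \<odot>\<^bsub>fob P x\<^esub> p, m) \<in> gens"
proof -
  assume a: "(x, p, m) \<in> gens" "r \<in> carrier R"
  then interpret X: module R "fob P x" using contra_functorD(1)[OF P] by (simp add: gens_iff)
  show ?thesis using a by (simp add: gens_iff)
qed

lemma M_smult: "(x, p, m) \<in> gens \<Longrightarrow> r \<in> carrier R \<Longrightarrow> (x, p, r \<odot>\<^bsub>fob M x\<^esub> m) \<in> gens"
proof -
  assume a: "(x, p, m) \<in> gens" "r \<in> carrier R"
  then interpret X: module R "fob M x" using co_functorD(1)[OF M] by (simp add: gens_iff)
  show ?thesis using a by (simp add: gens_iff)
qed

lemma Dom_gen: "f \<in> Ar C \<Longrightarrow> p \<in> carrier (fob P (Cod C f)) \<Longrightarrow> m \<in> carrier (fob M (Dom C f)) \<Longrightarrow>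
    (Dom C f, far P f p, m) \<in> gens"
  using mod_hom_closed[OF contra_functorD(2)[OF P]] Dom_Ob by (simp add: gens_iff)

lemma Cod_gen: "f \<in> Ar C \<Longrightarrow> p \<in> carrier (fob P (Cod C f)) \<Longrightarrow> m \<in> carrier (fob M (Dom C f)) \<Longrightarrow>
    (Cod C f, p, far M f m) \<in> gens"
  using mod_hom_closed[OF co_functorD(2)[OF M]] Cod_Ob by (simp add: gens_iff)

lemmas gen_intros = P_add M_add P_smult M_smult Dom_gen Cod_gen

lemma ftens_rels_closed: "ftens_rels R C P M \<subseteq> carrier (free_mod R gens)"
proof -
  interpret F: module R "free_mod R gens" by (rule free_module)
  show ?thesis
    unfolding ftens_rels_def Let_def
    by (intro subsetI, elim UnE CollectE exE conjE; hypsubst;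
      intro F.minus_closed F.a_closed F.smult_closed basis_closed gen_intros; assumption)
qed

sublocale pres: presentation R gens "ftens_rels R C P M"
  by (intro presentation.intro base_ring_axioms presentation_axioms.intro ftens_rels_closed)

text \<open>The five kinds of relations match the clauses of \<open>balanced\<close> one by one.
  Read from right to left this gives the maps out of \<open>ftens\<close>; read from left to right
  it shows that the generators themselves form a balanced family.\<close>

lemma rels_iff:
  assumes N: "module R N" and \<phi>: "\<phi> \<in> gens \<rightarrow> carrier N"
  shows "(\<forall>q \<in> ftens_rels R C P M. lin R N \<phi> q = \<zero>\<^bsub>N\<^esub>) \<longleftrightarrow> balanced R C P M N (\<lambda>x p m. \<phi> (x, p, m))"
proof -
  interpret N: module R N by fact
  note hom = lin_hom[OF N \<phi>]
  let ?F = "free_mod R gens" and ?e = "basis_vec R"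
  have \<phi>': "\<phi> s \<in> carrier N" if "s \<in> gens" for s using \<phi> that by auto
  have minus: "lin R N \<phi> (?e s \<ominus>\<^bsub>?F\<^esub> ?e t) = \<zero>\<^bsub>N\<^esub> \<longleftrightarrow> \<phi> s = \<phi> t" if "s \<in> gens" "t \<in> gens" for s t
    using that mod_hom_minus[OF pres.F.module_axioms N hom, of "?e s" "?e t"]
    by (simp add: basis_closed lin_basis[OF N \<phi>] N.minus_eq_zero_iff \<phi>')
  have add: "lin R N \<phi> (?e s \<ominus>\<^bsub>?F\<^esub> (?e t \<oplus>\<^bsub>?F\<^esub> ?e u)) = \<zero>\<^bsub>N\<^esub> \<longleftrightarrow> \<phi> s = \<phi> t \<oplus>\<^bsub>N\<^esub> \<phi> u"
    if "s \<in> gens" "t \<in> gens" "u \<in> gens" for s t u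
    using that mod_hom_minus[OF pres.F.module_axioms N hom, of "?e s" "?e t \<oplus>\<^bsub>?F\<^esub> ?e u"] mod_hom_add[OF hom, of "?e t" "?e u"]
    by (simp add: basis_closed lin_basis[OF N \<phi>] N.minus_eq_zero_iff \<phi>')
  have smult: "lin R N \<phi> (?e s \<ominus>\<^bsub>?F\<^esub> (r \<odot>\<^bsub>?F\<^esub> ?e t)) = \<zero>\<^bsub>N\<^esub> \<longleftrightarrow> \<phi> s = r \<odot>\<^bsub>N\<^esub> \<phi> t"
    if "s \<in> gens" "t \<in> gens" "r \<in> carrier R" for s t r
    using that mod_hom_minus[OF pres.F.module_axioms N hom, of "?e s" "r \<odot>\<^bsub>?F\<^esub> ?e t"] mod_hom_smult[OF hom, of r "?e t"]
    by (simp add: basis_closed lin_basis[OF N \<phi>] N.minus_eq_zero_iff \<phi>')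
  have "(\<forall>q \<in> ftens_rels R C P M. lin R N \<phi> q = \<zero>\<^bsub>N\<^esub>) \<longleftrightarrow>
     (\<forall>x p q m. (x, p, m) \<in> gens \<and> (x, q, m) \<in> gens \<longrightarrow> \<phi> (x, p \<oplus>\<^bsub>fob P x\<^esub> q, m) = \<phi> (x, p, m) \<oplus>\<^bsub>N\<^esub> \<phi> (x, q, m)) \<and>
     (\<forall>x p m n. (x, p, m) \<in> gens \<and> (x, p, n) \<in> gens \<longrightarrow> \<phi> (x, p, m \<oplus>\<^bsub>fob M x\<^esub> n) = \<phi> (x, p, m) \<oplus>\<^bsub>N\<^esub> \<phi> (x, p, n)) \<and>
     (\<forall>x p m r. (x, p, m) \<in> gens \<and> r \<in> carrier R \<longrightarrow> \<phi> (x, r \<odot>\<^bsub>fob P x\<^esub> p, m) = r \<odot>\<^bsub>N\<^esub> \<phi> (x, p, m)) \<and>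
     (\<forall>x p m r. (x, p, m) \<in> gens \<and> r \<in> carrier R \<longrightarrow> \<phi> (x, p, r \<odot>\<^bsub>fob M x\<^esub> m) = r \<odot>\<^bsub>N\<^esub> \<phi> (x, p, m)) \<and>
     (\<forall>f p m. f \<in> Ar C \<and> p \<in> carrier (fob P (Cod C f)) \<and> m \<in> carrier (fob M (Dom C f)) \<longrightarrow>
        \<phi> (Dom C f, far P f p, m) = \<phi> (Cod C f, p, far M f m))"
    (is "_ \<longleftrightarrow> ?A1 \<and> ?A2 \<and> ?A3 \<and> ?A4 \<and> ?A5")
    unfolding ftens_rels_def Let_def ball_Un conj_assoc
      ball_Collect4 ball_Collect3
    by (intro arg_cong2[where f = conj] iff_allI imp_cong refl; elim conjE;
      rule add minus smult; (assumption | rule gen_intros)+)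
  also have "\<dots> \<longleftrightarrow> balanced R C P M N (\<lambda>x p m. \<phi> (x, p, m))"
    unfolding balanced_def mod_hom_def gens_iff using \<phi>' by (auto simp: gens_iff)
  finally show ?thesis .
qed

lemma ftens_module: "module R (ftens R C P M)"
  unfolding ftens_def by (rule pres.pres_module)

lemma elt_closed:
  "x \<in> Ob C \<Longrightarrow> p \<in> carrier (fob P x) \<Longrightarrow> m \<in> carrier (fob M x) \<Longrightarrow> elt R C P M x p m \<in> carrier (ftens R C P M)"
  unfolding elt_def ftens_def by (intro pres.pres_gen_closed) (simp add: gens_iff)

lemma elt_balanced: "balanced R C P M (ftens R C P M) (elt R C P M)"
proof -
  have "pres_gen R gens (ftens_rels R C P M) \<in> gens \<rightarrow> carrier (ftens R C P M)"
    unfolding ftens_def by (intro funcsetI pres.pres_gen_closed)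
  from rels_iff[OF ftens_module this] pres.pres_rel show ?thesis
    by (simp add: elt_def[abs_def] ftens_def)
qed

lemma ftens_lift:
  assumes N: "module R N" and \<phi>: "balanced R C P M N \<phi>"
  shows ftens_lift_hom: "pres_lift R gens (ftens_rels R C P M) N (\<lambda>(x, p, m). \<phi> x p m) \<in> mod_hom R (ftens R C P M) N"
    and ftens_lift_elt: "\<And>x p m. x \<in> Ob C \<Longrightarrow> p \<in> carrier (fob P x) \<Longrightarrow> m \<in> carrier (fob M x) \<Longrightarrow>
      pres_lift R gens (ftens_rels R C P M) N (\<lambda>(x, p, m). \<phi> x p m) (elt R C P M x p m) = \<phi> x p m"
proof -
  have \<phi>': "(\<lambda>(x, p, m). \<phi> x p m) \<in> gens \<rightarrow> carrier N"
    using mod_hom_closed[OF balancedD(2)[OF \<phi>]] by (auto simp: gens_iff)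
  have 0: "\<And>q. q \<in> ftens_rels R C P M \<Longrightarrow> lin R N (\<lambda>(x, p, m). \<phi> x p m) q = \<zero>\<^bsub>N\<^esub>"
    using rels_iff[OF N \<phi>'] \<phi> by simp
  show "pres_lift R gens (ftens_rels R C P M) N (\<lambda>(x, p, m). \<phi> x p m) \<in> mod_hom R (ftens R C P M) N"
    using pres.pres_lift_hom[OF N \<phi>' 0] by (simp add: ftens_def)
  show "pres_lift R gens (ftens_rels R C P M) N (\<lambda>(x, p, m). \<phi> x p m) (elt R C P M x p m) = \<phi> x p m"
    if "x \<in> Ob C" "p \<in> carrier (fob P x)" "m \<in> carrier (fob M x)" for x p m
    using pres.pres_lift_gen[OF N \<phi>' 0, of "(x, p, m)"] that by (simp add: elt_def gens_iff)
qed

lemma ftens_submodule_full: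
  assumes "submodule H R (ftens R C P M)"
    and "\<And>x p m. x \<in> Ob C \<Longrightarrow> p \<in> carrier (fob P x) \<Longrightarrow> m \<in> carrier (fob M x) \<Longrightarrow> elt R C P M x p m \<in> H"
    and "w \<in> carrier (ftens R C P M)"
  shows "w \<in> H"
  using assms pres.pres_submodule_full[of H w] by (auto simp: ftens_def elt_def gens_iff)

lemma ftens_hom_eq:
  assumes "module R N" "h \<in> mod_hom R (ftens R C P M) N" "k \<in> mod_hom R (ftens R C P M) N"
    and "\<And>x p m. x \<in> Ob C \<Longrightarrow> p \<in> carrier (fob P x) \<Longrightarrow> m \<in> carrier (fob M x) \<Longrightarrow>
      h (elt R C P M x p m) = k (elt R C P M x p m)"
    and "w \<in> carrier (ftens R C P M)"
  shows "h w = k w"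
  using assms pres.pres_hom_eq[of N h k w] by (auto simp: ftens_def elt_def gens_iff)

end

section \<open>Functoriality, representable functors and the co-Yoneda lemma\<close>

context cat_over
begin

lemma ftens_map:
  assumes P: "contra_functor R C P" and P': "contra_functor R C P'" and M: "co_functor R C M"
    and \<eta>: "contra_nat R C P P' \<eta>"
  shows ftens_map_hom: "ftens_map R C M P P' \<eta> \<in> mod_hom R (ftens R C P M) (ftens R C P' M)"
    and ftens_map_elt: "\<And>x p m. x \<in> Ob C \<Longrightarrow> p \<in> carrier (fob P x) \<Longrightarrow> m \<in> carrier (fob M x) \<Longrightarrow>
      ftens_map R C M P P' \<eta> (elt R C P M x p m) = elt R C P' M x (\<eta> x p) m"
proof -
  interpret T: ftensor R C P M by (intro ftensor.intro cat_over_axioms ftensor_axioms.intro P M)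
  interpret T': ftensor R C P' M by (intro ftensor.intro cat_over_axioms ftensor_axioms.intro P' M)
  note b = balancedD[OF T'.elt_balanced]
  have "balanced R C P M (ftens R C P' M) (\<lambda>x p m. elt R C P' M x (\<eta> x p) m)"
    unfolding balanced_def
  proof (intro conjI ballI)
    fix x m assume "x \<in> Ob C" "m \<in> carrier (fob M x)"
    then show "(\<lambda>p. elt R C P' M x (\<eta> x p) m) \<in> mod_hom R (fob P x) (ftens R C P' M)"
      using mod_hom_comp[OF contra_natD(1)[OF \<eta>, of x] b(1)[of x m]] by simp
  next
    fix x p assume "x \<in> Ob C" "p \<in> carrier (fob P x)"
    then show "elt R C P' M x (\<eta> x p) \<in> mod_hom R (fob M x) (ftens R C P' M)"
      using mod_hom_closed[OF contra_natD(1)[OF \<eta>]] by (intro b(2))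
  next
    fix f p m assume f: "f \<in> Ar C" and pm: "p \<in> carrier (fob P (Cod C f))" "m \<in> carrier (fob M (Dom C f))"
    have "\<eta> (Cod C f) p \<in> carrier (fob P' (Cod C f))"
      using mod_hom_closed[OF contra_natD(1)[OF \<eta>]] pm f by (simp add: Cod_Ob)
    then show "elt R C P' M (Dom C f) (\<eta> (Dom C f) (far P f p)) m = elt R C P' M (Cod C f) (\<eta> (Cod C f) p) (far M f m)"
      using b(3)[OF f] contra_natD(2)[OF \<eta> f] pm by simp
  qed
  from T.ftens_lift_hom[OF T'.ftens_module this] T.ftens_lift_elt[OF T'.ftens_module this]
  show "ftens_map R C M P P' \<eta> \<in> mod_hom R (ftens R C P M) (ftens R C P' M)"
    "\<And>x p m. x \<in> Ob C \<Longrightarrow> p \<in> carrier (fob P x) \<Longrightarrow> m \<in> carrier (fob M x) \<Longrightarrow>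
      ftens_map R C M P P' \<eta> (elt R C P M x p m) = elt R C P' M x (\<eta> x p) m"
    unfolding ftens_map_def elt_def by auto
qed

abbreviation rep_index :: "'o \<Rightarrow> 'o \<Rightarrow> unit set" where
  "rep_index c y \<equiv> if y = c then {()} else {}"

text \<open>Representables are free functors on one generator, placed at \<open>c\<close>, so
  functoriality and the extension principle are inherited. An arrow f becomes the basis vector at
  the pair ((), f).\<close>

abbreviation rep :: "'o \<Rightarrow> ('o, 'm, 'k, unit \<times> 'm \<Rightarrow> 'k) catmod" where
  "rep c \<equiv> free_fun (rep_index c)"

abbreviation rep_arr :: "'m \<Rightarrow> unit \<times> 'm \<Rightarrow> 'k" where
  "rep_arr f \<equiv> basis_vec R ((), f)"

text \<open>The Yoneda correspondence: the natural map out of \<open>rep c\<close> determined by the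
  image \<open>g\<close> of the identity of \<open>c\<close>.\<close>

abbreviation rep_ext :: "('o, 'm, 'k, 'g) catmod \<Rightarrow> 'g \<Rightarrow> 'o \<Rightarrow> (unit \<times> 'm \<Rightarrow> 'k) \<Rightarrow> 'g" where
  "rep_ext G g \<equiv> free_ext G (\<lambda>_ _. g)"

lemma rep_arrows: "free_arrows (rep_index c) x = {((), f) |f. f \<in> Ar C \<and> Dom C f = x \<and> Cod C f = c}"
  by (auto simp: free_arrows_def split: if_splits)

lemma rep_arr_closed: "f \<in> Ar C \<Longrightarrow> rep_arr f \<in> carrier (fob (rep (Cod C f)) (Dom C f))"
  unfolding free_fun_fob by (rule basis_closed) (auto simp: rep_arrows)

lemma rep_hom_eq:
  assumes "module R N" "h \<in> mod_hom R (fob (rep c) x) N" "k \<in> mod_hom R (fob (rep c) x) N"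
    and "\<And>f. f \<in> Ar C \<Longrightarrow> Dom C f = x \<Longrightarrow> Cod C f = c \<Longrightarrow> h (rep_arr f) = k (rep_arr f)"
    and "\<phi> \<in> carrier (fob (rep c) x)"
  shows "h \<phi> = k \<phi>"
  using assms unfolding free_fun_fob
  by (elim free_hom_eq[OF assms(1), of h _ k]) (auto simp: rep_arrows)

lemma rep_far_arr:
  assumes "f \<in> Ar C" "g \<in> Ar C" "Cod C f = Dom C g"
  shows "far (rep (Cod C g)) f (rep_arr g) = rep_arr (Cmp C g f)"
  using assms by (intro free_fun_far_basis) (auto simp: rep_arrows)

context
  fixes G :: "('o, 'm, 'k, 'g) catmod" and c g
  assumes G: "contra_functor R C G" and g: "c \<in> Ob C" "g \<in> carrier (fob G c)"
begin

lemma rep_ext_nat: "contra_nat R C (rep c) G (rep_ext G g)"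
  by (rule free_ext_nat[OF G]) (use g in \<open>auto split: if_splits\<close>)

lemma rep_ext_arr: "f \<in> Ar C \<Longrightarrow> Cod C f = c \<Longrightarrow> rep_ext G g (Dom C f) (rep_arr f) = far G f g"
  by (rule free_ext_basis[OF G, of "rep_index c"]) (use g in \<open>auto simp: rep_arrows Dom_Ob split: if_splits\<close>)

lemma rep_ext_Idn: "rep_ext G g c (rep_arr (Idn C c)) = g"
  using rep_ext_arr[OF Idn_arrow[OF g(1)]] g by (simp add: cat_simps contra_functorD(3)[OF G])

end

text \<open>By the co-Yoneda lemma \<open>rep c \<otimes> M \<cong> M c\<close>; this is the isomorphism on pure tensors.\<close>

definition rep_eval :: "('o, 'm, 'k, 'v) catmod \<Rightarrow> 'o \<Rightarrow> (unit \<times> 'm \<Rightarrow> 'k) \<Rightarrow> 'v \<Rightarrow> 'v" where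
  "rep_eval M c \<phi> m = lin R (fob M c) (\<lambda>(_, f). far M f m) \<phi>"

context
  fixes M :: "('o, 'm, 'k, 'v) catmod" and c
  assumes M: "co_functor R C M" and c: "c \<in> Ob C"
begin

lemma rep_eval_values:
  "m \<in> carrier (fob M x) \<Longrightarrow> (\<lambda>(_, f). far M f m) \<in> free_arrows (rep_index c) x \<rightarrow> carrier (fob M c)"
  using mod_hom_closed[OF co_functorD(2)[OF M]] by (auto simp: rep_arrows)

lemma rep_eval_hom:
  "m \<in> carrier (fob M x) \<Longrightarrow> (\<lambda>\<phi>. rep_eval M c \<phi> m) \<in> mod_hom R (fob (rep c) x) (fob M c)"
  unfolding rep_eval_def free_fun_fob by (intro lin_hom rep_eval_values co_functorD(1)[OF M c])

lemma rep_eval_arr: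
  "f \<in> Ar C \<Longrightarrow> Cod C f = c \<Longrightarrow> m \<in> carrier (fob M (Dom C f)) \<Longrightarrow> rep_eval M c (rep_arr f) m = far M f m"
  unfolding rep_eval_def using lin_basis[OF co_functorD(1)[OF M c] rep_eval_values, of m "Dom C f" "((), f)"]
  by (auto simp: rep_arrows)

lemma rep_eval_balanced: "balanced R C (rep c) M (fob M c) (\<lambda>x \<phi> m. rep_eval M c \<phi> m)"
  unfolding balanced_def
proof (intro conjI ballI)
  fix x m assume "m \<in> carrier (fob M x)"
  then show "(\<lambda>\<phi>. rep_eval M c \<phi> m) \<in> mod_hom R (fob (rep c) x) (fob M c)" by (rule rep_eval_hom)
next
  fix x \<phi> assume x: "x \<in> Ob C" and \<phi>: "\<phi> \<in> carrier (fob (rep c) x)"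
  note Mc = co_functorD(1)[OF M c]
  interpret Mx: module R "fob M x" by (rule co_functorD(1)[OF M x])
  let ?S = "free_arrows (rep_index c) x"
  have \<phi>': "\<phi> \<in> carrier (free_mod R ?S)" using \<phi> by (simp add: free_fun_fob)
  note v = rep_eval_values[of _ x]
  show "rep_eval M c \<phi> \<in> mod_hom R (fob M x) (fob M c)"
  proof (rule mod_homI)
    fix m assume m: "m \<in> carrier (fob M x)"
    show "rep_eval M c \<phi> m \<in> carrier (fob M c)" using mod_hom_closed[OF rep_eval_hom[OF m] \<phi>] .
    fix n assume n: "n \<in> carrier (fob M x)"
    have "rep_eval M c \<phi> (m \<oplus>\<^bsub>fob M x\<^esub> n)
        = lin R (fob M c) (\<lambda>s. (\<lambda>(_, f). far M f m) s \<oplus>\<^bsub>fob M c\<^esub> (\<lambda>(_, f). far M f n) s) \<phi>"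
      unfolding rep_eval_def
    proof (rule sym, rule lin_cong[OF \<phi>' _ v Mc])
      fix s assume "s \<in> ?S"
      then obtain f where "s = ((), f)" "f \<in> Ar C" "Dom C f = x" "Cod C f = c" by (auto simp: rep_arrows)
      then show "(\<lambda>(_, f). far M f m) s \<oplus>\<^bsub>fob M c\<^esub> (\<lambda>(_, f). far M f n) s = (\<lambda>(_, f). far M f (m \<oplus>\<^bsub>fob M x\<^esub> n)) s"
        using mod_hom_add[OF co_functorD(2)[OF M, of f]] m n by auto
    qed (use m n in simp)
    also have "\<dots> = rep_eval M c \<phi> m \<oplus>\<^bsub>fob M c\<^esub> rep_eval M c \<phi> n"
      unfolding rep_eval_def by (rule lin_add[OF Mc v[OF m] v[OF n] \<phi>'])
    finally show "rep_eval M c \<phi> (m \<oplus>\<^bsub>fob M x\<^esub> n) = rep_eval M c \<phi> m \<oplus>\<^bsub>fob M c\<^esub> rep_eval M c \<phi> n" .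
  next
    fix r m assume r: "r \<in> carrier R" and m: "m \<in> carrier (fob M x)"
    have "rep_eval M c \<phi> (r \<odot>\<^bsub>fob M x\<^esub> m) = lin R (fob M c) (\<lambda>s. r \<odot>\<^bsub>fob M c\<^esub> (\<lambda>(_, f). far M f m) s) \<phi>"
      unfolding rep_eval_def
    proof (rule sym, rule lin_cong[OF \<phi>' _ v Mc])
      fix s assume "s \<in> ?S"
      then obtain f where "s = ((), f)" "f \<in> Ar C" "Dom C f = x" "Cod C f = c" by (auto simp: rep_arrows)
      then show "r \<odot>\<^bsub>fob M c\<^esub> (\<lambda>(_, f). far M f m) s = (\<lambda>(_, f). far M f (r \<odot>\<^bsub>fob M x\<^esub> m)) s"
        using mod_hom_smult[OF co_functorD(2)[OF M, of f]] m r by auto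
    qed (use m r in simp)
    also have "\<dots> = r \<odot>\<^bsub>fob M c\<^esub> rep_eval M c \<phi> m"
      unfolding rep_eval_def by (rule lin_smult[OF Mc v[OF m] r \<phi>'])
    finally show "rep_eval M c \<phi> (r \<odot>\<^bsub>fob M x\<^esub> m) = r \<odot>\<^bsub>fob M c\<^esub> rep_eval M c \<phi> m" .
  qed
next
  fix g \<phi> m assume g: "g \<in> Ar C" and \<phi>: "\<phi> \<in> carrier (fob (rep c) (Cod C g))" and m: "m \<in> carrier (fob M (Dom C g))"
  have gm: "far M g m \<in> carrier (fob M (Cod C g))" using mod_hom_closed[OF co_functorD(2)[OF M g] m] .
  have h: "(\<lambda>\<phi>. rep_eval M c (far (rep c) g \<phi>) m) \<in> mod_hom R (fob (rep c) (Cod C g)) (fob M c)"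
    by (rule mod_hom_comp[OF contra_functorD(2)[OF free_fun_contra g] rep_eval_hom[OF m]])
  show "rep_eval M c (far (rep c) g \<phi>) m = rep_eval M c \<phi> (far M g m)"
  proof (rule rep_hom_eq[OF co_functorD(1)[OF M c] h rep_eval_hom[OF gm] _ \<phi>])
    fix f assume f: "f \<in> Ar C" "Dom C f = Cod C g" "Cod C f = c"
    then show "rep_eval M c (far (rep c) g (rep_arr f)) m = rep_eval M c (rep_arr f) (far M g m)"
      using rep_far_arr[OF g f(1)] co_functorD(4)[OF M g f(1) _ m] gm m g
        rep_eval_arr[of "Cmp C f g" m] rep_eval_arr[of f "far M g m"] by (simp add: cat_simps)
  qed
qed

text \<open>On a basis arrow f the left side contains G(f)(g), and balancing transfers f to
  \<open>m\<close>. With \<open>elt\<close> for \<beta> this describes the tensored chain maps on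
  M(c); with \<open>rep_eval\<close> it describes maps between representables after
  tensoring.\<close>

lemma balanced_rep_ext:
  assumes G: "contra_functor R C G" and g: "g \<in> carrier (fob G c)" and N: "module R N"
    and b: "balanced R C G M N \<beta>" and x: "x \<in> Ob C"
    and \<phi>: "\<phi> \<in> carrier (fob (rep c) x)" and m: "m \<in> carrier (fob M x)"
  shows "\<beta> x (rep_ext G g x \<phi>) m = \<beta> c g (rep_eval M c \<phi> m)"
proof -
  have h: "(\<lambda>\<phi>. \<beta> x (rep_ext G g x \<phi>) m) \<in> mod_hom R (fob (rep c) x) N"
    by (rule mod_hom_comp[OF contra_natD(1)[OF rep_ext_nat[OF G c g] x] balancedD(1)[OF b x m]])
  have k: "(\<lambda>\<phi>. \<beta> c g (rep_eval M c \<phi> m)) \<in> mod_hom R (fob (rep c) x) N"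
    by (rule mod_hom_comp[OF rep_eval_hom[OF m] balancedD(2)[OF b c g]])
  show ?thesis
  proof (rule rep_hom_eq[OF N h k _ \<phi>])
    fix f assume f: "f \<in> Ar C" "Dom C f = x" "Cod C f = c"
    then show "\<beta> x (rep_ext G g x (rep_arr f)) m = \<beta> c g (rep_eval M c (rep_arr f) m)"
      using rep_ext_arr[OF G c g f(1,3)] rep_eval_arr[OF f(1,3)] balancedD(3)[OF b f(1)] g m by simp
  qed
qed

end

end

section \<open>Comparison with a presentation by representable functors\<close>


text \<open>Comparison of a projective resolution \<open>P\<close> with the partial resolution by \<open>F0 = rep c0\<close> and \<open>F1 = rep c1\<close>:
  chain maps \<open>a0, a1 : F \<rightarrow> P\<close> and \<open>\<beta>0, \<beta>1 : P \<rightarrow> F\<close>, and homotopies \<open>k0 : P 0 \<rightarrow> P 1\<close> and \<open>h0 : F0 \<rightarrow> F1\<close>.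
  In the next degree no natural maps are needed, because only images matter there and exactness
  provides preimages pointwise.\<close>

locale presented_tor = cat_over R C for R :: "'k ring" (structure) and C :: "('o, 'm) cat" +
  fixes P :: "nat \<Rightarrow> ('o, 'm, 'k, 'p) catmod" and d :: "nat \<Rightarrow> 'o \<Rightarrow> 'p \<Rightarrow> 'p"
    and \<epsilon> :: "'o \<Rightarrow> 'p \<Rightarrow> 'k" and M :: "('o, 'm, 'k, 'v) catmod" and c0 c1 :: 'o and u v :: 'm
  assumes res: "projective_resolution R C (const_functor R) P d \<epsilon>"
    and M: "co_functor R C M"
    and u: "u \<in> Ar C" "Dom C u = c1" "Cod C u = c0"
    and v: "v \<in> Ar C" "Dom C v = c1" "Cod C v = c0"
    and connected: "\<And>x. x \<in> Ob C \<Longrightarrow> \<exists>f \<in> Ar C. Dom C f = x \<and> Cod C f = c0"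
    and exact0: "\<And>x \<phi>. x \<in> Ob C \<Longrightarrow> \<phi> \<in> carrier (fob (rep c0) x) \<Longrightarrow>
      rep_ext (const_functor R) \<one> x \<phi> = \<zero> \<Longrightarrow>
      \<phi> \<in> rep_ext (rep c0) (rep_arr u \<ominus>\<^bsub>fob (rep c0) c1\<^esub> rep_arr v) x ` carrier (fob (rep c1) x)"
begin

lemma ob: "c0 \<in> Ob C" "c1 \<in> Ob C"
  using u Dom_Ob Cod_Ob by auto

lemma proj: "projective R C (P n)"
  and d_nat: "contra_nat R C (P (Suc n)) (P n) (d n)"
  and \<epsilon>_nat: "contra_nat R C (P 0) (const_functor R) \<epsilon>"
  using res unfolding projective_resolution_def by auto

lemma P_contra: "contra_functor R C (P n)"
  using proj unfolding projective_def by blast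

lemma \<epsilon>_onto: "x \<in> Ob C \<Longrightarrow> \<epsilon> x ` carrier (fob (P 0) x) = carrier R"
  and exactP0: "x \<in> Ob C \<Longrightarrow> d 0 x ` carrier (fob (P (Suc 0)) x) = {p \<in> carrier (fob (P 0) x). \<epsilon> x p = \<zero>}"
  and exactP: "x \<in> Ob C \<Longrightarrow> d (Suc n) x ` carrier (fob (P (Suc (Suc n))) x)
      = {p \<in> carrier (fob (P (Suc n)) x). d n x p = \<zero>\<^bsub>fob (P n) x\<^esub>}"
  using res unfolding projective_resolution_def by (auto simp: const_functor_def self_mod_def)

lemma P_module: "x \<in> Ob C \<Longrightarrow> module R (fob (P n) x)"
  using contra_functorD(1)[OF P_contra] .

lemma d_closed: "x \<in> Ob C \<Longrightarrow> p \<in> carrier (fob (P (Suc n)) x) \<Longrightarrow> d n x p \<in> carrier (fob (P n) x)"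
  using mod_hom_closed[OF contra_natD(1)[OF d_nat]] .

lemma d_d: "x \<in> Ob C \<Longrightarrow> p \<in> carrier (fob (P (Suc (Suc n))) x) \<Longrightarrow> d n x (d (Suc n) x p) = \<zero>\<^bsub>fob (P n) x\<^esub>"
  using exactP by blast

lemma \<epsilon>d: "x \<in> Ob C \<Longrightarrow> p \<in> carrier (fob (P (Suc 0)) x) \<Longrightarrow> \<epsilon> x (d 0 x p) = \<zero>"
  using exactP0 by blast

abbreviation F0 where "F0 \<equiv> rep c0"
abbreviation F1 where "F1 \<equiv> rep c1"

lemma rep_module: "module R (fob (rep c) x)"
  unfolding free_fun_fob by (rule free_module)

lemma const_simps: "fob (const_functor R) x = self_mod R" "far (const_functor R) f y = y"
  "carrier (self_mod R) = carrier R" "\<zero>\<^bsub>self_mod R\<^esub> = \<zero>"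
  by (auto simp: const_functor_def self_mod_def)

abbreviation aug where "aug \<equiv> rep_ext (const_functor R) \<one>"

lemma aug_nat: "contra_nat R C F0 (const_functor R) aug"
  by (rule rep_ext_nat[OF const_contra ob(1)]) (simp add: const_simps)

lemma aug_arr: "f \<in> Ar C \<Longrightarrow> Cod C f = c0 \<Longrightarrow> aug (Dom C f) (rep_arr f) = \<one>"
  using rep_ext_arr[OF const_contra ob(1), of \<one> f] by (simp add: const_simps)

definition b where "b = rep_arr u \<ominus>\<^bsub>fob F0 c1\<^esub> rep_arr v"

lemma uv_closed: "rep_arr u \<in> carrier (fob F0 c1)" "rep_arr v \<in> carrier (fob F0 c1)"
  using rep_arr_closed[OF u(1)] rep_arr_closed[OF v(1)] u v by auto

lemma b_closed: "b \<in> carrier (fob F0 c1)"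
proof -
  interpret F: module R "fob F0 c1" by (rule rep_module)
  show ?thesis unfolding b_def using uv_closed by simp
qed

abbreviation bd where "bd \<equiv> rep_ext F0 b"

lemma bd_nat: "contra_nat R C F1 F0 bd"
  by (rule rep_ext_nat[OF free_fun_contra ob(2) b_closed])

lemma bd_hom: "x \<in> Ob C \<Longrightarrow> bd x \<in> mod_hom R (fob F1 x) (fob F0 x)"
  using contra_natD(1)[OF bd_nat] .

lemma exact0': "x \<in> Ob C \<Longrightarrow> \<phi> \<in> carrier (fob F0 x) \<Longrightarrow> aug x \<phi> = \<zero> \<Longrightarrow> \<phi> \<in> bd x ` carrier (fob F1 x)"
  using exact0 unfolding b_def .

text \<open>By Yoneda, a map from \<open>F0\<close> to \<open>P 0\<close> over the constant functor
  is the same as an element over 1.\<close>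

lemma p0_ex: "\<exists>p \<in> carrier (fob (P 0) c0). \<epsilon> c0 p = \<one>"
proof -
  have "\<one> \<in> \<epsilon> c0 ` carrier (fob (P 0) c0)" using \<epsilon>_onto[OF ob(1)] by simp
  then show ?thesis by (elim imageE) (rule bexI, erule sym)
qed

definition p0 where "p0 = (SOME p. p \<in> carrier (fob (P 0) c0) \<and> \<epsilon> c0 p = \<one>)"

lemma p0: "p0 \<in> carrier (fob (P 0) c0)" "\<epsilon> c0 p0 = \<one>"
proof -
  have "p0 \<in> carrier (fob (P 0) c0) \<and> \<epsilon> c0 p0 = \<one>"
    unfolding p0_def by (rule someI_ex) (use p0_ex in blast)
  then show "p0 \<in> carrier (fob (P 0) c0)" "\<epsilon> c0 p0 = \<one>" by auto
qed

abbreviation a0 where "a0 \<equiv> rep_ext (P 0) p0"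

lemma a0_nat: "contra_nat R C F0 (P 0) a0"
  by (rule rep_ext_nat[OF P_contra ob(1) p0(1)])

lemma \<epsilon>_a0: 
  assumes x: "x \<in> Ob C" and \<phi>: "\<phi> \<in> carrier (fob F0 x)"
  shows "\<epsilon> x (a0 x \<phi>) = aug x \<phi>"
proof -
  have h: "(\<lambda>\<phi>. \<epsilon> x (a0 x \<phi>)) \<in> mod_hom R (fob F0 x) (self_mod R)"
    using contra_natD(1)[OF contra_nat_comp[OF a0_nat \<epsilon>_nat] x] by (simp add: const_simps)
  have k: "aug x \<in> mod_hom R (fob F0 x) (self_mod R)"
    using contra_natD(1)[OF aug_nat x] by (simp add: const_simps)
  show ?thesis
  proof (rule rep_hom_eq[OF self_module h k _ \<phi>])
    fix f assume f: "f \<in> Ar C" "Dom C f = x" "Cod C f = c0"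
    then show "\<epsilon> x (a0 x (rep_arr f)) = aug x (rep_arr f)"
      using rep_ext_arr[OF P_contra ob(1) p0(1), of f] aug_arr[OF f(1,3)] contra_natD(2)[OF \<epsilon>_nat f(1), of p0] p0
      by (simp add: const_simps)
  qed
qed

lemma aug_bd:
  assumes x: "x \<in> Ob C" and \<phi>: "\<phi> \<in> carrier (fob F1 x)"
  shows "aug x (bd x \<phi>) = \<zero>"
proof -
  have h: "(\<lambda>\<phi>. aug x (bd x \<phi>)) \<in> mod_hom R (fob F1 x) (self_mod R)"
    using contra_natD(1)[OF contra_nat_comp[OF bd_nat aug_nat] x] by (simp add: const_simps)
  have hm: "aug c1 \<in> mod_hom R (fob F0 c1) (self_mod R)"
    using contra_natD(1)[OF aug_nat ob(2)] by (simp add: const_simps)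
  interpret S: module R "self_mod R" by (rule self_module)
  have aug_b: "aug c1 b = \<zero>"
    unfolding b_def mod_hom_minus[OF rep_module self_module hm uv_closed]
    using aug_arr[OF u(1,3)] aug_arr[OF v(1,3)] u v S.minus_self[of \<one>] by (simp add: const_simps)
  have "aug x (bd x \<phi>) = \<zero>\<^bsub>self_mod R\<^esub>"
  proof (rule rep_hom_eq[OF self_module h mod_hom_zero_map[OF self_module] _ \<phi>])
    fix f assume f: "f \<in> Ar C" "Dom C f = x" "Cod C f = c1"
    then show "aug x (bd x (rep_arr f)) = \<zero>\<^bsub>self_mod R\<^esub>"
      using rep_ext_arr[OF free_fun_contra ob(2) b_closed, of f] contra_natD(2)[OF aug_nat f(1), of b] b_closed aug_b
      by (simp add: const_simps)
  qed
  then show ?thesis by (simp add: const_simps)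
qed

text \<open>The element \<open>a0 c1 b\<close> is killed by the augmentation, hence is a boundary in
  \<open>P\<close>. By Yoneda a preimage is the degree 1 part of the chain map from \<open>F\<close>
  to \<open>P\<close>.\<close>

lemma p1_ex: "\<exists>p \<in> carrier (fob (P (Suc 0)) c1). d 0 c1 p = a0 c1 b"
proof -
  have e: "aug c1 b = \<zero>"
    using aug_bd[OF ob(2) rep_arr_closed[OF Idn_arrow[OF ob(2)], unfolded Dom_Idn[OF ob(2)] Cod_Idn[OF ob(2)]]]
      rep_ext_Idn[OF free_fun_contra ob(2) b_closed] by simp
  have "a0 c1 b \<in> d 0 c1 ` carrier (fob (P (Suc 0)) c1)"
    unfolding exactP0[OF ob(2)]
    using \<epsilon>_a0[OF ob(2) b_closed] e mod_hom_closed[OF contra_natD(1)[OF a0_nat ob(2)] b_closed] by simp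
  then show ?thesis by (elim imageE) (rule bexI, erule sym)
qed

definition p1 where "p1 = (SOME p. p \<in> carrier (fob (P (Suc 0)) c1) \<and> d 0 c1 p = a0 c1 b)"

lemma p1: "p1 \<in> carrier (fob (P (Suc 0)) c1)" "d 0 c1 p1 = a0 c1 b"
proof -
  have "p1 \<in> carrier (fob (P (Suc 0)) c1) \<and> d 0 c1 p1 = a0 c1 b"
    unfolding p1_def by (rule someI_ex) (use p1_ex in blast)
  then show "p1 \<in> carrier (fob (P (Suc 0)) c1)" "d 0 c1 p1 = a0 c1 b" by auto
qed

abbreviation a1 where "a1 \<equiv> rep_ext (P (Suc 0)) p1"

lemma a1_nat: "contra_nat R C F1 (P (Suc 0)) a1"
  by (rule rep_ext_nat[OF P_contra ob(2) p1(1)])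

text \<open>Naturality in the Yoneda correspondence; it reduces commuting squares out of a
  representable to one equation between elements.\<close>

lemma nat_rep_ext:
  assumes G: "contra_functor R C G" and H: "contra_functor R C H" and \<eta>: "contra_nat R C G H \<eta>"
    and c: "c \<in> Ob C" and g: "g \<in> carrier (fob G c)" and x: "x \<in> Ob C" and \<phi>: "\<phi> \<in> carrier (fob (rep c) x)"
  shows "\<eta> x (rep_ext G g x \<phi>) = rep_ext H (\<eta> c g) x \<phi>"
proof -
  have \<eta>g: "\<eta> c g \<in> carrier (fob H c)" using mod_hom_closed[OF contra_natD(1)[OF \<eta> c] g] .
  have h: "(\<lambda>\<phi>. \<eta> x (rep_ext G g x \<phi>)) \<in> mod_hom R (fob (rep c) x) (fob H x)"
    by (rule contra_natD(1)[OF contra_nat_comp[OF rep_ext_nat[OF G c g] \<eta>] x])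
  show ?thesis
  proof (rule rep_hom_eq[OF contra_functorD(1)[OF H x] h contra_natD(1)[OF rep_ext_nat[OF H c \<eta>g] x] _ \<phi>])
    fix f assume f: "f \<in> Ar C" "Dom C f = x" "Cod C f = c"
    then show "\<eta> x (rep_ext G g x (rep_arr f)) = rep_ext H (\<eta> c g) x (rep_arr f)"
      using rep_ext_arr[OF G c g f(1)] rep_ext_arr[OF H c \<eta>g f(1)] contra_natD(2)[OF \<eta> f(1), of g] g by simp
  qed
qed

lemma d_a1: "x \<in> Ob C \<Longrightarrow> \<phi> \<in> carrier (fob F1 x) \<Longrightarrow> d 0 x (a1 x \<phi>) = a0 x (bd x \<phi>)"
  using nat_rep_ext[OF P_contra P_contra d_nat ob(2) p1(1)] nat_rep_ext[OF free_fun_contra P_contra a0_nat ob(2) b_closed] p1(2)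
  by simp

text \<open>An arrow to \<open>c0\<close> has augmentation 1, so a multiple of it attains any
  prescribed value. Thus \<open>aug\<close> is pointwise onto and projectivity of \<open>P 0\<close>
  applies.\<close>

lemma \<beta>0_ex: "\<exists>\<beta>. contra_nat R C (P 0) F0 \<beta> \<and>
    (\<forall>x \<in> Ob C. \<forall>p \<in> carrier (fob (P 0) x). aug x (\<beta> x p) = \<epsilon> x p)"
proof -
  have "\<epsilon> x p \<in> aug x ` carrier (fob F0 x)" if x: "x \<in> Ob C" and p: "p \<in> carrier (fob (P 0) x)" for x p
  proof -
    interpret F: module R "fob F0 x" by (rule rep_module)
    obtain f where f: "f \<in> Ar C" "Dom C f = x" "Cod C f = c0" using connected[OF x] by blast
    have r: "\<epsilon> x p \<in> carrier R" using \<epsilon>_onto[OF x] p by blast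
    have fc: "rep_arr f \<in> carrier (fob F0 x)" using rep_arr_closed[OF f(1)] f by simp
    have "aug x (\<epsilon> x p \<odot>\<^bsub>fob F0 x\<^esub> rep_arr f) = \<epsilon> x p"
      using mod_hom_smult[OF contra_natD(1)[OF aug_nat x] r fc] aug_arr[OF f(1,3)] f r
      by (simp add: const_simps) (simp add: self_mod_def)
    from image_eqI[where f = "aug x", OF this[symmetric] F.smult_closed[OF r fc]] show ?thesis .
  qed
  then show ?thesis
    by (rule projective_lift[OF proj free_fun_contra const_contra aug_nat \<epsilon>_nat]) (assumption+, intro exI conjI ballI, assumption, simp)
qed

definition \<beta>0 where "\<beta>0 = (SOME \<beta>. contra_nat R C (P 0) F0 \<beta> \<and>
    (\<forall>x \<in> Ob C. \<forall>p \<in> carrier (fob (P 0) x). aug x (\<beta> x p) = \<epsilon> x p))"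

lemma \<beta>0_nat: "contra_nat R C (P 0) F0 \<beta>0"
  and aug_\<beta>0: "x \<in> Ob C \<Longrightarrow> p \<in> carrier (fob (P 0) x) \<Longrightarrow> aug x (\<beta>0 x p) = \<epsilon> x p"
  using someI_ex[OF \<beta>0_ex] unfolding \<beta>0_def[symmetric] by auto

lemma \<beta>1_ex: "\<exists>\<beta>. contra_nat R C (P (Suc 0)) F1 \<beta> \<and>
    (\<forall>x \<in> Ob C. \<forall>p \<in> carrier (fob (P (Suc 0)) x). bd x (\<beta> x p) = \<beta>0 x (d 0 x p))"
proof -
  have "\<beta>0 x (d 0 x p) \<in> bd x ` carrier (fob F1 x)" if x: "x \<in> Ob C" and p: "p \<in> carrier (fob (P (Suc 0)) x)" for x p
    using aug_\<beta>0[OF x d_closed[OF x p]] \<epsilon>d[OF x p] mod_hom_closed[OF contra_natD(1)[OF \<beta>0_nat x] d_closed[OF x p]]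
    by (intro exact0'[OF x]) auto
  then show ?thesis
    by (rule projective_lift[OF proj free_fun_contra free_fun_contra bd_nat contra_nat_comp[OF d_nat \<beta>0_nat]]) (assumption+, intro exI conjI ballI, assumption, simp)
qed

definition \<beta>1 where "\<beta>1 = (SOME \<beta>. contra_nat R C (P (Suc 0)) F1 \<beta> \<and>
    (\<forall>x \<in> Ob C. \<forall>p \<in> carrier (fob (P (Suc 0)) x). bd x (\<beta> x p) = \<beta>0 x (d 0 x p)))"

lemma \<beta>1_nat: "contra_nat R C (P (Suc 0)) F1 \<beta>1"
  and bd_\<beta>1: "x \<in> Ob C \<Longrightarrow> p \<in> carrier (fob (P (Suc 0)) x) \<Longrightarrow> bd x (\<beta>1 x p) = \<beta>0 x (d 0 x p)"
  using someI_ex[OF \<beta>1_ex] unfolding \<beta>1_def[symmetric] by auto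

text \<open>The difference of the identity and \<open>a0\<close> after \<beta>0 is killed by
  \<epsilon>, so its values lie pointwise in the image of \<open>d 0\<close>, along which
  projectivity lifts it.\<close>

lemma k0_ex: "\<exists>k. contra_nat R C (P 0) (P (Suc 0)) k \<and>
    (\<forall>x \<in> Ob C. \<forall>p \<in> carrier (fob (P 0) x). d 0 x (k x p) = p \<ominus>\<^bsub>fob (P 0) x\<^esub> a0 x (\<beta>0 x p))"
proof -
  note n = contra_nat_diff[OF P_contra contra_nat_id contra_nat_comp[OF \<beta>0_nat a0_nat]]
  have "p \<ominus>\<^bsub>fob (P 0) x\<^esub> a0 x (\<beta>0 x p) \<in> d 0 x ` carrier (fob (P (Suc 0)) x)"
    if x: "x \<in> Ob C" and p: "p \<in> carrier (fob (P 0) x)" for x p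
  proof -
    interpret P0: module R "fob (P 0) x" by (rule P_module[OF x])
    interpret S: module R "self_mod R" by (rule self_module)
    have \<beta>p: "\<beta>0 x p \<in> carrier (fob F0 x)" using mod_hom_closed[OF contra_natD(1)[OF \<beta>0_nat x] p] .
    have ap: "a0 x (\<beta>0 x p) \<in> carrier (fob (P 0) x)" using mod_hom_closed[OF contra_natD(1)[OF a0_nat x] \<beta>p] .
    have r: "\<epsilon> x p \<in> carrier R" using \<epsilon>_onto[OF x] p by blast
    have "\<epsilon> x (p \<ominus>\<^bsub>fob (P 0) x\<^esub> a0 x (\<beta>0 x p)) = \<epsilon> x p \<ominus>\<^bsub>self_mod R\<^esub> \<epsilon> x (a0 x (\<beta>0 x p))"
      using mod_hom_minus[OF P_module[OF x] self_module _ p ap] contra_natD(1)[OF \<epsilon>_nat x] by (simp add: const_simps)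
    also have "\<dots> = \<zero>" using \<epsilon>_a0[OF x \<beta>p] aug_\<beta>0[OF x p] S.minus_self[of "\<epsilon> x p"] r
      by (simp add: const_simps)
    finally show ?thesis unfolding exactP0[OF x] using p ap by simp
  qed
  then show ?thesis
    by (rule projective_lift[OF proj P_contra P_contra d_nat n]) (assumption+, intro exI conjI ballI, assumption, simp)
qed

definition k0 where "k0 = (SOME k. contra_nat R C (P 0) (P (Suc 0)) k \<and>
    (\<forall>x \<in> Ob C. \<forall>p \<in> carrier (fob (P 0) x). d 0 x (k x p) = p \<ominus>\<^bsub>fob (P 0) x\<^esub> a0 x (\<beta>0 x p)))"

lemma k0_nat: "contra_nat R C (P 0) (P (Suc 0)) k0"
  and d_k0: "x \<in> Ob C \<Longrightarrow> p \<in> carrier (fob (P 0) x) \<Longrightarrow> d 0 x (k0 x p) = p \<ominus>\<^bsub>fob (P 0) x\<^esub> a0 x (\<beta>0 x p)"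
  using someI_ex[OF k0_ex] unfolding k0_def[symmetric] by auto

abbreviation e0 where "e0 \<equiv> rep_arr (Idn C c0)"
abbreviation e1 where "e1 \<equiv> rep_arr (Idn C c1)"

lemma e_closed: "e0 \<in> carrier (fob F0 c0)" "e1 \<in> carrier (fob F1 c1)"
  using rep_arr_closed[OF Idn_arrow[OF ob(1)]] rep_arr_closed[OF Idn_arrow[OF ob(2)]] ob by (auto simp: cat_simps)

lemma \<beta>p0: "\<beta>0 c0 p0 \<in> carrier (fob F0 c0)"
  using mod_hom_closed[OF contra_natD(1)[OF \<beta>0_nat ob(1)] p0(1)] .

text \<open>Since \<open>a0\<close> sends \<open>e0\<close> to \<open>p0\<close>, the element on the
  right is the difference of the identity and \<beta>0 after \<open>a0\<close>, evaluated at the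
  universal element. A bounding element determines the homotopy \<open>h0\<close> by Yoneda.\<close>

lemma \<chi>_ex: "\<exists>\<chi> \<in> carrier (fob F1 c0). bd c0 \<chi> = e0 \<ominus>\<^bsub>fob F0 c0\<^esub> \<beta>0 c0 p0"
proof -
  interpret F: module R "fob F0 c0" by (rule rep_module)
  interpret S: module R "self_mod R" by (rule self_module)
  have "aug c0 (e0 \<ominus>\<^bsub>fob F0 c0\<^esub> \<beta>0 c0 p0) = aug c0 e0 \<ominus>\<^bsub>self_mod R\<^esub> aug c0 (\<beta>0 c0 p0)"
    using mod_hom_minus[OF rep_module self_module _ e_closed(1) \<beta>p0] contra_natD(1)[OF aug_nat ob(1)] by (simp add: const_simps)
  also have "\<dots> = \<zero>"
    using aug_arr[OF Idn_arrow[OF ob(1)]] ob(1) aug_\<beta>0[OF ob(1) p0(1)] p0(2) S.minus_self[of \<one>]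
    by (simp add: cat_simps const_simps)
  finally have "e0 \<ominus>\<^bsub>fob F0 c0\<^esub> \<beta>0 c0 p0 \<in> bd c0 ` carrier (fob F1 c0)"
    using e_closed(1) \<beta>p0 by (intro exact0'[OF ob(1)]) auto
  then show ?thesis by (elim imageE) (rule bexI, erule sym)
qed

definition \<chi> where "\<chi> = (SOME \<chi>. \<chi> \<in> carrier (fob F1 c0) \<and> bd c0 \<chi> = e0 \<ominus>\<^bsub>fob F0 c0\<^esub> \<beta>0 c0 p0)"

lemma \<chi>: "\<chi> \<in> carrier (fob F1 c0)" "bd c0 \<chi> = e0 \<ominus>\<^bsub>fob F0 c0\<^esub> \<beta>0 c0 p0"
proof -
  have "\<exists>\<chi>. \<chi> \<in> carrier (fob F1 c0) \<and> bd c0 \<chi> = e0 \<ominus>\<^bsub>fob F0 c0\<^esub> \<beta>0 c0 p0" using \<chi>_ex by blast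
  from someI_ex[OF this] have "\<chi> \<in> carrier (fob F1 c0) \<and> bd c0 \<chi> = e0 \<ominus>\<^bsub>fob F0 c0\<^esub> \<beta>0 c0 p0"
    unfolding \<chi>_def[symmetric] .
  then show "\<chi> \<in> carrier (fob F1 c0)" "bd c0 \<chi> = e0 \<ominus>\<^bsub>fob F0 c0\<^esub> \<beta>0 c0 p0" by auto
qed

abbreviation h0 where "h0 \<equiv> rep_ext F1 \<chi>"

lemma h0_nat: "contra_nat R C F0 F1 h0"
  by (rule rep_ext_nat[OF free_fun_contra ob(1) \<chi>(1)])

lemma bd_h0:
  assumes x: "x \<in> Ob C" and \<phi>: "\<phi> \<in> carrier (fob F0 x)"
  shows "bd x (h0 x \<phi>) = \<phi> \<ominus>\<^bsub>fob F0 x\<^esub> \<beta>0 x (a0 x \<phi>)"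
proof -
  have k: "contra_nat R C F0 F0 (\<lambda>x \<phi>. \<phi> \<ominus>\<^bsub>fob F0 x\<^esub> \<beta>0 x (a0 x \<phi>))"
    by (rule contra_nat_diff[OF free_fun_contra contra_nat_id contra_nat_comp[OF a0_nat \<beta>0_nat]])
  show ?thesis
  proof (rule rep_hom_eq[OF rep_module contra_natD(1)[OF contra_nat_comp[OF h0_nat bd_nat] x] contra_natD(1)[OF k x] _ \<phi>])
    fix f assume f: "f \<in> Ar C" "Dom C f = x" "Cod C f = c0"
    have "bd x (h0 x (rep_arr f)) = far F0 f (bd c0 \<chi>)"
      using rep_ext_arr[OF free_fun_contra ob(1) \<chi>(1) f(1,3)] contra_natD(2)[OF bd_nat f(1), of \<chi>] \<chi>(1) f by simp
    also have "\<dots> = far F0 f (e0 \<ominus>\<^bsub>fob F0 c0\<^esub> \<beta>0 c0 (a0 c0 e0))"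
      unfolding \<chi>(2) rep_ext_Idn[OF P_contra ob(1) p0(1)] ..
    also have "\<dots> = far F0 f e0 \<ominus>\<^bsub>fob F0 x\<^esub> \<beta>0 x (a0 x (far F0 f e0))"
      using contra_natD(2)[OF k f(1), of e0] e_closed(1) f by simp
    also have "far F0 f e0 = rep_arr f"
      using rep_far_arr[OF f(1) Idn_arrow[OF ob(1)]] Cmp_Idn_left[OF f(1)] f ob(1) by (simp add: cat_simps)
    finally show "bd x (h0 x (rep_arr f)) = rep_arr f \<ominus>\<^bsub>fob F0 x\<^esub> \<beta>0 x (a0 x (rep_arr f))" .
  qed
qed

end


section \<open>The comparison after tensoring with \<open>M\<close>\<close>

context presented_tor
begin

abbreviation T where "T n \<equiv> ftens R C (P n) M"
abbreviation el where "el n \<equiv> elt R C (P n) M"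
abbreviation dT where "dT n \<equiv> ftens_map R C M (P (Suc n)) (P n) (d n)"
abbreviation M0 where "M0 \<equiv> fob M c0"
abbreviation M1 where "M1 \<equiv> fob M c1"
abbreviation ev0 where "ev0 \<equiv> rep_eval M c0"
abbreviation ev1 where "ev1 \<equiv> rep_eval M c1"

lemma M_module: "x \<in> Ob C \<Longrightarrow> module R (fob M x)"
  using co_functorD(1)[OF M] .

sublocale FT: ftensor R C "P n" M for n
  by (intro ftensor.intro cat_over_axioms ftensor_axioms.intro P_contra M)

lemma T_module: "module R (T n)"
  by (rule FT.ftens_module)

lemma dT_hom: "dT n \<in> mod_hom R (T (Suc n)) (T n)"
  and dT_el: "x \<in> Ob C \<Longrightarrow> p \<in> carrier (fob (P (Suc n)) x) \<Longrightarrow> m \<in> carrier (fob M x) \<Longrightarrow>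
    dT n (el (Suc n) x p m) = el n x (d n x p) m"
  using ftens_map_hom[OF P_contra P_contra M d_nat] ftens_map_elt[OF P_contra P_contra M d_nat] by auto

lemma el_left: "x \<in> Ob C \<Longrightarrow> m \<in> carrier (fob M x) \<Longrightarrow> (\<lambda>p. el n x p m) \<in> mod_hom R (fob (P n) x) (T n)"
  and el_right: "x \<in> Ob C \<Longrightarrow> p \<in> carrier (fob (P n) x) \<Longrightarrow> el n x p \<in> mod_hom R (fob M x) (T n)"
  using balancedD(1,2)[OF FT.elt_balanced] by auto

lemma el_closed:
  "x \<in> Ob C \<Longrightarrow> p \<in> carrier (fob (P n) x) \<Longrightarrow> m \<in> carrier (fob M x) \<Longrightarrow> el n x p m \<in> carrier (T n)"
  by (rule FT.elt_closed)

lemma el_zero: "x \<in> Ob C \<Longrightarrow> m \<in> carrier (fob M x) \<Longrightarrow> el n x \<zero>\<^bsub>fob (P n) x\<^esub> m = \<zero>\<^bsub>T n\<^esub>"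
  by (rule mod_hom_zero[OF P_module T_module el_left])

lemma dT_dT: "w \<in> carrier (T (Suc (Suc n))) \<Longrightarrow> dT n (dT (Suc n) w) = \<zero>\<^bsub>T n\<^esub>"
proof -
  assume w: "w \<in> carrier (T (Suc (Suc n)))"
  show ?thesis
  proof (rule FT.ftens_hom_eq[OF T_module mod_hom_comp[OF dT_hom dT_hom] mod_hom_zero_map[OF T_module] _ w])
    fix x p m assume a: "x \<in> Ob C" "p \<in> carrier (fob (P (Suc (Suc n))) x)" "m \<in> carrier (fob M x)"
    then show "dT n (dT (Suc n) (el (Suc (Suc n)) x p m)) = \<zero>\<^bsub>T n\<^esub>"
      by (simp add: dT_el d_closed d_d el_zero)
  qed
qed

definition D :: "'v \<Rightarrow> 'v" where
  "D m = far M u m \<ominus>\<^bsub>M0\<^esub> far M v m"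

lemma Mu: "far M u \<in> mod_hom R M1 M0" and Mv: "far M v \<in> mod_hom R M1 M0"
  using co_functorD(2)[OF M u(1)] co_functorD(2)[OF M v(1)] u v by auto

lemma D_hom: "D \<in> mod_hom R M1 M0"
  unfolding D_def[abs_def] by (rule mod_hom_diff[OF M_module[OF ob(1)] Mu Mv])

lemma ev_b:
  assumes m: "m \<in> carrier M1"
  shows "ev0 b m = D m"
  unfolding b_def mod_hom_minus[OF rep_module M_module[OF ob(1)] rep_eval_hom[OF M ob(1) m] uv_closed]
  using rep_eval_arr[OF M ob(1) u(1,3), of m] rep_eval_arr[OF M ob(1) v(1,3), of m] u v m by (simp add: D_def)

lemma ev_closed: "x \<in> Ob C \<Longrightarrow> c \<in> Ob C \<Longrightarrow> \<phi> \<in> carrier (fob (rep c) x) \<Longrightarrow> m \<in> carrier (fob M x) \<Longrightarrow>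
    rep_eval M c \<phi> m \<in> carrier (fob M c)"
  using mod_hom_closed[OF rep_eval_hom[OF M]] by blast

text \<open>Under the co-Yoneda identification the tensored differential becomes \<open>D\<close>:
  \<open>bd\<close> is determined by \<open>b\<close>, and evaluating \<open>b\<close> gives the
  difference of the two maps M(u) and M(v).\<close>

lemma ev_bd:
  assumes x: "x \<in> Ob C" and \<phi>: "\<phi> \<in> carrier (fob F1 x)" and m: "m \<in> carrier (fob M x)"
  shows "ev0 (bd x \<phi>) m = D (ev1 \<phi> m)"
  using balanced_rep_ext[OF M ob(2) free_fun_contra b_closed M_module[OF ob(1)] rep_eval_balanced[OF M ob(1)] x \<phi> m]
    ev_b[OF ev_closed[OF x ob(2) \<phi> m]] by simp

lemma ev_e0: "m \<in> carrier M0 \<Longrightarrow> ev0 e0 m = m"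
  using rep_eval_arr[OF M ob(1) Idn_arrow[OF ob(1)], of m] ob by (simp add: cat_simps co_functorD(3)[OF M])

lemma ev_e1: "m \<in> carrier M1 \<Longrightarrow> ev1 e1 m = m"
  using rep_eval_arr[OF M ob(2) Idn_arrow[OF ob(2)], of m] ob by (simp add: cat_simps co_functorD(3)[OF M])

text \<open>With \<open>F0\<close> tensored with \<open>M\<close> identified with M(c0), the map
  induced by \<open>a0\<close> is m -> p0 tensor m; \<open>A1\<close> is the analogue in degree
  1.\<close>

definition "A0 = el 0 c0 p0"
definition "A1 = el (Suc 0) c1 p1"

lemma A0_hom: "A0 \<in> mod_hom R M0 (T 0)"
  unfolding A0_def by (rule el_right[OF ob(1) p0(1)])

lemma A1_hom: "A1 \<in> mod_hom R M1 (T (Suc 0))"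
  unfolding A1_def by (rule el_right[OF ob(2) p1(1)])

lemma el_a0:
  assumes "x \<in> Ob C" "\<phi> \<in> carrier (fob F0 x)" "m \<in> carrier (fob M x)"
  shows "el 0 x (a0 x \<phi>) m = A0 (ev0 \<phi> m)"
  unfolding A0_def by (rule balanced_rep_ext[OF M ob(1) P_contra p0(1) T_module FT.elt_balanced assms])

lemma el_a1:
  assumes "x \<in> Ob C" "\<phi> \<in> carrier (fob F1 x)" "m \<in> carrier (fob M x)"
  shows "el (Suc 0) x (a1 x \<phi>) m = A1 (ev1 \<phi> m)"
  unfolding A1_def by (rule balanced_rep_ext[OF M ob(2) P_contra p1(1) T_module FT.elt_balanced assms])

lemma dT_A1: 
  assumes m: "m \<in> carrier M1" shows "dT 0 (A1 m) = A0 (D m)"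
  unfolding A1_def using dT_el[OF ob(2) p1(1) m] el_a0[OF ob(2) b_closed m] ev_b[OF m] p1(2) by simp

lemma balanced_nat:
  assumes \<eta>: "contra_nat R C F G \<eta>" and b: "balanced R C G M N \<beta>"
  shows "balanced R C F M N (\<lambda>x p m. \<beta> x (\<eta> x p) m)"
  unfolding balanced_def
proof (intro conjI ballI)
  fix x m assume "x \<in> Ob C" "m \<in> carrier (fob M x)"
  then show "(\<lambda>p. \<beta> x (\<eta> x p) m) \<in> mod_hom R (fob F x) N"
    using mod_hom_comp[OF contra_natD(1)[OF \<eta>, of x] balancedD(1)[OF b, of x m]] by simp
next
  fix x p assume "x \<in> Ob C" "p \<in> carrier (fob F x)"
  then show "\<beta> x (\<eta> x p) \<in> mod_hom R (fob M x) N"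
    using mod_hom_closed[OF contra_natD(1)[OF \<eta>]] by (intro balancedD(2)[OF b])
next
  fix f p m assume f: "f \<in> Ar C" and pm: "p \<in> carrier (fob F (Cod C f))" "m \<in> carrier (fob M (Dom C f))"
  have "\<eta> (Cod C f) p \<in> carrier (fob G (Cod C f))"
    using mod_hom_closed[OF contra_natD(1)[OF \<eta>]] pm f by (simp add: Cod_Ob)
  then show "\<beta> (Dom C f) (\<eta> (Dom C f) (far F f p)) m = \<beta> (Cod C f) (\<eta> (Cod C f) p) (far M f m)"
    using balancedD(3)[OF b f] contra_natD(2)[OF \<eta> f] pm by simp
qed

definition "B0 = pres_lift R (ftens_gens C (P 0) M) (ftens_rels R C (P 0) M) M0 (\<lambda>(x, p, m). ev0 (\<beta>0 x p) m)"
definition "B1 = pres_lift R (ftens_gens C (P (Suc 0)) M) (ftens_rels R C (P (Suc 0)) M) M1 (\<lambda>(x, p, m). ev1 (\<beta>1 x p) m)"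

lemma B0_hom: "B0 \<in> mod_hom R (T 0) M0"
  and B0_el: "x \<in> Ob C \<Longrightarrow> p \<in> carrier (fob (P 0) x) \<Longrightarrow> m \<in> carrier (fob M x) \<Longrightarrow> B0 (el 0 x p m) = ev0 (\<beta>0 x p) m"
  unfolding B0_def
  using FT.ftens_lift_hom[OF M_module[OF ob(1)] balanced_nat[OF \<beta>0_nat rep_eval_balanced[OF M ob(1)]]]
    FT.ftens_lift_elt[OF M_module[OF ob(1)] balanced_nat[OF \<beta>0_nat rep_eval_balanced[OF M ob(1)]]] by auto

lemma B1_hom: "B1 \<in> mod_hom R (T (Suc 0)) M1"
  and B1_el: "x \<in> Ob C \<Longrightarrow> p \<in> carrier (fob (P (Suc 0)) x) \<Longrightarrow> m \<in> carrier (fob M x) \<Longrightarrow>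
    B1 (el (Suc 0) x p m) = ev1 (\<beta>1 x p) m"
  unfolding B1_def
  using FT.ftens_lift_hom[OF M_module[OF ob(2)] balanced_nat[OF \<beta>1_nat rep_eval_balanced[OF M ob(2)]]]
    FT.ftens_lift_elt[OF M_module[OF ob(2)] balanced_nat[OF \<beta>1_nat rep_eval_balanced[OF M ob(2)]]] by auto

definition "K = ftens_map R C M (P 0) (P (Suc 0)) k0"

lemma K_hom: "K \<in> mod_hom R (T 0) (T (Suc 0))"
  and K_el: "x \<in> Ob C \<Longrightarrow> p \<in> carrier (fob (P 0) x) \<Longrightarrow> m \<in> carrier (fob M x) \<Longrightarrow> K (el 0 x p m) = el (Suc 0) x (k0 x p) m"
  unfolding K_def using ftens_map_hom[OF P_contra P_contra M k0_nat] ftens_map_elt[OF P_contra P_contra M k0_nat] by auto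

lemma \<beta>1_closed: "x \<in> Ob C \<Longrightarrow> p \<in> carrier (fob (P (Suc 0)) x) \<Longrightarrow> \<beta>1 x p \<in> carrier (fob F1 x)"
  using mod_hom_closed[OF contra_natD(1)[OF \<beta>1_nat]] .

lemma \<beta>0_closed: "x \<in> Ob C \<Longrightarrow> p \<in> carrier (fob (P 0) x) \<Longrightarrow> \<beta>0 x p \<in> carrier (fob F0 x)"
  using mod_hom_closed[OF contra_natD(1)[OF \<beta>0_nat]] .

lemma k0_closed: "x \<in> Ob C \<Longrightarrow> p \<in> carrier (fob (P 0) x) \<Longrightarrow> k0 x p \<in> carrier (fob (P (Suc 0)) x)"
  using mod_hom_closed[OF contra_natD(1)[OF k0_nat]] .

lemma a0_closed: "x \<in> Ob C \<Longrightarrow> \<phi> \<in> carrier (fob F0 x) \<Longrightarrow> a0 x \<phi> \<in> carrier (fob (P 0) x)"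
  using mod_hom_closed[OF contra_natD(1)[OF a0_nat]] .

lemma a1_closed: "x \<in> Ob C \<Longrightarrow> \<phi> \<in> carrier (fob F1 x) \<Longrightarrow> a1 x \<phi> \<in> carrier (fob (P (Suc 0)) x)"
  using mod_hom_closed[OF contra_natD(1)[OF a1_nat]] .

lemma B0_dT:
  assumes w: "w \<in> carrier (T (Suc 0))"
  shows "B0 (dT 0 w) = D (B1 w)"
proof (rule FT.ftens_hom_eq[OF M_module[OF ob(1)] mod_hom_comp[OF dT_hom B0_hom] mod_hom_comp[OF B1_hom D_hom] _ w])
  fix x p m assume a: "x \<in> Ob C" "p \<in> carrier (fob (P (Suc 0)) x)" "m \<in> carrier (fob M x)"
  then show "B0 (dT 0 (el (Suc 0) x p m)) = D (B1 (el (Suc 0) x p m))"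
    using ev_bd[OF a(1) \<beta>1_closed[OF a(1,2)] a(3)] by (simp add: dT_el B0_el B1_el d_closed bd_\<beta>1)
qed

lemma T0_homotopy:
  assumes w: "w \<in> carrier (T 0)"
  shows "w \<ominus>\<^bsub>T 0\<^esub> A0 (B0 w) = dT 0 (K w)"
proof (rule FT.ftens_hom_eq[OF T_module mod_hom_diff[OF T_module mod_hom_ident mod_hom_comp[OF B0_hom A0_hom]] mod_hom_comp[OF K_hom dT_hom] _ w])
  fix x p m assume a: "x \<in> Ob C" "p \<in> carrier (fob (P 0) x)" "m \<in> carrier (fob M x)"
  then show "el 0 x p m \<ominus>\<^bsub>T 0\<^esub> A0 (B0 (el 0 x p m)) = dT 0 (K (el 0 x p m))"
    using mod_hom_minus[OF P_module[OF a(1)] T_module el_left[OF a(1,3)] a(2) a0_closed[OF a(1) \<beta>0_closed[OF a(1,2)]]]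
      el_a0[OF a(1) \<beta>0_closed[OF a(1,2)] a(3)]
    by (simp add: dT_el B0_el K_el k0_closed d_k0)
qed

text \<open>The span of \<open>cycles\<close> is the image in \<open>M c1\<close> of the kernel of \<open>F1 \<rightarrow> F0\<close>.\<close>

definition cycles :: "'v set" where
  "cycles = {ev1 \<zeta> w |x \<zeta> w. x \<in> Ob C \<and> \<zeta> \<in> carrier (fob F1 x) \<and> bd x \<zeta> = \<zero>\<^bsub>fob F0 x\<^esub> \<and> w \<in> carrier (fob M x)}"

abbreviation J :: "'v set" where
  "J \<equiv> mod_span R M1 cycles"

lemma cycles_closed: "cycles \<subseteq> carrier M1"
  unfolding cycles_def using ev_closed[OF _ ob(2)] by blast

lemma J_sub: "submodule J R M1"
  by (rule mod_span_submodule[OF M_module[OF ob(2)] cycles_closed])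

lemma J_I: "x \<in> Ob C \<Longrightarrow> \<zeta> \<in> carrier (fob F1 x) \<Longrightarrow> bd x \<zeta> = \<zero>\<^bsub>fob F0 x\<^esub> \<Longrightarrow> w \<in> carrier (fob M x) \<Longrightarrow> ev1 \<zeta> w \<in> J"
  using mod_span_incl[of cycles R M1] unfolding cycles_def by blast

lemma D_J:
  assumes "m \<in> J" shows "D m = \<zero>\<^bsub>M0\<^esub>"
proof -
  have "cycles \<subseteq> {m \<in> carrier M1. D m = \<zero>\<^bsub>M0\<^esub>}"
  proof
    fix m assume "m \<in> cycles"
    then obtain x \<zeta> w where *: "m = ev1 \<zeta> w" "x \<in> Ob C" "\<zeta> \<in> carrier (fob F1 x)" "bd x \<zeta> = \<zero>\<^bsub>fob F0 x\<^esub>" "w \<in> carrier (fob M x)"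
      unfolding cycles_def by blast
    show "m \<in> {m \<in> carrier M1. D m = \<zero>\<^bsub>M0\<^esub>}"
      using ev_bd[OF *(2,3,5)] *(4) mod_hom_zero[OF rep_module M_module[OF ob(1)] rep_eval_hom[OF M ob(1) *(5)]]
        ev_closed[OF *(2) ob(2) *(3,5)] *(1) by simp
  qed
  from mod_span_least[OF submodule_kernel[OF M_module[OF ob(2)] M_module[OF ob(1)] D_hom] this] assms
  show ?thesis by blast
qed

text \<open>On generators \<beta>1 carries a boundary \<open>d (Suc 0) x p\<close> to a cycle of
  \<open>F1\<close>, because \<open>bd\<close> after \<beta>1 is \<beta>0 after \<open>d 0\<close>,
  and two successive differentials vanish.\<close>

lemma B1_dT:
  assumes w: "w \<in> carrier (T (Suc (Suc 0)))"
  shows "B1 (dT (Suc 0) w) \<in> J"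
proof -
  have "w \<in> {w \<in> carrier (T (Suc (Suc 0))). B1 (dT (Suc 0) w) \<in> J}"
  proof (rule FT.ftens_submodule_full[OF submodule_vimage[OF T_module M_module[OF ob(2)] mod_hom_comp[OF dT_hom B1_hom] J_sub] _ w])
    fix x p m assume a: "x \<in> Ob C" "p \<in> carrier (fob (P (Suc (Suc 0))) x)" "m \<in> carrier (fob M x)"
    have dp: "d (Suc 0) x p \<in> carrier (fob (P (Suc 0)) x)" using d_closed[OF a(1,2)] .
    have "bd x (\<beta>1 x (d (Suc 0) x p)) = \<zero>\<^bsub>fob F0 x\<^esub>"
      using bd_\<beta>1[OF a(1) dp] d_d[OF a(1,2)] mod_hom_zero[OF P_module[OF a(1)] rep_module contra_natD(1)[OF \<beta>0_nat a(1)]]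
      by simp
    then have "ev1 (\<beta>1 x (d (Suc 0) x p)) m \<in> J"
      using a dp \<beta>1_closed by (intro J_I)
    then show "el (Suc (Suc 0)) x p m \<in> {w \<in> carrier (T (Suc (Suc 0))). B1 (dT (Suc 0) w) \<in> J}"
      using a dp by (simp add: dT_el B1_el el_closed)
  qed
  then show ?thesis by simp
qed

lemma dT_image_I:
  assumes x: "x \<in> Ob C" and p: "p \<in> carrier (fob (P (Suc 0)) x)" "d 0 x p = \<zero>\<^bsub>fob (P 0) x\<^esub>" and m: "m \<in> carrier (fob M x)"
  shows "el (Suc 0) x p m \<in> dT (Suc 0) ` carrier (T (Suc (Suc 0)))"
proof -
  have "p \<in> d (Suc 0) x ` carrier (fob (P (Suc (Suc 0))) x)" unfolding exactP[OF x] using p by simp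
  then obtain q where q: "q \<in> carrier (fob (P (Suc (Suc 0))) x)" "p = d (Suc 0) x q" by blast
  then show ?thesis using dT_el[OF x q(1) m] el_closed[OF x q(1) m] by (metis imageI)
qed

text \<open>A cycle of \<open>F1\<close> goes under \<open>a1\<close> to a cycle of
  \<open>P (Suc 0)\<close>, which exactness makes a boundary at the same object. This replaces a
  chain map in degree 2.\<close>

lemma A1_J:
  assumes "m \<in> J" shows "A1 m \<in> dT (Suc 0) ` carrier (T (Suc (Suc 0)))"
proof -
  have "cycles \<subseteq> {m \<in> carrier M1. A1 m \<in> dT (Suc 0) ` carrier (T (Suc (Suc 0)))}"
  proof
    fix m assume "m \<in> cycles"
    then obtain x \<zeta> w where *: "m = ev1 \<zeta> w" "x \<in> Ob C" "\<zeta> \<in> carrier (fob F1 x)" "bd x \<zeta> = \<zero>\<^bsub>fob F0 x\<^esub>" "w \<in> carrier (fob M x)"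
      unfolding cycles_def by blast
    have "d 0 x (a1 x \<zeta>) = \<zero>\<^bsub>fob (P 0) x\<^esub>"
      using d_a1[OF *(2,3)] *(4) mod_hom_zero[OF rep_module P_module[OF *(2)] contra_natD(1)[OF a0_nat *(2)]] by simp
    from dT_image_I[OF *(2) a1_closed[OF *(2,3)] this *(5)]
    show "m \<in> {m \<in> carrier M1. A1 m \<in> dT (Suc 0) ` carrier (T (Suc (Suc 0)))}"
      using el_a1[OF *(2,3,5)] *(1) ev_closed[OF *(2) ob(2) *(3,5)] by simp
  qed
  from mod_span_least[OF submodule_vimage[OF M_module[OF ob(2)] T_module A1_hom submodule_image[OF T_module T_module dT_hom]] this] assms
  show ?thesis by blast
qed

text \<open>For each \<open>p\<close> the element p - a1(\<beta>1(p)) - k0(d(p)) is a cycle: both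
  subtracted terms contribute a0(\<beta>0(d(p))) to its boundary with opposite signs. Exactness then
  supplies a preimage separately for every generator.\<close>

lemma T1_homotopy:
  assumes w: "w \<in> carrier (T (Suc 0))"
  shows "w \<ominus>\<^bsub>T (Suc 0)\<^esub> A1 (B1 w) \<ominus>\<^bsub>T (Suc 0)\<^esub> K (dT 0 w) \<in> dT (Suc 0) ` carrier (T (Suc (Suc 0)))"
    (is "?h w \<in> ?I")
proof -
  have h: "?h \<in> mod_hom R (T (Suc 0)) (T (Suc 0))"
    by (intro mod_hom_diff[OF T_module] mod_hom_ident mod_hom_comp[OF B1_hom A1_hom] mod_hom_comp[OF dT_hom K_hom])
  have "w \<in> {w \<in> carrier (T (Suc 0)). ?h w \<in> ?I}"
  proof (rule FT.ftens_submodule_full[OF submodule_vimage[OF T_module T_module h submodule_image[OF T_module T_module dT_hom]] _ w])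
    fix x p m assume a: "x \<in> Ob C" "p \<in> carrier (fob (P (Suc 0)) x)" "m \<in> carrier (fob M x)"
    interpret P0: module R "fob (P 0) x" by (rule P_module[OF a(1)])
    interpret P1: module R "fob (P (Suc 0)) x" by (rule P_module[OF a(1)])
    let ?s = "a1 x (\<beta>1 x p)" and ?k = "k0 x (d 0 x p)"
    have dp: "d 0 x p \<in> carrier (fob (P 0) x)" using d_closed[OF a(1,2)] .
    have s: "?s \<in> carrier (fob (P (Suc 0)) x)" and k: "?k \<in> carrier (fob (P (Suc 0)) x)"
      using a1_closed[OF a(1) \<beta>1_closed[OF a(1,2)]] k0_closed[OF a(1) dp] by auto
    note hl = el_left[OF a(1,3), of "Suc 0"] and dh = contra_natD(1)[OF d_nat a(1), of 0]
    have eq: "?h (el (Suc 0) x p m) = el (Suc 0) x (p \<ominus>\<^bsub>fob (P (Suc 0)) x\<^esub> ?s \<ominus>\<^bsub>fob (P (Suc 0)) x\<^esub> ?k) m"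
      using a s k dp mod_hom_minus[OF P_module[OF a(1)] T_module hl] el_a1[OF a(1) \<beta>1_closed[OF a(1,2)] a(3)]
      by (simp add: dT_el K_el B1_el)
    have ap: "a0 x (\<beta>0 x (d 0 x p)) \<in> carrier (fob (P 0) x)"
      using a0_closed[OF a(1) \<beta>0_closed[OF a(1) dp]] .
    have "d 0 x (p \<ominus>\<^bsub>fob (P (Suc 0)) x\<^esub> ?s \<ominus>\<^bsub>fob (P (Suc 0)) x\<^esub> ?k)
        = (d 0 x p \<ominus>\<^bsub>fob (P 0) x\<^esub> d 0 x ?s) \<ominus>\<^bsub>fob (P 0) x\<^esub> d 0 x ?k"
      using a s k mod_hom_minus[OF P_module[OF a(1)] P_module[OF a(1)] dh] by simp
    also have "\<dots> = \<zero>\<^bsub>fob (P 0) x\<^esub>"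
      using d_a1[OF a(1) \<beta>1_closed[OF a(1,2)]] bd_\<beta>1[OF a(1,2)] d_k0[OF a(1) dp] dp ap by simp
    finally have "el (Suc 0) x (p \<ominus>\<^bsub>fob (P (Suc 0)) x\<^esub> ?s \<ominus>\<^bsub>fob (P (Suc 0)) x\<^esub> ?k) m \<in> ?I"
      using a s k by (intro dT_image_I) auto
    then show "el (Suc 0) x p m \<in> {w \<in> carrier (T (Suc 0)). ?h w \<in> ?I}"
      using eq el_closed[OF a] by simp
  qed
  then show ?thesis by simp
qed

lemma M0_homotopy:
  assumes m: "m \<in> carrier M0"
  shows "m \<ominus>\<^bsub>M0\<^esub> B0 (A0 m) = D (ev1 \<chi> m)"
proof -
  have "D (ev1 \<chi> m) = ev0 e0 m \<ominus>\<^bsub>M0\<^esub> ev0 (\<beta>0 c0 p0) m"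
    using ev_bd[OF ob(1) \<chi>(1) m] \<chi>(2)
      mod_hom_minus[OF rep_module M_module[OF ob(1)] rep_eval_hom[OF M ob(1) m] e_closed(1) \<beta>p0] by simp
  then show ?thesis using B0_el[OF ob(1) p0(1) m] ev_e0[OF m] by (simp add: A0_def)
qed

text \<open>The same homotopy formula at the universal element \<open>e1\<close>, whose boundary is
  \<open>b\<close>, yields a cycle of \<open>F1\<close>; evaluating this cycle at \<open>m\<close>
  gives an element of \<open>J\<close>.\<close>

lemma M1_homotopy:
  assumes m: "m \<in> carrier M1" and Dm: "D m = \<zero>\<^bsub>M0\<^esub>"
  shows "m \<ominus>\<^bsub>M1\<^esub> B1 (A1 m) \<in> J"
proof -
  interpret F0c: module R "fob F0 c1" by (rule rep_module)
  interpret F1c: module R "fob F1 c1" by (rule rep_module)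
  interpret N1: module R M1 by (rule M_module[OF ob(2)])
  let ?\<zeta> = "e1 \<ominus>\<^bsub>fob F1 c1\<^esub> \<beta>1 c1 p1 \<ominus>\<^bsub>fob F1 c1\<^esub> h0 c1 b"
  have \<beta>p: "\<beta>1 c1 p1 \<in> carrier (fob F1 c1)" using \<beta>1_closed[OF ob(2) p1(1)] .
  have hb: "h0 c1 b \<in> carrier (fob F1 c1)" using mod_hom_closed[OF contra_natD(1)[OF h0_nat ob(2)] b_closed] .
  have ab: "\<beta>0 c1 (a0 c1 b) \<in> carrier (fob F0 c1)" using \<beta>0_closed[OF ob(2) a0_closed[OF ob(2) b_closed]] .
  have "bd c1 ?\<zeta> = bd c1 e1 \<ominus>\<^bsub>fob F0 c1\<^esub> bd c1 (\<beta>1 c1 p1) \<ominus>\<^bsub>fob F0 c1\<^esub> bd c1 (h0 c1 b)"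
    using mod_hom_minus[OF rep_module rep_module bd_hom[OF ob(2)]] e_closed(2) \<beta>p hb by simp
  also have "\<dots> = b \<ominus>\<^bsub>fob F0 c1\<^esub> \<beta>0 c1 (a0 c1 b) \<ominus>\<^bsub>fob F0 c1\<^esub> (b \<ominus>\<^bsub>fob F0 c1\<^esub> \<beta>0 c1 (a0 c1 b))"
    using rep_ext_Idn[OF free_fun_contra ob(2) b_closed] bd_\<beta>1[OF ob(2) p1(1)] p1(2) bd_h0[OF ob(2) b_closed] by simp
  also have "\<dots> = \<zero>\<^bsub>fob F0 c1\<^esub>" using b_closed ab by simp
  finally have J: "ev1 ?\<zeta> m \<in> J" using e_closed(2) \<beta>p hb m by (intro J_I[OF ob(2)]) auto
  note hm = rep_eval_hom[OF M ob(2) m]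
  \<comment> \<open>The homotopy term factors through \<open>D m\<close>, which is where the
    assumption that \<open>m\<close> is a cycle enters.\<close>
  have "ev1 (h0 c1 b) m = ev1 \<chi> (D m)"
    using balanced_rep_ext[OF M ob(1) free_fun_contra \<chi>(1) M_module[OF ob(2)] rep_eval_balanced[OF M ob(2)] ob(2) b_closed m]
      ev_b[OF m] by simp
  also have "\<dots> = \<zero>\<^bsub>M1\<^esub>"
    unfolding Dm by (rule mod_hom_zero[OF M_module[OF ob(1)] M_module[OF ob(2)] balancedD(2)[OF rep_eval_balanced[OF M ob(2)] ob(1) \<chi>(1)]])
  finally have "ev1 (h0 c1 b) m = \<zero>\<^bsub>M1\<^esub>" .
  then have "ev1 ?\<zeta> m = m \<ominus>\<^bsub>M1\<^esub> B1 (A1 m)"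
    using mod_hom_minus[OF rep_module M_module[OF ob(2)] hm] e_closed(2) \<beta>p hb ev_e1[OF m] B1_el[OF ob(2) p1(1) m]
      m ev_closed[OF ob(2) ob(2) \<beta>p m]
    by (simp add: A1_def)
  with J show ?thesis by simp
qed

text \<open>The isomorphism \<iota> lets the degree 0 term be an isomorphic copy of M(c0), and
  \<open>L\<close> with \<open>g\<close> may be any parametrization of \<open>J\<close>. For
  \<open>DeltaS\<close> these freedoms yield \<open>A\<close> in place of its first tensor power,
  and the direct sum in degree 2.\<close>

theorem tor_iso:
  assumes N: "module R N" and \<iota>: "\<iota> \<in> mod_hom R M0 N" and \<kappa>: "\<kappa> \<in> mod_hom R N M0"
    and \<kappa>\<iota>: "\<And>m. m \<in> carrier M0 \<Longrightarrow> \<kappa> (\<iota> m) = m" and \<iota>\<kappa>: "\<And>n. n \<in> carrier N \<Longrightarrow> \<iota> (\<kappa> n) = n"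
    and L: "module R L" and g: "g \<in> mod_hom R L M1" and gJ: "g ` carrier L = J"
  shows "mod_iso R (tor R C P d M 0) (homology M1 (\<lambda>m. \<iota> (D m)) N (\<lambda>_. ()) zero_mod)"
    and "mod_iso R (tor R C P d M (Suc 0)) (homology L g M1 (\<lambda>m. \<iota> (D m)) N)"
proof -
  note M0m = M_module[OF ob(1)] and M1m = M_module[OF ob(2)]
  note Z = module_zero_mod[OF is_cring]
  note \<iota>D = mod_hom_comp[OF D_hom \<iota>] and zh = mod_hom_to_zero_mod[of R]
  interpret T0: module R "T 0" by (rule T_module)
  interpret T1: module R "T (Suc 0)" by (rule T_module)
  interpret N: module R N by (rule N)
  interpret M1m: module R M1 by (rule M1m)
  have B: "(\<lambda>w. \<iota> (B0 w)) \<in> mod_hom R (T 0) N" and A: "(\<lambda>n. A0 (\<kappa> n)) \<in> mod_hom R N (T 0)"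
    by (rule mod_hom_comp[OF B0_hom \<iota>], rule mod_hom_comp[OF \<kappa> A0_hom])
  have \<iota>0: "\<iota> m = \<zero>\<^bsub>N\<^esub> \<longleftrightarrow> m = \<zero>\<^bsub>M0\<^esub>" if "m \<in> carrier M0" for m
    using mod_hom_zero[OF M0m N \<iota>] mod_hom_zero[OF N M0m \<kappa>] \<kappa>\<iota>[OF that] by metis
  note cl = mod_hom_closed[OF B0_hom] mod_hom_closed[OF A0_hom] mod_hom_closed[OF B1_hom] mod_hom_closed[OF A1_hom]
    mod_hom_closed[OF D_hom] mod_hom_closed[OF \<kappa>] mod_hom_closed[OF \<iota>] mod_hom_closed[OF K_hom]
    mod_hom_closed[OF dT_hom]
  show "mod_iso R (tor R C P d M 0) (homology M1 (\<lambda>m. \<iota> (D m)) N (\<lambda>_. ()) zero_mod)"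
    unfolding tor.simps One_nat_def
  proof (rule homology_iso[OF T_module T_module Z M1m N Z dT_hom zh _ \<iota>D zh _ B _ _ A])
    fix w assume w: "w \<in> carrier (T (Suc 0))"
    have "\<iota> (B0 (dT 0 w)) = \<iota> (D (B1 w))" using B0_dT[OF w] by simp
    then show "\<iota> (B0 (dT 0 w)) \<in> (\<lambda>m. \<iota> (D m)) ` carrier M1" using cl(3)[OF w] by blast
  next
    fix m assume m: "m \<in> carrier M1"
    have "A0 (\<kappa> (\<iota> (D m))) = dT 0 (A1 m)" using dT_A1[OF m] \<kappa>\<iota>[OF cl(5)[OF m]] by simp
    then show "A0 (\<kappa> (\<iota> (D m))) \<in> dT 0 ` carrier (T (Suc 0))" using cl(4)[OF m] by blast
  next
    fix w assume w: "w \<in> carrier (T 0)"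
    have "w \<ominus>\<^bsub>T 0\<^esub> A0 (\<kappa> (\<iota> (B0 w))) = dT 0 (K w)" using T0_homotopy[OF w] \<kappa>\<iota>[OF cl(1)[OF w]] by simp
    then show "w \<ominus>\<^bsub>T 0\<^esub> A0 (\<kappa> (\<iota> (B0 w))) \<in> dT 0 ` carrier (T (Suc 0))" using cl(8)[OF w] by blast
  next
    fix n assume n: "n \<in> carrier N"
    have "n \<ominus>\<^bsub>N\<^esub> \<iota> (B0 (A0 (\<kappa> n))) = \<iota> (\<kappa> n) \<ominus>\<^bsub>N\<^esub> \<iota> (B0 (A0 (\<kappa> n)))" using \<iota>\<kappa>[OF n] by simp
    also have "\<dots> = \<iota> (\<kappa> n \<ominus>\<^bsub>M0\<^esub> B0 (A0 (\<kappa> n)))"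
      using mod_hom_minus[OF M0m N \<iota>] cl(1,2,6) n by simp
    also have "\<dots> = \<iota> (D (ev1 \<chi> (\<kappa> n)))" using M0_homotopy[OF cl(6)[OF n]] by simp
    finally show "n \<ominus>\<^bsub>N\<^esub> \<iota> (B0 (A0 (\<kappa> n))) \<in> (\<lambda>m. \<iota> (D m)) ` carrier M1"
      using ev_closed[OF ob(1) ob(2) \<chi>(1) cl(6)[OF n]] by blast
  qed (auto simp: zero_mod_def)
  show "mod_iso R (tor R C P d M (Suc 0)) (homology L g M1 (\<lambda>m. \<iota> (D m)) N)"
    unfolding tor.simps
  proof (rule homology_iso[OF T_module T_module T_module L M1m N dT_hom dT_hom _ g \<iota>D _ B1_hom _ _ A1_hom, unfolded gJ])
    show "dT 0 (dT (Suc 0) w) = \<zero>\<^bsub>T 0\<^esub>" if "w \<in> carrier (T (Suc (Suc 0)))" for w using dT_dT[OF that] .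
    show "\<iota> (D (g l)) = \<zero>\<^bsub>N\<^esub>" if "l \<in> carrier L" for l
    proof -
      have "g l \<in> J" using gJ that by blast
      from D_J[OF this] show ?thesis using mod_hom_zero[OF M0m N \<iota>] by simp
    qed
    show "\<iota> (D (B1 w)) = \<zero>\<^bsub>N\<^esub>" if "w \<in> carrier (T (Suc 0))" "dT 0 w = \<zero>\<^bsub>T 0\<^esub>" for w
      using B0_dT[OF that(1)] that(2) mod_hom_zero[OF T_module M0m B0_hom] mod_hom_zero[OF M0m N \<iota>] by simp
    show "B1 (dT (Suc 0) w) \<in> J" if "w \<in> carrier (T (Suc (Suc 0)))" for w using B1_dT[OF that] .
    show "dT 0 (A1 m) = \<zero>\<^bsub>T 0\<^esub>" if m: "m \<in> carrier M1" "\<iota> (D m) = \<zero>\<^bsub>N\<^esub>" for m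
      using dT_A1[OF m(1)] m(2) \<iota>0[OF cl(5)[OF m(1)]] mod_hom_zero[OF M0m T_module A0_hom] by simp
    show "A1 (g l) \<in> dT (Suc 0) ` carrier (T (Suc (Suc 0)))" if "l \<in> carrier L" for l
    proof -
      have "g l \<in> J" using gJ that by blast
      then show ?thesis by (rule A1_J)
    qed
    show "w \<ominus>\<^bsub>T (Suc 0)\<^esub> A1 (B1 w) \<in> dT (Suc 0) ` carrier (T (Suc (Suc 0)))"
      if w: "w \<in> carrier (T (Suc 0))" "dT 0 w = \<zero>\<^bsub>T 0\<^esub>" for w
      using T1_homotopy[OF w(1)] w(2) mod_hom_zero[OF T_module T_module K_hom] cl(3,4) w(1) by simp
    show "m \<ominus>\<^bsub>M1\<^esub> B1 (A1 m) \<in> J" if m: "m \<in> carrier M1" "\<iota> (D m) = \<zero>\<^bsub>N\<^esub>" for m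
      using M1_homotopy[OF m(1)] m(2) \<iota>0[OF cl(5)[OF m(1)]] by simp
  qed
qed

end

section \<open>Exactness for the category \<Delta>S\<close>


text \<open>Two reversals pull the letter c to the front: (U, c, X) gives XcU, and (X, 1, cU) gives
  cUX.\<close>

lemma word_connected:
  assumes swap: "\<And>X Y Z. splits L X Y Z \<Longrightarrow> E (X @ Y @ Z) = E (Z @ Y @ X)"
    and w: "distinct w" "set w = L" and v: "distinct v" "set v = L"
  shows "E w = E v"
proof (rule move_to_front_invariant[OF _ w v])
  fix U c X assume "distinct (U @ c # X)" "set (U @ c # X) = L"
  then have "splits L U [c] X" "splits L X [] (c # U)" unfolding splits_def by auto
  from this[THEN swap] show "E (U @ c # X) = E (c # U @ X)" by simp
qed

section \<open>Arrows of \<open>DeltaS\<close> as lists of words\<close>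

text \<open>The arrow out of \<open>[n]\<close> whose ordered fibres are the given words.\<close>

definition arr :: "nat \<Rightarrow> nat list list \<Rightarrow> ds_arrow" where
  "arr n ws = \<lparr>src = n, tgt = length ws - 1,
     und = restrict (\<lambda>i. THE j. j < length ws \<and> i \<in> set (ws ! j)) {..n},
     fib = (\<lambda>j. if j < length ws then ws ! j else [])\<rparr>"

definition blocks :: "nat \<Rightarrow> nat list list \<Rightarrow> bool" where
  "blocks n ws \<longleftrightarrow> ws \<noteq> [] \<and> distinct (concat ws) \<and> set (concat ws) = {..n}"

lemma arr_simps [simp]:
  "src (arr n ws) = n" "tgt (arr n ws) = length ws - 1"
  "fib (arr n ws) j = (if j < length ws then ws ! j else [])"
  by (auto simp: arr_def)

lemma blocks_disjoint:
  assumes "distinct (concat ws)" "j < length ws" "k < length ws" "i \<in> set (ws ! j)" "i \<in> set (ws ! k)"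
  shows "j = k"
  using assms
proof (induction ws arbitrary: j k)
  case (Cons w ws)
  then show ?case by (cases j; cases k) (fastforce dest: nth_mem)+
qed simp

lemma is_ds_arr: 
  assumes "blocks n ws"
  shows "is_ds_arrow (arr n ws)"
proof -
  have ws: "ws \<noteq> []" "distinct (concat ws)" "set (concat ws) = {..n}" using assms by (auto simp: blocks_def)
  have the: "(THE j. j < length ws \<and> i \<in> set (ws ! j)) = j" if "j < length ws" "i \<in> set (ws ! j)" for i j
    using that blocks_disjoint[OF ws(2)] by (intro the_equality) auto
  have ex: "\<exists>j < length ws. i \<in> set (ws ! j)" if "i \<le> n" for i
  proof -
    have "i \<in> set (concat ws)" using that ws(3) by simp
    then obtain w where "w \<in> set ws" "i \<in> set w" by auto
    then show ?thesis by (metis in_set_conv_nth)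
  qed
  have le: "i \<le> n" if "j < length ws" "i \<in> set (ws ! j)" for i j
    using that ws(3) nth_mem by fastforce
  have und: "und (arr n ws) i = j" if "j < length ws" "i \<in> set (ws ! j)" for i j
    using the[OF that] le[OF that] by (simp add: arr_def)
  have dist: "distinct (ws ! j)" if "j < length ws" for j
    using ws(2) that by (simp add: distinct_concat_iff)
  show ?thesis
    unfolding is_ds_arrow_def
  proof (intro conjI allI)
    show "und (arr n ws) \<in> {..src (arr n ws)} \<rightarrow>\<^sub>E {..tgt (arr n ws)}"
    proof (intro PiE_I)
      fix i assume "i \<in> {..src (arr n ws)}"
      then show "und (arr n ws) i \<in> {..tgt (arr n ws)}" using ex[of i] und by fastforce
    qed (simp add: arr_def)
    fix j
    show "distinct (fib (arr n ws) j)" using dist by simp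
    show "set (fib (arr n ws) j) = {i \<in> {..src (arr n ws)}. und (arr n ws) i = j}"
    proof (intro equalityI subsetI)
      fix i assume "i \<in> set (fib (arr n ws) j)"
      then show "i \<in> {i \<in> {..src (arr n ws)}. und (arr n ws) i = j}"
        using und le by (auto split: if_splits)
    next
      fix i assume i: "i \<in> {i \<in> {..src (arr n ws)}. und (arr n ws) i = j}"
      then obtain k where "k < length ws" "i \<in> set (ws ! k)" using ex by auto
      then show "i \<in> set (fib (arr n ws) j)" using und[of k i] i by auto
    qed
  qed
qed

lemma ds_arrow_blocks:
  assumes f: "is_ds_arrow f"
  shows "blocks (src f) (map (fib f) [0..<Suc (tgt f)])" "f = arr (src f) (map (fib f) [0..<Suc (tgt f)])"
proof -
  note D = ds_arrowD[OF f]
  have "distinct (concat (map (fib f) js))" if "distinct js" for js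
    using that D(1,2) by (induction js) auto
  from this[of "[0..<Suc (tgt f)]"] have "distinct (concat (map (fib f) [0..<Suc (tgt f)]))" by simp
  moreover have "set (concat (map (fib f) [0..<Suc (tgt f)])) = {..src f}"
    using D(2,3) by (auto simp: less_Suc_eq_le simp del: upt_Suc)
  ultimately show bl: "blocks (src f) (map (fib f) [0..<Suc (tgt f)])"
    unfolding blocks_def by (simp del: upt_Suc)
  show "f = arr (src f) (map (fib f) [0..<Suc (tgt f)])"
    by (rule ds_arrow_eqI[OF f is_ds_arr[OF bl]]) (simp_all del: upt_Suc)
qed

text \<open>Composition is substitution: each letter i in the words of the second arrow is replaced
  by the i-th word of the first. The length condition says that the first arrow ends at [m].\<close>

lemma arr_Cmp:
  assumes ws: "blocks n ws" and vs: "blocks m vs" and m: "length ws = Suc m"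
  shows "Cmp DeltaS (arr m vs) (arr n ws) = arr n (map (\<lambda>v. concat (map ((!) ws) v)) vs)"
    and "blocks n (map (\<lambda>v. concat (map ((!) ws) v)) vs)"
proof -
  let ?f = "Cmp DeltaS (arr m vs) (arr n ws)" and ?us = "map (\<lambda>v. concat (map ((!) ws) v)) vs"
  have f: "is_ds_arrow ?f" using is_ds_arr[OF ws] is_ds_arr[OF vs] m by (intro ds_Cmp) auto
  have vs': "vs \<noteq> []" using vs by (simp add: blocks_def)
  have fib: "fib ?f j = ?us ! j" if j: "j < length vs" for j
  proof -
    have "set (vs ! j) \<subseteq> {..m}" using vs j nth_mem[OF j] by (auto simp: blocks_def)
    then show ?thesis using j m by (auto simp: subset_iff less_Suc_eq_le intro!: arg_cong[of _ _ concat])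
  qed
  have us: "?us = map (fib ?f) [0..<Suc (tgt ?f)]"
    using vs' fib by (intro nth_equalityI) (auto simp del: upt_Suc)
  show "?f = arr n ?us" using ds_arrow_blocks(2)[OF f] unfolding us by (simp del: upt_Suc)
  show "blocks n ?us" using ds_arrow_blocks(1)[OF f] unfolding us by (simp del: upt_Suc)
qed

lemma blocks_three: "blocks n [X, Y, Z] \<longleftrightarrow> splits {..n} X Y Z"
  and blocks_four: "blocks n [W, X, Y, Z] \<longleftrightarrow> splits {..n} (W @ X) Y Z"
  and blocks_one: "blocks n [w] \<longleftrightarrow> distinct w \<and> set w = {..n}"
  by (auto simp: blocks_def splits_def)

lemma ds_arrow_three:
  assumes "is_ds_arrow f" "tgt f = 2"
  obtains X Y Z where "splits {..src f} X Y Z" "f = arr (src f) [X, Y, Z]"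
proof
  have "[0..<Suc 2] = [0, 1, 2]" by (simp add: upt_rec)
  then show "splits {..src f} (fib f 0) (fib f 1) (fib f 2)" "f = arr (src f) [fib f 0, fib f 1, fib f 2]"
    using ds_arrow_blocks[OF assms(1)] assms(2) blocks_three by auto
qed

lemma ds_arrow_one:
  assumes "is_ds_arrow f" "tgt f = 0"
  shows "blocks (src f) [fib f 0]" "f = arr (src f) [fib f 0]"
  using ds_arrow_blocks[OF assms(1)] assms(2) by auto

abbreviation "up \<equiv> arr 2 [[0, 1, 2]]"
abbreviation "down \<equiv> arr 2 [[2, 1, 0]]"

lemma atMost_small: "{..2::nat} = {0, 1, 2}" "{..3::nat} = {0, 1, 2, 3}" "{..0::nat} = {0}"
  by (auto simp: numeral_2_eq_2 numeral_3_eq_3 atMost_Suc)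

lemma blocks_up_down: "blocks 2 [[0, 1, 2]]" "blocks 2 [[2, 1, 0]]"
  by (auto simp: blocks_def atMost_small)

lemma up_Cmp: "splits {..n} X Y Z \<Longrightarrow> Cmp DeltaS up (arr n [X, Y, Z]) = arr n [X @ Y @ Z]"
  and down_Cmp: "splits {..n} X Y Z \<Longrightarrow> Cmp DeltaS down (arr n [X, Y, Z]) = arr n [Z @ Y @ X]"
  using arr_Cmp(1)[of n "[X, Y, Z]" 2 "[[0, 1, 2]]"] arr_Cmp(1)[of n "[X, Y, Z]" 2 "[[2, 1, 0]]"] blocks_up_down
  by (auto simp: blocks_three numeral_2_eq_2)

abbreviation "mid \<equiv> arr 0 [[], [0], []]"

lemma blocks_4: "blocks 3 [[0, 1], [2], [3]]" "blocks 3 [[3], [2, 0], [1]]" "blocks 3 [[1, 2, 0], [], [3]]"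
  "blocks 3 [[3], [1, 2], [0]]" "blocks 0 [[], [0], []]"
  by (auto simp: blocks_def atMost_small)

text \<open>The four arrows [3] -> [2] are the triples of the relation for the one-letter words W =
  0, X = 1, Y = 2, Z = 3. Every other instance is pulled back from this universal one along (W, X,
  Y, Z).\<close>

lemma four_Cmp:
  assumes "splits {..n} (W @ X) Y Z"
  shows "Cmp DeltaS (arr 3 [[0, 1], [2], [3]]) (arr n [W, X, Y, Z]) = arr n [W @ X, Y, Z]"
    "Cmp DeltaS (arr 3 [[3], [2, 0], [1]]) (arr n [W, X, Y, Z]) = arr n [Z, Y @ W, X]"
    "Cmp DeltaS (arr 3 [[1, 2, 0], [], [3]]) (arr n [W, X, Y, Z]) = arr n [X @ Y @ W, [], Z]"
    "Cmp DeltaS (arr 3 [[3], [1, 2], [0]]) (arr n [W, X, Y, Z]) = arr n [Z, X @ Y, W]"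
proof -
  have "blocks n [W, X, Y, Z]" using assms by (simp add: blocks_four)
  note c = arr_Cmp(1)[OF this blocks_4(1)] arr_Cmp(1)[OF this blocks_4(2)]
    arr_Cmp(1)[OF this blocks_4(3)] arr_Cmp(1)[OF this blocks_4(4)]
  show "Cmp DeltaS (arr 3 [[0, 1], [2], [3]]) (arr n [W, X, Y, Z]) = arr n [W @ X, Y, Z]"
    "Cmp DeltaS (arr 3 [[3], [2, 0], [1]]) (arr n [W, X, Y, Z]) = arr n [Z, Y @ W, X]"
    "Cmp DeltaS (arr 3 [[1, 2, 0], [], [3]]) (arr n [W, X, Y, Z]) = arr n [X @ Y @ W, [], Z]"
    "Cmp DeltaS (arr 3 [[3], [1, 2], [0]]) (arr n [W, X, Y, Z]) = arr n [Z, X @ Y, W]"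
    using c by simp_all
qed

lemma mid_Cmp: "blocks n [w] \<Longrightarrow> Cmp DeltaS mid (arr n [w]) = arr n [[], w, []]"
  using blocks_4(5) by (simp add: arr_Cmp(1)[of n "[w]" 0])


section \<open>Exactness at F0 and the maps of the small complex\<close>

lemma mod_hom_scale:
  assumes "module R M" "x \<in> carrier M"
  shows "(\<lambda>r. r \<odot>\<^bsub>M\<^esub> x) \<in> mod_hom R (self_mod R) M"
proof -
  interpret M: module R M by fact
  show ?thesis by (rule mod_homI) (auto simp: self_mod_def M.smult_l_distr M.smult_assoc1 assms(2))
qed

lemma dsum_module:
  assumes "module R M" "module R N"
  shows "module R (dsum_mod M N)"
proof -
  interpret M: module R M by fact
  interpret N: module R N by fact
  show ?thesis
  proof (intro moduleI abelian_groupI)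
    fix z assume "z \<in> carrier (dsum_mod M N)"
    then show "\<exists>w \<in> carrier (dsum_mod M N). w \<oplus>\<^bsub>dsum_mod M N\<^esub> z = \<zero>\<^bsub>dsum_mod M N\<^esub>"
      by (intro bexI[of _ "(\<ominus>\<^bsub>M\<^esub> fst z, \<ominus>\<^bsub>N\<^esub> snd z)"]) (auto simp: dsum_mod_def M.l_neg N.l_neg)
  qed (auto simp: dsum_mod_def M.a_ac N.a_ac M.smult_l_distr N.smult_l_distr M.smult_r_distr N.smult_r_distr
      M.smult_assoc1 N.smult_assoc1 M.R.is_cring)
qed

lemma dsum_hom:
  assumes K: "module R K" and h: "h \<in> mod_hom R M K" and k: "k \<in> mod_hom R N K"
  shows "(\<lambda>z. h (fst z) \<oplus>\<^bsub>K\<^esub> k (snd z)) \<in> mod_hom R (dsum_mod M N) K"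
proof -
  interpret K: module R K by fact
  show ?thesis
    by (rule mod_homI)
      (auto simp: dsum_mod_def mod_hom_closed[OF h] mod_hom_closed[OF k] mod_hom_add[OF h] mod_hom_add[OF k]
        mod_hom_smult[OF h] mod_hom_smult[OF k] K.smult_r_distr K.a_ac)
qed

text \<open>The shape taken by the boundary of the universal four-term relation, as a walk through
  four permutations back to the first.\<close>

lemma (in abelian_group) telescope4:
  assumes "a \<in> carrier G" "b \<in> carrier G" "c \<in> carrier G" "d \<in> carrier G"
  shows "(a \<ominus> b) \<oplus> (b \<ominus> c) \<oplus> (c \<ominus> d) \<oplus> (d \<ominus> a) = \<zero>"
proof -
  have e: "(x \<ominus> y) \<oplus> (y \<ominus> z) = x \<ominus> z" if "x \<in> carrier G" "y \<in> carrier G" "z \<in> carrier G" for x y z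
    using that by (simp add: a_minus_def a_assoc) (simp add: l_neg flip: a_assoc)
  show ?thesis using assms by (simp add: e)
qed

context algebra_over
begin

sublocale DS: cat_over R DeltaS
  by (intro cat_over.intro base_ring_axioms DeltaS.small_cat_axioms)

abbreviation F where "F c x \<equiv> fob (DS.rep c) x"
abbreviation e where "e n ws \<equiv> DS.rep_arr (arr n ws)"

lemma e_closed:
  assumes "blocks n ws" shows "e n ws \<in> carrier (F (length ws - 1) n)"
  using DS.rep_arr_closed[of "arr n ws"] is_ds_arr[OF assms] by simp

lemma e_closed1: "blocks n [w] \<Longrightarrow> e n [w] \<in> carrier (F 0 n)"
  using e_closed[of n "[w]"] by simp

lemma e_closed3: "splits {..n} X Y Z \<Longrightarrow> e n [X, Y, Z] \<in> carrier (F 2 n)"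
  using e_closed[of n "[X, Y, Z]"] by (simp add: blocks_three numeral_2_eq_2)

definition db where "db = e 2 [[0, 1, 2]] \<ominus>\<^bsub>F 0 2\<^esub> e 2 [[2, 1, 0]]"

lemma F_module: "module R (F c x)"
  unfolding DS.free_fun_fob by (rule free_module)

lemma db_closed: "db \<in> carrier (F 0 2)"
proof -
  interpret M: module R "F 0 2" by (rule F_module)
  show ?thesis unfolding db_def using e_closed1[OF blocks_up_down(1)] e_closed1[OF blocks_up_down(2)] by simp
qed

abbreviation bd where "bd \<equiv> DS.rep_ext (DS.rep 0) db"

lemma bd_hom: "bd n \<in> mod_hom R (F 2 n) (F 0 n)"
  using contra_natD(1)[OF DS.rep_ext_nat[OF DS.free_fun_contra _ db_closed], of n] by simp

lemma bd_e:
  assumes X: "splits {..n} X Y Z"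
  shows "bd n (e n [X, Y, Z]) = e n [X @ Y @ Z] \<ominus>\<^bsub>F 0 n\<^esub> e n [Z @ Y @ X]"
proof -
  have f: "is_ds_arrow (arr n [X, Y, Z])" using is_ds_arr X by (simp add: blocks_three)
  have t: "tgt (arr n [X, Y, Z]) = 2" by simp
  have h: "far (DS.rep 0) (arr n [X, Y, Z]) \<in> mod_hom R (F 0 2) (F 0 n)"
    using contra_functorD(2)[OF DS.free_fun_contra, of "arr n [X, Y, Z]"] f by (simp add: numeral_2_eq_2)
  have "bd n (e n [X, Y, Z]) = far (DS.rep 0) (arr n [X, Y, Z]) db"
    using DS.rep_ext_arr[OF DS.free_fun_contra _ db_closed, of "arr n [X, Y, Z]"] f by (simp add: numeral_2_eq_2)
  also have "\<dots> = far (DS.rep 0) (arr n [X, Y, Z]) (e 2 [[0, 1, 2]]) \<ominus>\<^bsub>F 0 n\<^esub> far (DS.rep 0) (arr n [X, Y, Z]) (e 2 [[2, 1, 0]])"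
    unfolding db_def
    by (rule mod_hom_minus[OF F_module F_module h e_closed1[OF blocks_up_down(1)] e_closed1[OF blocks_up_down(2)]])
  also have "\<dots> = e n [X @ Y @ Z] \<ominus>\<^bsub>F 0 n\<^esub> e n [Z @ Y @ X]"
    using DS.rep_far_arr[of "arr n [X, Y, Z]" up] DS.rep_far_arr[of "arr n [X, Y, Z]" down] f
      is_ds_arr[OF blocks_up_down(1)] is_ds_arr[OF blocks_up_down(2)] up_Cmp[OF X] down_Cmp[OF X]
    by (simp add: numeral_2_eq_2)
  finally show ?thesis .
qed

text \<open>Modulo the image of \<open>bd\<close> all permutations have the same class, by
  \<open>word_connected\<close>. Hence the class of \<phi> is its augmentation times the class of
  one reference permutation, and vanishes with the augmentation.\<close>

lemma augmentation_exact:
  assumes \<phi>: "\<phi> \<in> carrier (F 0 n)" and aug: "DS.rep_ext (const_functor R) \<one> n \<phi> = \<zero>"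
  shows "\<phi> \<in> bd n ` carrier (F 2 n)"
proof -
  let ?I = "bd n ` carrier (F 2 n)" and ?aug = "DS.rep_ext (const_functor R) \<one> n"
  interpret S: module R "self_mod R" by (rule DS.self_module)
  interpret Q: mod_quotient R "F 0 n" ?I
    by (intro mod_quotient.intro mod_quotient_axioms.intro F_module submodule_image[OF F_module F_module bd_hom])
  let ?Q = "quot_mod (F 0 n) ?I" and ?q = "\<lambda>x. ?I +>\<^bsub>F 0 n\<^esub> x"
  interpret QM: module R ?Q by (rule Q.quot_module)
  let ?w = "[0..<Suc n]"
  have w: "distinct ?w" "set ?w = {..n}" by auto
  have const: "?q (e n [v]) = ?q (e n [?w])" if v: "blocks n [v]" for v
  proof (rule word_connected[of "{..n}" "\<lambda>v. ?q (e n [v])"])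
    fix X Y Z assume X: "splits {..n} X Y Z"
    then have b: "blocks n [X @ Y @ Z]" "blocks n [Z @ Y @ X]" unfolding splits_def blocks_one by auto
    have "e n [X @ Y @ Z] \<ominus>\<^bsub>F 0 n\<^esub> e n [Z @ Y @ X] \<in> ?I"
      unfolding bd_e[OF X, symmetric] by (rule imageI[OF e_closed3[OF X]])
    then show "?q (e n [X @ Y @ Z]) = ?q (e n [Z @ Y @ X])"
      using b e_closed1 by (subst Q.quot_eq_iff) auto
  qed (use v w in \<open>auto simp: blocks_one simp del: upt_Suc\<close>)
  let ?E = "?q (e n [?w])"
  have E: "?E \<in> carrier ?Q" using mod_hom_closed[OF Q.quot_proj e_closed1] w by (simp add: blocks_one del: upt_Suc)
  have one: "\<one> \<in> carrier (fob (const_functor R) 0)" by (simp add: const_functor_def self_mod_def)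
  have aug_hom: "?aug \<in> mod_hom R (F 0 n) (self_mod R)"
    using contra_natD(1)[OF DS.rep_ext_nat[OF DS.const_contra _ one], of n] by (simp add: const_functor_def)
  have mult_hom: "(\<lambda>r. r \<odot>\<^bsub>?Q\<^esub> ?E) \<in> mod_hom R (self_mod R) ?Q"
    by (rule mod_hom_scale[OF Q.quot_module E])
  have "?q \<phi> = ?aug \<phi> \<odot>\<^bsub>?Q\<^esub> ?E"
  proof (rule DS.rep_hom_eq[OF Q.quot_module Q.quot_proj mod_hom_comp[OF aug_hom mult_hom] _ \<phi>])
    fix f assume f: "f \<in> Ar DeltaS" "Dom DeltaS f = n" "Cod DeltaS f = 0"
    then have f': "is_ds_arrow f" "tgt f = 0" "src f = n" by auto
    note b = ds_arrow_one[OF f'(1,2), unfolded f'(3)]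
    have "?aug (DS.rep_arr f) = \<one>"
      using DS.rep_ext_arr[OF DS.const_contra _ one, of f] f by (simp add: const_functor_def)
    then show "?q (DS.rep_arr f) = ?aug (DS.rep_arr f) \<odot>\<^bsub>?Q\<^esub> ?E"
      using const[OF b(1)] QM.smult_one[OF E] b(2) by (simp only:)
  qed
  also have "\<dots> = \<zero>\<^bsub>?Q\<^esub>" unfolding aug by (rule QM.smult_l_null[OF E])
  finally show ?thesis using Q.quot_zero_iff[OF \<phi>] by simp
qed

lemma one_arrow: "\<exists>f \<in> Ar DeltaS. Dom DeltaS f = n \<and> Cod DeltaS f = 0"
proof -
  have "blocks n [[0..<Suc n]]" by (auto simp: blocks_one simp del: upt_Suc)
  from is_ds_arr[OF this] show ?thesis by (intro bexI[of _ "arr n [[0..<Suc n]]"]) auto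
qed

abbreviation T where "T \<equiv> tens_pow R A"
abbreviation B where "B \<equiv> far (Bsym R A)"

lemma B_hom:
  assumes "blocks n ws" "length ws = Suc m"
  shows "B (arr n ws) \<in> mod_hom R (T (Suc n)) (T (Suc m))"
  using Bsym_hom[OF is_ds_arr[OF assms(1)]] assms(2) by simp

lemma B_Cmp:
  assumes "is_ds_arrow f" "is_ds_arrow g" "tgt f = src g" "x \<in> carrier (T (Suc (src f)))"
  shows "B g (B f x) = B (Cmp DeltaS g f) x"
  using co_functorD(4)[OF Bsym_functor, of f g x] assms by (simp add: Bsym_fob)

text \<open>The first tensor power is a quotient of a free module and hence only isomorphic to
  \<open>A\<close>; \<open>iota\<close> and \<open>kappa\<close> are the mutually inverse
  identifications.\<close>

definition iota where "iota = tens_lift R A 1 A hd"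
definition kappa where "kappa a = pure R A [a]"

lemma single_split: "us @ [a] @ vs \<in> tens_gens A (Suc 0) \<Longrightarrow> us = [] \<and> vs = [] \<and> a \<in> carrier A"
  by (auto simp: tens_gens_def)

lemma iota_hom: "iota \<in> mod_hom R (T 1) A"
  and iota_pure: "a \<in> carrier A \<Longrightarrow> iota (pure R A [a]) = a"
proof -
  have hd: "hd \<in> tens_gens A 1 \<rightarrow> carrier A" by (auto simp: tens_gens_def length_Suc_conv)
  have add: "hd (us @ [a \<oplus>\<^bsub>A\<^esub> b] @ vs) = hd (us @ [a] @ vs) \<oplus>\<^bsub>A\<^esub> hd (us @ [b] @ vs)"
    if "us @ [a] @ vs \<in> tens_gens A 1" for us a b vs using single_split that by fastforce
  have smult: "hd (us @ [r \<odot>\<^bsub>A\<^esub> a] @ vs) = r \<odot>\<^bsub>A\<^esub> hd (us @ [a] @ vs)"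
    if "us @ [a] @ vs \<in> tens_gens A 1" for us a r vs using single_split that by fastforce
  show "iota \<in> mod_hom R (T 1) A"
    unfolding iota_def by (rule tens_lift_hom[OF A.module_axioms hd add smult])
  show "iota (pure R A [a]) = a" if "a \<in> carrier A"
    unfolding iota_def using tens_lift_pure[OF A.module_axioms hd add smult, of "[a]"] that by (simp add: tens_gens_def)
qed

lemma kappa_hom: "kappa \<in> mod_hom R A (T 1)"
proof (rule mod_homI)
  fix a assume a: "a \<in> carrier A"
  then have g: "[] @ [a] @ [] \<in> tens_gens A 1" by (simp add: tens_gens_def)
  then show "kappa a \<in> carrier (T 1)" using pure_closed[of "[a]" 1] by (simp add: kappa_def)
  show "kappa (a \<oplus>\<^bsub>A\<^esub> b) = kappa a \<oplus>\<^bsub>T 1\<^esub> kappa b" if "b \<in> carrier A" for b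
    using pure_add[OF g that] by (simp add: kappa_def)
  show "kappa (r \<odot>\<^bsub>A\<^esub> a) = r \<odot>\<^bsub>T 1\<^esub> kappa a" if "r \<in> carrier R" for r
    using pure_smult[OF g that] by (simp add: kappa_def)
qed

lemma iota_kappa: "a \<in> carrier A \<Longrightarrow> iota (kappa a) = a"
  by (simp add: kappa_def iota_pure)

lemma kappa_iota: "x \<in> carrier (T 1) \<Longrightarrow> kappa (iota x) = x"
proof (rule tens_hom_eq[OF tens_module mod_hom_comp[OF iota_hom kappa_hom] mod_hom_ident])
  fix as assume "as \<in> tens_gens A 1"
  then obtain a where "as = [a]" "a \<in> carrier A" by (auto simp: tens_gens_def length_Suc_conv)
  then show "kappa (iota (pure R A as)) = pure R A as" by (simp add: iota_pure kappa_def)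
qed

abbreviation "g1 \<equiv> arr 3 [[0, 1], [2], [3]]"
abbreviation "g2 \<equiv> arr 3 [[3], [2, 0], [1]]"
abbreviation "g3 \<equiv> arr 3 [[1, 2, 0], [], [3]]"
abbreviation "g4 \<equiv> arr 3 [[3], [1, 2], [0]]"

definition D4 where
  "D4 x = B g1 x \<oplus>\<^bsub>T 3\<^esub> B g2 x \<oplus>\<^bsub>T 3\<^esub> B g3 x \<oplus>\<^bsub>T 3\<^esub> B g4 x"

definition D2 where "D2 z = D4 (fst z) \<oplus>\<^bsub>T 3\<^esub> B mid (kappa (snd z))"

lemma g_hom: "B g1 \<in> mod_hom R (T 4) (T 3)" "B g2 \<in> mod_hom R (T 4) (T 3)"
  "B g3 \<in> mod_hom R (T 4) (T 3)" "B g4 \<in> mod_hom R (T 4) (T 3)" "B mid \<in> mod_hom R (T 1) (T 3)"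
  using B_hom[OF blocks_4(1), of 2] B_hom[OF blocks_4(2), of 2] B_hom[OF blocks_4(3), of 2]
    B_hom[OF blocks_4(4), of 2] B_hom[OF blocks_4(5), of 2] by (simp_all add: eval_nat_numeral)

lemma D4_hom: "D4 \<in> mod_hom R (T 4) (T 3)"
  unfolding D4_def[abs_def] by (intro mod_hom_plus tens_module g_hom)

lemma D2_hom: "D2 \<in> mod_hom R (dsum_mod (T 4) A) (T 3)"
  unfolding D2_def[abs_def] by (rule dsum_hom[OF tens_module D4_hom mod_hom_comp[OF kappa_hom g_hom(5)]])

lemma D2_left: "x \<in> carrier (T 4) \<Longrightarrow> D2 (x, \<zero>\<^bsub>A\<^esub>) = D4 x"
proof -
  assume x: "x \<in> carrier (T 4)"
  interpret T3: module R "T 3" by (rule tens_module)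
  have "B mid (kappa \<zero>\<^bsub>A\<^esub>) = \<zero>\<^bsub>T 3\<^esub>"
    by (rule mod_hom_zero[OF A.module_axioms tens_module mod_hom_comp[OF kappa_hom g_hom(5)]])
  then show ?thesis using mod_hom_closed[OF D4_hom x] by (simp add: D2_def)
qed

lemma D2_right: "a \<in> carrier A \<Longrightarrow> D2 (\<zero>\<^bsub>T 4\<^esub>, a) = B mid (kappa a)"
proof -
  assume a: "a \<in> carrier A"
  interpret T3: module R "T 3" by (rule tens_module)
  show ?thesis using mod_hom_zero[OF tens_module tens_module D4_hom]
      mod_hom_closed[OF mod_hom_comp[OF kappa_hom g_hom(5)] a] by (simp add: D2_def)
qed

end


section \<open>The image of \<open>D2\<close>\<close>

context algebra_over
begin

lemma ev_arr:
  assumes "is_ds_arrow f" "tgt f = m" "x \<in> carrier (T (Suc (src f)))"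
  shows "DS.rep_eval (Bsym R A) m (DS.rep_arr f) x = B f x"
  using DS.rep_eval_arr[OF Bsym_functor, of m f x] assms by (simp add: Bsym_fob)

lemma ev_hom:
  assumes "x \<in> carrier (T (Suc n))"
  shows "(\<lambda>\<phi>. DS.rep_eval (Bsym R A) m \<phi> x) \<in> mod_hom R (F m n) (T (Suc m))"
  using DS.rep_eval_hom[OF Bsym_functor, of m x n] assms by (simp add: Bsym_fob)

lemma ev2_closed:
  "\<zeta> \<in> carrier (F 2 n) \<Longrightarrow> w \<in> carrier (T (Suc n)) \<Longrightarrow> DS.rep_eval (Bsym R A) 2 \<zeta> w \<in> carrier (T 3)"
  using mod_hom_closed[OF ev_hom[of w n 2]] by simp

text \<open>The set \<open>cycles\<close> of the comparison, specialised to \<open>DeltaS\<close>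
  and the bar construction and stated without reference to a resolution.\<close>

definition relators :: "(('a list \<Rightarrow> 'k) set) set" where
  "relators = {DS.rep_eval (Bsym R A) 2 \<zeta> w |n \<zeta> w. \<zeta> \<in> carrier (F 2 n) \<and> bd n \<zeta> = \<zero>\<^bsub>F 0 n\<^esub> \<and> w \<in> carrier (T (Suc n))}"

text \<open>Each summand of \<open>D2\<close> is evaluation at a fixed cycle of F1: the universal
  four-term sum at [3], and the arrow \<open>mid\<close> at [0].\<close>

lemma D2_in_span:
  assumes z: "z \<in> carrier (dsum_mod (T 4) A)"
  shows "D2 z \<in> mod_span R (T 3) relators"
proof -
  obtain x a where z': "z = (x, a)" "x \<in> carrier (T 4)" "a \<in> carrier A" using z by (auto simp: dsum_mod_def)
  interpret T3: module R "T 3" by (rule tens_module)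
  interpret F03: module R "F 0 3" by (rule F_module)
  interpret F23: module R "F 2 3" by (rule F_module)
  interpret F00: module R "F 0 0" by (rule F_module)
  have cl: "relators \<subseteq> carrier (T 3)"
    unfolding relators_def using ev2_closed by blast
  note span = mod_span_submodule[OF tens_module cl]
  let ?G = "[[0, 1], [2], [3]]" and ?H = "[[3], [2, 0], [1]]" and ?I = "[[1, 2, 0], [], [3]]" and ?J = "[[3], [1, 2], [0]]"
  have sp: "splits {..3::nat} [0, 1] [2] [3]" "splits {..3::nat} [3] [2, 0] [1]"
    "splits {..3::nat} [1, 2, 0] [] [3]" "splits {..3::nat} [3] [1, 2] [0]" "splits {..0::nat} [] [0] []"
    using blocks_4 by (simp_all only: blocks_three)
  note ec = sp[THEN e_closed3]
  \<comment> \<open>Its boundary walks through 0123, 3201, 1203, 3120 and back to 0123.\<close>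
  let ?\<zeta> = "e 3 ?G \<oplus>\<^bsub>F 2 3\<^esub> e 3 ?H \<oplus>\<^bsub>F 2 3\<^esub> e 3 ?I \<oplus>\<^bsub>F 2 3\<^esub> e 3 ?J"
  have w: "blocks 3 [[0, 1, 2, 3]]" "blocks 3 [[3, 2, 0, 1]]" "blocks 3 [[1, 2, 0, 3]]" "blocks 3 [[3, 1, 2, 0]]"
    by (auto simp: blocks_def atMost_small)
  have "bd 3 ?\<zeta> = bd 3 (e 3 ?G) \<oplus>\<^bsub>F 0 3\<^esub> bd 3 (e 3 ?H) \<oplus>\<^bsub>F 0 3\<^esub> bd 3 (e 3 ?I) \<oplus>\<^bsub>F 0 3\<^esub> bd 3 (e 3 ?J)"
    using ec by (simp add: mod_hom_add[OF bd_hom])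
  also have "\<dots> = \<zero>\<^bsub>F 0 3\<^esub>"
    unfolding bd_e[OF sp(1)] bd_e[OF sp(2)] bd_e[OF sp(3)] bd_e[OF sp(4)] append.simps
    by (rule F03.telescope4[OF w[THEN e_closed1]])
  finally have "DS.rep_eval (Bsym R A) 2 ?\<zeta> x \<in> relators"
    unfolding relators_def using ec z'(2) by (auto intro!: exI[of _ "?\<zeta>"] exI[of _ "3::nat"] exI[of _ x])
  moreover have "DS.rep_eval (Bsym R A) 2 ?\<zeta> x = D4 x"
  proof -
    have x: "x \<in> carrier (T (Suc 3))" using z'(2) by (simp add: eval_nat_numeral)
    note h = ev_hom[OF x, of 2]
    have ev: "DS.rep_eval (Bsym R A) 2 (e 3 ws) x = B (arr 3 ws) x" if "blocks 3 ws" "length ws = 3" for ws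
      using ev_arr[OF is_ds_arr[OF that(1)], of 2 x] that(2) x by simp
    show ?thesis
      using ec mod_hom_add[OF h] ev[OF blocks_4(1)] ev[OF blocks_4(2)] ev[OF blocks_4(3)] ev[OF blocks_4(4)]
      by (simp add: D4_def)
  qed
  ultimately have 1: "D4 x \<in> mod_span R (T 3) relators" using mod_span_incl[of relators R "T 3"] by auto
  have k: "kappa a \<in> carrier (T (Suc 0))" using mod_hom_closed[OF kappa_hom z'(3)] by simp
  have w0: "blocks 0 [[0]]" by (auto simp: blocks_def)
  have "bd 0 (e 0 [[], [0], []]) = \<zero>\<^bsub>F 0 0\<^esub>"
    using bd_e[OF sp(5)] e_closed1[OF w0] by simp
  then have "DS.rep_eval (Bsym R A) 2 (e 0 [[], [0], []]) (kappa a) \<in> relators"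
    unfolding relators_def using ec(5) k by blast
  moreover have "DS.rep_eval (Bsym R A) 2 (e 0 [[], [0], []]) (kappa a) = B mid (kappa a)"
    using ev_arr[OF is_ds_arr[OF blocks_4(5)], of 2 "kappa a"] k by simp
  ultimately have 2: "B mid (kappa a) \<in> mod_span R (T 3) relators" using mod_span_incl[of relators R "T 3"] by auto
  show ?thesis using T3.submoduleE(5)[OF span 1 2] by (simp add: D2_def z'(1))
qed

text \<open>Modulo the image of \<open>D2\<close>, the values at \<open>w\<close> of all triples
  have a potential \<open>s\<close>. Evaluation at \<open>w\<close> thus factors through
  \<open>bd\<close>, so it vanishes on cycles.\<close>

lemma relators_in_image:
  assumes \<zeta>: "\<zeta> \<in> carrier (F 2 n)" "bd n \<zeta> = \<zero>\<^bsub>F 0 n\<^esub>" and w: "w \<in> carrier (T (Suc n))"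
  shows "DS.rep_eval (Bsym R A) 2 \<zeta> w \<in> D2 ` carrier (dsum_mod (T 4) A)"
proof -
  let ?I = "D2 ` carrier (dsum_mod (T 4) A)"
  have dsum: "module R (dsum_mod (T 4) A)" by (rule dsum_module[OF tens_module A.module_axioms])
  interpret Q: mod_quotient R "T 3" ?I
    by (intro mod_quotient.intro mod_quotient_axioms.intro tens_module submodule_image[OF dsum tens_module D2_hom])
  let ?Q = "quot_mod (T 3) ?I" and ?q = "\<lambda>x. ?I +>\<^bsub>T 3\<^esub> x"
  interpret QM: module R ?Q by (rule Q.quot_module)
  interpret T3: module R "T 3" by (rule tens_module)
  let ?g = "\<lambda>X Y Z. ?q (B (arr n [X, Y, Z]) w)"
  have Bc: "B (arr n [X, Y, Z]) w \<in> carrier (T 3)" if "splits {..n} X Y Z" for X Y Z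
    using mod_hom_closed[OF B_hom[of n "[X, Y, Z]" 2] w] that by (simp add: blocks_three eval_nat_numeral)
  have D2I: "D2 (x, a) \<in> ?I" if "x \<in> carrier (T 4)" "a \<in> carrier A" for x a
    using that by (intro imageI) (simp add: dsum_mod_def)
  obtain s where s: "\<And>v. s v \<in> carrier ?Q"
    "\<And>X Y Z. splits {..n} X Y Z \<Longrightarrow> ?g X Y Z = s (X @ Y @ Z) \<ominus>\<^bsub>?Q\<^esub> s (Z @ Y @ X)"
  \<comment> \<open>The letter 0 serves as the mark, as it belongs to {0, ..., n} for every
    n.\<close>
  proof (rule QM.word_potential[of "{..n}" 0 ?g])
    fix X Y Z assume "splits {..n} X Y Z"
    then show "?g X Y Z \<in> carrier ?Q" using mod_hom_closed[OF Q.quot_proj] Bc by blast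
  next
    fix W X Y Z assume sp: "splits {..n} (W @ X) Y Z"
    then have bl: "blocks n [W, X, Y, Z]" by (simp add: blocks_four)
    \<comment> \<open>Pushing \<open>w\<close> to [3] along (W, X, Y, Z) turns this instance of the
      relation into the value of \<open>D4\<close> at one tensor.\<close>
    let ?x = "B (arr n [W, X, Y, Z]) w"
    have x: "?x \<in> carrier (T 4)" using mod_hom_closed[OF B_hom[of n "[W, X, Y, Z]" 3] w] bl by (simp add: eval_nat_numeral)
    have comp: "B g ?x = B (Cmp DeltaS g (arr n [W, X, Y, Z])) w" if "is_ds_arrow g" "src g = 3" for g
      using B_Cmp[OF is_ds_arr[OF bl] that(1)] that(2) w by simp
    have sp': "splits {..n} Z (Y @ W) X" "splits {..n} (X @ Y @ W) [] Z" "splits {..n} Z (X @ Y) W"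
      using sp by (auto simp: splits_def)
    have eq: "D4 ?x = B (arr n [W @ X, Y, Z]) w \<oplus>\<^bsub>T 3\<^esub> B (arr n [Z, Y @ W, X]) w \<oplus>\<^bsub>T 3\<^esub>
        B (arr n [X @ Y @ W, [], Z]) w \<oplus>\<^bsub>T 3\<^esub> B (arr n [Z, X @ Y, W]) w"
      unfolding D4_def using four_Cmp[OF sp] comp[OF is_ds_arr[OF blocks_4(1)]] comp[OF is_ds_arr[OF blocks_4(2)]]
        comp[OF is_ds_arr[OF blocks_4(3)]] comp[OF is_ds_arr[OF blocks_4(4)]] by simp
    have "?q (D4 ?x) = \<zero>\<^bsub>?Q\<^esub>"
      using D2I[OF x A.zero_closed] D2_left[OF x] mod_hom_closed[OF D4_hom x] Q.quot_zero_iff by simp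
    then show "?g (W @ X) Y Z \<oplus>\<^bsub>?Q\<^esub> ?g Z (Y @ W) X \<oplus>\<^bsub>?Q\<^esub> ?g (X @ Y @ W) [] Z \<oplus>\<^bsub>?Q\<^esub> ?g Z (X @ Y) W = \<zero>\<^bsub>?Q\<^esub>"
      unfolding eq using Bc[OF sp] Bc[OF sp'(1)] Bc[OF sp'(2)] Bc[OF sp'(3)] by (simp add: mod_hom_add[OF Q.quot_proj])
  next
    fix X assume sp: "splits {..n} [] X []"
    then have bl: "blocks n [X]" by (simp add: blocks_one splits_def)
    \<comment> \<open>Likewise (1, X, 1) is \<open>mid\<close> after the one-word arrow X, so its
      value comes from the summand \<open>A\<close> of the source of \<open>D2\<close>.\<close>
    let ?y = "B (arr n [X]) w"
    have y: "?y \<in> carrier (T 1)" using mod_hom_closed[OF B_hom[OF bl, of 0] w] by simp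
    have "B mid ?y = B (arr n [[], X, []]) w"
      using B_Cmp[OF is_ds_arr[OF bl] is_ds_arr[OF blocks_4(5)]] mid_Cmp[OF bl] w by simp
    moreover have "D2 (\<zero>\<^bsub>T 4\<^esub>, iota ?y) = B mid ?y"
      using D2_right[OF mod_hom_closed[OF iota_hom y]] kappa_iota[OF y] by simp
    moreover have "D2 (\<zero>\<^bsub>T 4\<^esub>, iota ?y) \<in> ?I"
    proof -
      interpret T4: module R "T 4" by (rule tens_module)
      show ?thesis by (rule D2I[OF T4.zero_closed mod_hom_closed[OF iota_hom y]])
    qed
    ultimately show "?g [] X [] = \<zero>\<^bsub>?Q\<^esub>" using Q.quot_zero_iff[OF Bc[OF sp]] by simp
  qed (use that in auto)
  \<comment> \<open>An arrow to [0] is given by its fibre over 0, a permutation, so this extends the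
    potential \<open>s\<close> linearly to F0.\<close>
  let ?\<sigma> = "\<lambda>(_ :: unit, f). s (fib f 0)"
  let ?S = "lin R ?Q ?\<sigma>"
  have S_hom: "?S \<in> mod_hom R (F 0 n) ?Q"
    unfolding DS.free_fun_fob by (rule lin_hom[OF Q.quot_module]) (use s(1) in auto)
  have S_e: "?S (e n [v]) = s v" if "blocks n [v]" for v
  proof -
    have "((), arr n [v]) \<in> DS.free_arrows (DS.rep_index 0) n"
      using is_ds_arr[OF that] by (simp add: DS.rep_arrows)
    from lin_basis[OF Q.quot_module _ this, of ?\<sigma>] s(1) show ?thesis by (simp add: Pi_iff split_beta)
  qed
  have "?q (DS.rep_eval (Bsym R A) 2 \<zeta> w) = ?S (bd n \<zeta>)"
  proof (rule DS.rep_hom_eq[OF Q.quot_module _ mod_hom_comp[OF bd_hom S_hom] _ \<zeta>(1)])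
    show "(\<lambda>\<zeta>. ?q (DS.rep_eval (Bsym R A) 2 \<zeta> w)) \<in> mod_hom R (F 2 n) ?Q"
      by (rule mod_hom_comp[OF _ Q.quot_proj]) (use ev_hom[OF w, of 2] in simp)
    fix f assume f: "f \<in> Ar DeltaS" "Dom DeltaS f = n" "Cod DeltaS f = 2"
    then have f': "is_ds_arrow f" "tgt f = 2" "src f = n" by auto
    obtain X Y Z where X: "splits {..n} X Y Z" "f = arr n [X, Y, Z]"
      using ds_arrow_three[OF f'(1,2)] f'(3) by metis
    have b: "blocks n [X @ Y @ Z]" "blocks n [Z @ Y @ X]" using X(1) unfolding splits_def blocks_one by auto
    have "?q (DS.rep_eval (Bsym R A) 2 (DS.rep_arr f) w) = s (X @ Y @ Z) \<ominus>\<^bsub>?Q\<^esub> s (Z @ Y @ X)"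
      using ev_arr[OF f'(1,2)] f'(3) w s(2)[OF X(1)] X(2) by simp
    also have "\<dots> = ?S (bd n (DS.rep_arr f))"
      unfolding X(2) bd_e[OF X(1)] mod_hom_minus[OF F_module Q.quot_module S_hom e_closed1[OF b(1)] e_closed1[OF b(2)]]
        S_e[OF b(1)] S_e[OF b(2)] ..
    finally show "?q (DS.rep_eval (Bsym R A) 2 (DS.rep_arr f) w) = ?S (bd n (DS.rep_arr f))" .
  qed
  also have "\<dots> = \<zero>\<^bsub>?Q\<^esub>" unfolding \<zeta>(2) by (rule mod_hom_zero[OF F_module Q.quot_module S_hom])
  finally show ?thesis
    using Q.quot_zero_iff[OF ev2_closed[OF \<zeta>(1) w]] by simp
qed

lemma image_D2: "D2 ` carrier (dsum_mod (T 4) A) = mod_span R (T 3) relators"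
proof
  show "D2 ` carrier (dsum_mod (T 4) A) \<subseteq> mod_span R (T 3) relators" using D2_in_span by blast
  show "mod_span R (T 3) relators \<subseteq> D2 ` carrier (dsum_mod (T 4) A)"
    using relators_in_image
    by (intro mod_span_least submodule_image[OF dsum_module[OF tens_module A.module_axioms] tens_module D2_hom])
      (auto simp: relators_def)
qed

definition D1 where "D1 x = iota (B up x \<ominus>\<^bsub>T 1\<^esub> B down x)"

lemma D1_pure:
  assumes "a \<in> carrier A" "b \<in> carrier A" "c \<in> carrier A"
  shows "D1 (pure R A [a, b, c]) = a \<otimes>\<^bsub>A\<^esub> b \<otimes>\<^bsub>A\<^esub> c \<ominus>\<^bsub>A\<^esub> c \<otimes>\<^bsub>A\<^esub> b \<otimes>\<^bsub>A\<^esub> a"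
proof -
  have g: "[a, b, c] \<in> tens_gens A (2 + 1)" using assms by (simp add: tens_gens_def)
  have "B up (pure R A [a, b, c]) = pure R A [a \<otimes>\<^bsub>A\<^esub> b \<otimes>\<^bsub>A\<^esub> c]"
    "B down (pure R A [a, b, c]) = pure R A [c \<otimes>\<^bsub>A\<^esub> b \<otimes>\<^bsub>A\<^esub> a]"
    using Bsym_pure[OF is_ds_arr[OF blocks_up_down(1)], of "[a, b, c]"]
      Bsym_pure[OF is_ds_arr[OF blocks_up_down(2)], of "[a, b, c]"] g assms
    by (simp_all add: act_def AR.m_assoc)
  moreover have "pure R A [x] \<in> carrier (T 1)" if "x \<in> carrier A" for x
    using mod_hom_closed[OF kappa_hom that] by (simp add: kappa_def)
  ultimately show ?thesis
    unfolding D1_def using mod_hom_minus[OF tens_module A.module_axioms iota_hom] assms by (simp add: iota_pure)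
qed

lemma D4_pure:
  assumes "a \<in> carrier A" "b \<in> carrier A" "c \<in> carrier A" "x \<in> carrier A"
  shows "D4 (pure R A [a, b, c, x]) = pure R A [a \<otimes>\<^bsub>A\<^esub> b, c, x] \<oplus>\<^bsub>T 3\<^esub> pure R A [x, c \<otimes>\<^bsub>A\<^esub> a, b]
    \<oplus>\<^bsub>T 3\<^esub> pure R A [b \<otimes>\<^bsub>A\<^esub> c \<otimes>\<^bsub>A\<^esub> a, \<one>\<^bsub>A\<^esub>, x] \<oplus>\<^bsub>T 3\<^esub> pure R A [x, b \<otimes>\<^bsub>A\<^esub> c, a]"
proof -
  have g: "[a, b, c, x] \<in> tens_gens A (3 + 1)" using assms by (simp add: tens_gens_def)
  show ?thesis
    unfolding D4_def
    using Bsym_pure[OF is_ds_arr[OF blocks_4(1)], of "[a, b, c, x]"] Bsym_pure[OF is_ds_arr[OF blocks_4(2)], of "[a, b, c, x]"]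
      Bsym_pure[OF is_ds_arr[OF blocks_4(3)], of "[a, b, c, x]"] Bsym_pure[OF is_ds_arr[OF blocks_4(4)], of "[a, b, c, x]"] g assms
    by (simp add: act_def AR.m_assoc upt_rec)
qed

lemma mid_pure: "a \<in> carrier A \<Longrightarrow> B mid (kappa a) = pure R A [\<one>\<^bsub>A\<^esub>, a, \<one>\<^bsub>A\<^esub>]"
  using Bsym_pure[OF is_ds_arr[OF blocks_4(5)], of "[a]"]
  by (simp add: act_def kappa_def tens_gens_def upt_rec)

end

theorem theorem5:
  fixes R :: "'k ring"
    and A :: "('k, 'a) module"
    and P :: "nat \<Rightarrow> (nat, ds_arrow, 'k, 'p) catmod"
    and d :: "nat \<Rightarrow> nat \<Rightarrow> 'p \<Rightarrow> 'p"
    and \<epsilon> :: "nat \<Rightarrow> 'p \<Rightarrow> 'k"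
  assumes "cring R"
    and "unital_algebra R A"
    and "projective_resolution R DeltaS (const_functor R) P d \<epsilon>"
  shows "\<exists>D\<^sub>1 D\<^sub>2.
    D\<^sub>1 \<in> mod_hom R (tens_pow R A 3) A \<and>
    D\<^sub>2 \<in> mod_hom R (dsum_mod (tens_pow R A 4) A) (tens_pow R A 3) \<and>
    (\<forall>a \<in> carrier A. \<forall>b \<in> carrier A. \<forall>c \<in> carrier A.
       D\<^sub>1 (pure R A [a, b, c]) = a \<otimes>\<^bsub>A\<^esub> b \<otimes>\<^bsub>A\<^esub> c \<ominus>\<^bsub>A\<^esub> c \<otimes>\<^bsub>A\<^esub> b \<otimes>\<^bsub>A\<^esub> a) \<and>
    (\<forall>a \<in> carrier A. \<forall>b \<in> carrier A. \<forall>c \<in> carrier A. \<forall>e \<in> carrier A.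
       D\<^sub>2 (pure R A [a, b, c, e], \<zero>\<^bsub>A\<^esub>) =
         pure R A [a \<otimes>\<^bsub>A\<^esub> b, c, e]
         \<oplus>\<^bsub>tens_pow R A 3\<^esub> pure R A [e, c \<otimes>\<^bsub>A\<^esub> a, b]
         \<oplus>\<^bsub>tens_pow R A 3\<^esub> pure R A [b \<otimes>\<^bsub>A\<^esub> c \<otimes>\<^bsub>A\<^esub> a, \<one>\<^bsub>A\<^esub>, e]
         \<oplus>\<^bsub>tens_pow R A 3\<^esub> pure R A [e, b \<otimes>\<^bsub>A\<^esub> c, a]) \<and>
    (\<forall>a \<in> carrier A. D\<^sub>2 (\<zero>\<^bsub>tens_pow R A 4\<^esub>, a) = pure R A [\<one>\<^bsub>A\<^esub>, a, \<one>\<^bsub>A\<^esub>]) \<and>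
    (\<forall>z \<in> carrier (dsum_mod (tens_pow R A 4) A). D\<^sub>1 (D\<^sub>2 z) = \<zero>\<^bsub>A\<^esub>) \<and>
    mod_iso R (HS R A P d 0) (homology (tens_pow R A 3) D\<^sub>1 A (\<lambda>_. ()) zero_mod) \<and>
    mod_iso R (HS R A P d 1)
      (homology (dsum_mod (tens_pow R A 4) A) D\<^sub>2 (tens_pow R A 3) D\<^sub>1 A)"
proof -
  interpret algebra_over R A
    by (intro algebra_over.intro base_ring.intro algebra_over_axioms.intro assms)
  \<comment> \<open>Here c0 = [0] and c1 = [2], with the two order choices \<open>up\<close> and
    \<open>down\<close> as the arrows whose difference presents the constant functor.\<close>
  interpret PT: presented_tor R DeltaS P d \<epsilon> "Bsym R A" 0 2 up down
  proof (intro presented_tor.intro presented_tor_axioms.intro DS.cat_over_axioms assms(3) Bsym_functor)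
    fix n \<phi> assume "\<phi> \<in> carrier (F 0 n)" "DS.rep_ext (const_functor R) \<one>\<^bsub>R\<^esub> n \<phi> = \<zero>\<^bsub>R\<^esub>"
    then show "\<phi> \<in> DS.rep_ext (DS.rep 0) (DS.rep_arr up \<ominus>\<^bsub>F 0 2\<^esub> DS.rep_arr down) n ` carrier (F 2 n)"
      using augmentation_exact unfolding db_def by blast
  qed (use is_ds_arr[OF blocks_up_down(1)] is_ds_arr[OF blocks_up_down(2)] one_arrow in auto)
  have fob: "fob (Bsym R A) 0 = T 1" "fob (Bsym R A) 2 = T 3" by (simp_all add: Bsym_fob eval_nat_numeral)
  have D1: "D1 x = iota (PT.D x)" for x unfolding D1_def PT.D_def fob ..
  have b: "PT.b = db" unfolding PT.b_def db_def ..
  \<comment> \<open>This identity is the kernel computation: the image of \<open>D2\<close> is the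
    span of all evaluated cycles of F1, the form required by the comparison in degree 1.\<close>
  have J: "D2 ` carrier (dsum_mod (T 4) A) = PT.J"
    unfolding image_D2 PT.cycles_def relators_def fob(2) b by (simp add: Bsym_fob)
  have iso: "mod_iso R (tor R DeltaS P d (Bsym R A) 0) (homology (T 3) (\<lambda>x. iota (PT.D x)) A (\<lambda>_. ()) zero_mod)"
    "mod_iso R (tor R DeltaS P d (Bsym R A) (Suc 0)) (homology (dsum_mod (T 4) A) D2 (T 3) (\<lambda>x. iota (PT.D x)) A)"
    using PT.tor_iso[OF A.module_axioms _ _ _ _ dsum_module[OF tens_module A.module_axioms] _ J, of iota kappa, unfolded fob,
      OF iota_hom kappa_hom kappa_iota iota_kappa D2_hom] by auto
  show ?thesis
  proof (intro exI conjI ballI)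
    show "D1 \<in> mod_hom R (T 3) A"
      unfolding D1[abs_def] by (rule mod_hom_comp[OF PT.D_hom[unfolded fob] iota_hom])
    show "D2 \<in> mod_hom R (dsum_mod (T 4) A) (T 3)" by (rule D2_hom)
    show "D1 (D2 z) = \<zero>\<^bsub>A\<^esub>" if "z \<in> carrier (dsum_mod (T 4) A)" for z
    proof -
      have "D2 z \<in> PT.J" using J that by blast
      from PT.D_J[OF this] show ?thesis
        using mod_hom_zero[OF tens_module A.module_axioms iota_hom] by (simp add: D1 fob)
    qed
    show "mod_iso R (HS R A P d 0) (homology (T 3) D1 A (\<lambda>_. ()) zero_mod)"
      "mod_iso R (HS R A P d 1) (homology (dsum_mod (T 4) A) D2 (T 3) D1 A)"
      using iso unfolding HS_def D1[abs_def] by simp_all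
    fix a b c assume abc: "a \<in> carrier A" "b \<in> carrier A" "c \<in> carrier A"
    show "D1 (pure R A [a, b, c]) = a \<otimes>\<^bsub>A\<^esub> b \<otimes>\<^bsub>A\<^esub> c \<ominus>\<^bsub>A\<^esub> c \<otimes>\<^bsub>A\<^esub> b \<otimes>\<^bsub>A\<^esub> a"
      by (rule D1_pure[OF abc])
    fix x assume x: "x \<in> carrier A"
    have "pure R A [a, b, c, x] \<in> carrier (T 4)" using pure_closed[of "[a, b, c, x]" 4] abc x by (simp add: tens_gens_def)
    then show "D2 (pure R A [a, b, c, x], \<zero>\<^bsub>A\<^esub>) =
         pure R A [a \<otimes>\<^bsub>A\<^esub> b, c, x] \<oplus>\<^bsub>T 3\<^esub> pure R A [x, c \<otimes>\<^bsub>A\<^esub> a, b]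
         \<oplus>\<^bsub>T 3\<^esub> pure R A [b \<otimes>\<^bsub>A\<^esub> c \<otimes>\<^bsub>A\<^esub> a, \<one>\<^bsub>A\<^esub>, x] \<oplus>\<^bsub>T 3\<^esub> pure R A [x, b \<otimes>\<^bsub>A\<^esub> c, a]"
      using D2_left D4_pure[OF abc x] by simp
  next
    fix a assume "a \<in> carrier A"
    then show "D2 (\<zero>\<^bsub>T 4\<^esub>, a) = pure R A [\<one>\<^bsub>A\<^esub>, a, \<one>\<^bsub>A\<^esub>]" using D2_right mid_pure by simp
  qed
qed

end
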